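(* Let $\mathbb{F}_\theta^+$ be an aperiodic single vertex $2$-graph and let $(S,T)$ be a Cuntz-type representation of $\mathbb{F}_\theta^+$ on a Hilbert space $\mathcal{H}$. Let $\mathfrak{A}=\overline{\mathrm{alg}}^{\|\cdot\|}\{I,S_1,\ldots,S_m,T_1,\ldots,T_n\}$. Then, given any $\mathfrak{A}$-invariant projection $P$ on $\mathcal{H}$ (that is, any projection $P$ such that $P\mathcal{H}$ is an invariant subspace for $\mathfrak{A}$), the operator algebra $P\mathfrak{A}P$ is completely isometrically isomorphic to $\mathcal{A}_\theta$. That is, the representation $(PSP,PTP)$, where $PSP=[PS_1P,\ldots,PS_mP]$ and $PTP=[PT_1P,\ldots,PT_nP]$ act on $P\mathcal{H}$, is rigid.
   Context: Single vertex $2$-graph: for positive integers $m,n$ and a permutation $\theta$ of $\{1,\ldots,m\}\times\{1,\ldots,n\}$, $\mathbb{F}_\theta^+$ is the unital cancellative semigroup generated by $e_1,\ldots,e_m,f_1,\ldots,f_n$, where the $e_i$ form a copy of the free semigroup $\mathbb{F}_m^+$, the $f_j$ form a copy of the free semigroup $\mathbb{F}_n^+$, and $e_if_j=f_{j'}e_{i'}$ whenever $\theta(i,j)=(i',j')$. For a word $u=i_1\cdots i_k$ write $e_u=e_{i_1}\cdots e_{i_k}$, and similarly $f_v$; $|u|$ is the length of $u$. Periodicity: if $m,n\ge 2$, $\mathbb{F}_\theta^+$ is periodic if and only if there are integers $a,b>0$ and a bijection $\gamma:\{u\in\mathbb{F}_m^+:|u|=a\}\to\{v\in\mathbb{F}_n^+:|v|=b\}$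 such that $e_uf_v=f_{\gamma(u)}e_{\gamma^{-1}(v)}$ for all $|u|=a$, $|v|=b$. If $m=1$ or $n=1$ then $\mathbb{F}_\theta^+$ is periodic. It is aperiodic if it is not periodic. Representations: an isometric representation $(S,T)$ of $\mathbb{F}_\theta^+$ on $\mathcal{H}$ consists of row-operators $S=[S_1,\ldots,S_m]$ and $T=[T_1,\ldots,T_n]$ with $S_i,T_j\in\mathcal{B}(\mathcal{H})$, $S_i^*S_j=\delta_{i,j}I$, $T_k^*T_l=\delta_{k,l}I$, and $S_iT_j=T_{j'}S_{i'}$ whenever $\theta(i,j)=(i',j')$. It is of Cuntz-type if moreover $\sum_iS_iS_i^*=I=\sum_jT_jT_j^*$. Left-regular representation: on $\ell^2(\mathbb{F}_\theta^+)$ with orthonormal basis $\{\xi_w:w\in\mathbb{F}_\theta^+\}$ let $E_i\xi_w=\xi_{e_iw}$ and $F_j\xi_w=\xi_{f_jw}$. $\mathcal{A}_\theta$ is the norm-closed unital algebra generated by $E_1,\ldots,E_m,F_1,\ldots,F_n$. An isometric representation $(S,T)$ of $\mathbb{F}_\theta^+$ is rigid if $\overline{\mathrm{alg}}^{\|\cdot\|}\{I,S_1,\ldots,S_m,T_1,\ldots,T_n\}$ is completely isometrically isomorphic to $\mathcal{A}_\theta$. *)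

theory Defs
  imports "HOL-Analysis.Analysis"
begin

section \<open>Complex Hilbert spaces\<close>

class scaleC =
  fixes scaleC :: "complex \<Rightarrow> 'a \<Rightarrow> 'a"  (infixr \<open>*\<^sub>C\<close> 75)

text \<open>The inner product is linear in its first argument. Positive definiteness
  is part of \<open>norm_eq_sqrt_cinner\<close>, completeness part of \<^class>\<open>banach\<close>.\<close>

class complex_hilbert_space = banach + scaleC +
  fixes cinner :: "'a \<Rightarrow> 'a \<Rightarrow> complex"
  assumes scaleC_add_right: "c *\<^sub>C (x + y) = c *\<^sub>C x + c *\<^sub>C y"
    and scaleC_add_left: "(c + d) *\<^sub>C x = c *\<^sub>C x + d *\<^sub>C x"
    and scaleC_scaleC: "c *\<^sub>C d *\<^sub>C x = (c * d) *\<^sub>C x"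
    and scaleC_of_real: "complex_of_real r *\<^sub>C x = r *\<^sub>R x"
    and cinner_add_left: "cinner (x + y) z = cinner x z + cinner y z"
    and cinner_scaleC_left: "cinner (c *\<^sub>C x) y = c * cinner x y"
    and cinner_commute: "cinner x y = cnj (cinner y x)"
    and norm_eq_sqrt_cinner: "norm x = sqrt (Re (cinner x x))"

lemma norm_scaleC:
  fixes x :: "'a :: complex_hilbert_space"
  shows "norm (c *\<^sub>C x) = cmod c * norm x"
proof -
  have "cinner (c *\<^sub>C x) (c *\<^sub>C x) = c * cnj (cinner (c *\<^sub>C x) x)"
    by (metis cinner_commute cinner_scaleC_left)
  also have "\<dots> = c * cnj c * cinner x x"
    by (metis cinner_commute cinner_scaleC_left complex_cnj_mult mult.assoc)
  also have "c * cnj c = of_real ((cmod c)\<^sup>2)"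
    by (rule complex_norm_square[symmetric])
  finally have "Re (cinner (c *\<^sub>C x) (c *\<^sub>C x)) = (cmod c)\<^sup>2 * Re (cinner x x)"
    by simp
  then show ?thesis
    by (simp add: norm_eq_sqrt_cinner real_sqrt_mult)
qed

lemma scaleC_scaleR:
  fixes x :: "'a :: complex_hilbert_space"
  shows "c *\<^sub>C r *\<^sub>R x = r *\<^sub>R c *\<^sub>C x"
  by (metis mult.commute scaleC_of_real scaleC_scaleC)

lemma bounded_linear_scaleC:
  "bounded_linear (\<lambda>x :: 'a :: complex_hilbert_space. c *\<^sub>C x)"
  by (rule bounded_linear_intro[where K = "cmod c"])
    (simp_all add: scaleC_add_right scaleC_scaleR norm_scaleC mult.commute)


section \<open>Operators\<close>

text \<open>The type \<open>'a \<Rightarrow>\<^sub>L 'b\<close> consists of the \<^emph>\<open>real\<close>-linear bounded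
  operators; complex linearity is a separate predicate.\<close>

definition clinear_op :: "('a :: complex_hilbert_space \<Rightarrow>\<^sub>L 'b :: complex_hilbert_space) \<Rightarrow> bool" where
  "clinear_op T \<longleftrightarrow> (\<forall>c x. T (c *\<^sub>C x) = c *\<^sub>C T x)"

instantiation blinfun :: (real_normed_vector, complex_hilbert_space) scaleC
begin

lift_definition scaleC_blinfun :: "complex \<Rightarrow> 'a \<Rightarrow>\<^sub>L 'b \<Rightarrow> 'a \<Rightarrow>\<^sub>L 'b"
  is "\<lambda>c T x. c *\<^sub>C T x"
  by (rule bounded_linear_compose[OF bounded_linear_scaleC])

instance ..

end

definition adj :: "('a :: complex_hilbert_space \<Rightarrow>\<^sub>L 'a) \<Rightarrow> ('a \<Rightarrow>\<^sub>L 'a)" where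
  "adj T = (THE T' :: 'a \<Rightarrow>\<^sub>L 'a. \<forall>x y. cinner (T x) y = cinner x (T' y))"

definition projection_op :: "('a :: complex_hilbert_space \<Rightarrow>\<^sub>L 'a) \<Rightarrow> bool" where
  "projection_op P \<longleftrightarrow> clinear_op P \<and> P o\<^sub>L P = P \<and> adj P = P"

text \<open>A closed subspace is a Hilbert space in its own right. If \<open>U\<close> is the projection
  onto it, its bounded operators are identified with the corner \<open>U B(H) U\<close>, whose unit is
  \<open>U\<close>. This identification preserves sums, products, adjoints and matrix norms. The whole
  space is the case \<open>U = id_blinfun\<close>.\<close>

definition bounded_ops :: "('a :: complex_hilbert_space \<Rightarrow>\<^sub>L 'a) \<Rightarrow> ('a \<Rightarrow>\<^sub>L 'a) set" where
  "bounded_ops U = {T. clinear_op T \<and> U o\<^sub>L T = T \<and> T o\<^sub>L U = T}"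

inductive_set unital_alg ::
    "('a :: complex_hilbert_space \<Rightarrow>\<^sub>L 'a) \<Rightarrow> ('a \<Rightarrow>\<^sub>L 'a) set \<Rightarrow> ('a \<Rightarrow>\<^sub>L 'a) set"
  for U G where
  unit: "U \<in> unital_alg U G"
| gen: "T \<in> G \<Longrightarrow> T \<in> unital_alg U G"
| add: "S \<in> unital_alg U G \<Longrightarrow> T \<in> unital_alg U G \<Longrightarrow> S + T \<in> unital_alg U G"
| scale: "T \<in> unital_alg U G \<Longrightarrow> c *\<^sub>C T \<in> unital_alg U G"
| mult: "S \<in> unital_alg U G \<Longrightarrow> T \<in> unital_alg U G \<Longrightarrow> S o\<^sub>L T \<in> unital_alg U G"

text \<open>The topology of \<open>'a \<Rightarrow>\<^sub>L 'a\<close> is that of the operator norm.\<close>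

definition closed_unital_alg ::
    "('a :: complex_hilbert_space \<Rightarrow>\<^sub>L 'a) \<Rightarrow> ('a \<Rightarrow>\<^sub>L 'a) set \<Rightarrow> ('a \<Rightarrow>\<^sub>L 'a) set" where
  "closed_unital_alg U G = closure (unital_alg U G)"

text \<open>The norm of the \<open>k \<times> k\<close> operator matrix \<open>[A i j]\<close> on the \<open>k\<close>-fold Hilbert space
  direct sum. For entries in a corner \<open>U B(H) U\<close> it is the norm on the
  \<open>k\<close>-fold sum of \<open>U H\<close>.\<close>

definition matrix_norm :: "nat \<Rightarrow> (nat \<Rightarrow> nat \<Rightarrow> ('a :: complex_hilbert_space \<Rightarrow>\<^sub>L 'a)) \<Rightarrow> real" where
  "matrix_norm k A =
    (SUP x \<in> {x :: nat \<Rightarrow> 'a. L2_set (\<lambda>j. norm (x j)) {..<k} \<le> 1}.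
      L2_set (\<lambda>i. norm (\<Sum>j<k. A i j (x j))) {..<k})"

definition completely_isometrically_isomorphic ::
    "('a :: complex_hilbert_space \<Rightarrow>\<^sub>L 'a) set \<Rightarrow> ('b :: complex_hilbert_space \<Rightarrow>\<^sub>L 'b) set \<Rightarrow> bool" where
  "completely_isometrically_isomorphic \<A> \<B> \<longleftrightarrow>
    (\<exists>\<phi>. bij_betw \<phi> \<A> \<B>
      \<and> (\<forall>a\<in>\<A>. \<forall>b\<in>\<A>. \<phi> (a + b) = \<phi> a + \<phi> b)
      \<and> (\<forall>c. \<forall>a\<in>\<A>. \<phi> (c *\<^sub>C a) = c *\<^sub>C \<phi> a)
      \<and> (\<forall>a\<in>\<A>. \<forall>b\<in>\<A>. \<phi> (a o\<^sub>L b) = \<phi> a o\<^sub>L \<phi> b)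
      \<and> (\<forall>k A. (\<forall>i<k. \<forall>j<k. A i j \<in> \<A>) \<longrightarrow>
            matrix_norm k (\<lambda>i j. \<phi> (A i j)) = matrix_norm k A))"


section \<open>Square summable families\<close>

typedef 'a ell2 = "{f :: 'a \<Rightarrow> complex. (\<lambda>x. (cmod (f x))\<^sup>2) summable_on UNIV}"
  by (rule exI[where x = "\<lambda>_. 0"]) simp

setup_lifting type_definition_ell2

lemma square_summable_iff:
  "(\<lambda>x. (cmod (f x))\<^sup>2) summable_on UNIV \<longleftrightarrow>
    (\<exists>C. \<forall>F. finite F \<longrightarrow> L2_set (\<lambda>x. cmod (f x)) F \<le> C)"
proof
  assume s: "(\<lambda>x. (cmod (f x))\<^sup>2) summable_on UNIV"
  show "\<exists>C. \<forall>F. finite F \<longrightarrow> L2_set (\<lambda>x. cmod (f x)) F \<le> C"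
    by (rule exI[where x = "sqrt (infsum (\<lambda>x. (cmod (f x))\<^sup>2) UNIV)"])
      (auto simp: L2_set_def intro!: finite_sum_le_infsum s)
next
  assume "\<exists>C. \<forall>F. finite F \<longrightarrow> L2_set (\<lambda>x. cmod (f x)) F \<le> C"
  then obtain C where C: "\<And>F. finite F \<Longrightarrow> L2_set (\<lambda>x. cmod (f x)) F \<le> C" by blast
  have "(\<Sum>x\<in>F. (cmod (f x))\<^sup>2) \<le> C\<^sup>2" if "finite F" for F
    using C[OF that] unfolding L2_set_def by (simp add: sqrt_le_D)
  then show "(\<lambda>x. (cmod (f x))\<^sup>2) summable_on UNIV"
    by (intro nonneg_bdd_above_summable_on) (auto intro!: bdd_aboveI[where M = "C\<^sup>2"])
qed

lemma sqrt_infsum_le_iff: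
  assumes "(\<lambda>x. (cmod (f x))\<^sup>2) summable_on UNIV"
  shows "sqrt (infsum (\<lambda>x. (cmod (f x))\<^sup>2) UNIV) \<le> C \<longleftrightarrow>
    (\<forall>F. finite F \<longrightarrow> L2_set (\<lambda>x. cmod (f x)) F \<le> C)"
proof
  assume *: "sqrt (infsum (\<lambda>x. (cmod (f x))\<^sup>2) UNIV) \<le> C"
  show "\<forall>F. finite F \<longrightarrow> L2_set (\<lambda>x. cmod (f x)) F \<le> C"
    by (intro allI impI order_trans[OF _ *])
      (auto simp: L2_set_def intro!: finite_sum_le_infsum assms)
next
  assume *: "\<forall>F. finite F \<longrightarrow> L2_set (\<lambda>x. cmod (f x)) F \<le> C"
  then have "0 \<le> C" by (metis L2_set_empty finite.emptyI)
  moreover have "(\<Sum>x\<in>F. (cmod (f x))\<^sup>2) \<le> C\<^sup>2" if "finite F" for F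
    using * that unfolding L2_set_def by (simp add: sqrt_le_D)
  then have "infsum (\<lambda>x. (cmod (f x))\<^sup>2) UNIV \<le> C\<^sup>2"
    by (intro infsum_le_finite_sums assms)
  ultimately show "sqrt (infsum (\<lambda>x. (cmod (f x))\<^sup>2) UNIV) \<le> C"
    by (rule real_le_lsqrt)
qed

lemma L2_set_cmod_add_le:
  "L2_set (\<lambda>x. cmod (f x + g x)) F \<le> L2_set (\<lambda>x. cmod (f x)) F + L2_set (\<lambda>x. cmod (g x)) F"
  by (rule order_trans[OF L2_set_mono L2_set_triangle_ineq]) (auto simp: norm_triangle_ineq)

lemma square_summable_add:
  assumes "(\<lambda>x. (cmod (f x))\<^sup>2) summable_on UNIV" "(\<lambda>x. (cmod (g x))\<^sup>2) summable_on UNIV"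
  shows "(\<lambda>x. (cmod (f x + g x))\<^sup>2) summable_on UNIV"
proof -
  obtain C D where "\<And>F. finite F \<Longrightarrow> L2_set (\<lambda>x. cmod (f x)) F \<le> C"
    and "\<And>F. finite F \<Longrightarrow> L2_set (\<lambda>x. cmod (g x)) F \<le> D"
    using assms unfolding square_summable_iff by blast
  then have "L2_set (\<lambda>x. cmod (f x + g x)) F \<le> C + D" if "finite F" for F
    using that by (intro order_trans[OF L2_set_cmod_add_le] add_mono)
  then show ?thesis unfolding square_summable_iff by blast
qed

lemma square_summable_scale:
  assumes "(\<lambda>x. (cmod (f x))\<^sup>2) summable_on UNIV"
  shows "(\<lambda>x. (cmod (c * f x))\<^sup>2) summable_on UNIV"
  using assms by (simp add: norm_mult power_mult_distrib summable_on_cmult_right)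

lemma square_summable_mult:
  assumes "(\<lambda>x. (cmod (f x))\<^sup>2) summable_on UNIV" "(\<lambda>x. (cmod (g x))\<^sup>2) summable_on UNIV"
  shows "(\<lambda>x. f x * cnj (g x)) summable_on UNIV"
proof (rule abs_summable_summable, rule Infinite_Sum.abs_summable_on_comparison_test)
  show "(\<lambda>x. norm ((cmod (f x))\<^sup>2 + (cmod (g x))\<^sup>2)) summable_on UNIV"
    using summable_on_add[OF assms] by simp
  show "norm (f x * cnj (g x)) \<le> norm ((cmod (f x))\<^sup>2 + (cmod (g x))\<^sup>2)" for x
  proof -
    have "0 \<le> cmod (f x) * cmod (g x)" by simp
    then have "cmod (f x) * cmod (g x) \<le> (cmod (f x))\<^sup>2 + (cmod (g x))\<^sup>2"
      using sum_squares_bound[of "cmod (f x)" "cmod (g x)"] by linarith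
    then show ?thesis by (simp add: norm_mult)
  qed
qed

instantiation ell2 :: (type) real_normed_vector
begin

lift_definition zero_ell2 :: "'a ell2" is "\<lambda>_. 0" by simp
lift_definition plus_ell2 :: "'a ell2 \<Rightarrow> 'a ell2 \<Rightarrow> 'a ell2" is "\<lambda>f g x. f x + g x"
  by (rule square_summable_add)
lift_definition uminus_ell2 :: "'a ell2 \<Rightarrow> 'a ell2" is "\<lambda>f x. - f x" by simp
lift_definition minus_ell2 :: "'a ell2 \<Rightarrow> 'a ell2 \<Rightarrow> 'a ell2" is "\<lambda>f g x. f x - g x"
  subgoal for f g using square_summable_add[of f "\<lambda>x. - g x"] by simp
  done
lift_definition scaleR_ell2 :: "real \<Rightarrow> 'a ell2 \<Rightarrow> 'a ell2" is "\<lambda>r f x. of_real r * f x"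
  by (rule square_summable_scale)
lift_definition norm_ell2 :: "'a ell2 \<Rightarrow> real"
  is "\<lambda>f. sqrt (\<Sum>\<^sub>\<infinity>x. (cmod (f x))\<^sup>2)" .

definition sgn_ell2 :: "'a ell2 \<Rightarrow> 'a ell2" where
  "sgn_ell2 f = inverse (norm f) *\<^sub>R f"
definition dist_ell2 :: "'a ell2 \<Rightarrow> 'a ell2 \<Rightarrow> real" where
  "dist_ell2 f g = norm (f - g)"
definition uniformity_ell2 :: "('a ell2 \<times> 'a ell2) filter" where
  "uniformity_ell2 = (INF e\<in>{0 <..}. principal {(f, g). dist f g < e})"
definition open_ell2 :: "'a ell2 set \<Rightarrow> bool" where
  "open_ell2 S \<longleftrightarrow> (\<forall>f\<in>S. \<forall>\<^sub>F (f', g) in uniformity. f' = f \<longrightarrow> g \<in> S)"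

lemma norm_ell2_le_iff:
  "norm f \<le> C \<longleftrightarrow> (\<forall>F. finite F \<longrightarrow> L2_set (\<lambda>x. cmod (Rep_ell2 f x)) F \<le> C)"
  using Rep_ell2[of f] by (simp add: norm_ell2.rep_eq sqrt_infsum_le_iff)

lemma L2_set_le_norm_ell2: "finite F \<Longrightarrow> L2_set (\<lambda>x. cmod (Rep_ell2 f x)) F \<le> norm f"
  using norm_ell2_le_iff[of f "norm f"] by blast

lemma cmod_Rep_ell2_le: "cmod (Rep_ell2 f x) \<le> norm f"
  using L2_set_le_norm_ell2[of "{x}" f] by simp

instance
proof
  fix f g h :: "'a ell2" and r s :: real
  show "f + g + h = f + (g + h)" by transfer (simp add: fun_eq_iff)
  show "f + g = g + f" by transfer (simp add: fun_eq_iff)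
  show "0 + f = f" by transfer simp
  show "- f + f = 0" by transfer simp
  show "f - g = f + - g" by transfer simp
  show "r *\<^sub>R (f + g) = r *\<^sub>R f + r *\<^sub>R g" by transfer (simp add: algebra_simps)
  show "(r + s) *\<^sub>R f = r *\<^sub>R f + s *\<^sub>R f" by transfer (simp add: algebra_simps)
  show "r *\<^sub>R s *\<^sub>R f = (r * s) *\<^sub>R f" by transfer (simp add: algebra_simps)
  show "1 *\<^sub>R f = f" by transfer simp
  show "sgn f = inverse (norm f) *\<^sub>R f" by (rule sgn_ell2_def)
  show "dist f g = norm (f - g)" by (rule dist_ell2_def)
  show "uniformity = (INF e\<in>{0 <..}. principal {(f :: 'a ell2, g). dist f g < e})"
    by (rule uniformity_ell2_def)
  show "open S \<longleftrightarrow> (\<forall>f\<in>S. \<forall>\<^sub>F (f', g) in uniformity. f' = f \<longrightarrow> g \<in> S)" for S :: "'a ell2 set"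
    by (rule open_ell2_def)
  show "norm f = 0 \<longleftrightarrow> f = 0"
  proof
    assume "norm f = 0"
    then have "Rep_ell2 f x = 0" for x using cmod_Rep_ell2_le[of f x] by simp
    then show "f = 0" by (simp add: Rep_ell2_inject[symmetric] zero_ell2.rep_eq fun_eq_iff)
  qed (simp add: norm_ell2.rep_eq zero_ell2.rep_eq)
  show "norm (f + g) \<le> norm f + norm g"
    unfolding norm_ell2_le_iff plus_ell2.rep_eq
    by (intro allI impI order_trans[OF L2_set_cmod_add_le] add_mono L2_set_le_norm_ell2)
  show "norm (r *\<^sub>R f) = \<bar>r\<bar> * norm f"
    by (simp add: norm_ell2.rep_eq scaleR_ell2.rep_eq norm_mult power_mult_distrib
        infsum_cmult_right' real_sqrt_mult)
qed

end

instance ell2 :: (type) banach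
proof
  fix X :: "nat \<Rightarrow> 'a ell2"
  assume X: "Cauchy X"
  define l where "l = (\<lambda>x. lim (\<lambda>n. Rep_ell2 (X n) x))"
  have "Cauchy (\<lambda>n. Rep_ell2 (X n) x)" for x
  proof (rule metric_CauchyI)
    fix e :: real assume "0 < e"
    then obtain M where M: "dist (X m) (X n) < e" if "m \<ge> M" "n \<ge> M" for m n
      using X unfolding Cauchy_def by blast
    have "dist (Rep_ell2 (X m) x) (Rep_ell2 (X n) x) < e" if "m \<ge> M" "n \<ge> M" for m n
      using cmod_Rep_ell2_le[of "X m - X n" x] M[OF that]
      by (simp add: dist_ell2_def dist_norm minus_ell2.rep_eq)
    then show "\<exists>M. \<forall>m\<ge>M. \<forall>n\<ge>M. dist (Rep_ell2 (X m) x) (Rep_ell2 (X n) x) < e" by blast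
  qed
  then have "convergent (\<lambda>n. Rep_ell2 (X n) x)" for x
    by (simp add: Cauchy_convergent_iff)
  then have l: "(\<lambda>n. Rep_ell2 (X n) x) \<longlonglongrightarrow> l x" for x
    unfolding l_def by (simp add: convergent_LIMSEQ_iff)
  have tail: "\<exists>M. \<forall>n\<ge>M. \<forall>F. finite F \<longrightarrow> L2_set (\<lambda>x. cmod (Rep_ell2 (X n) x - l x)) F \<le> e"
    if "0 < e" for e
  proof -
    obtain M where M: "dist (X m) (X n) < e" if "m \<ge> M" "n \<ge> M" for m n
      using X \<open>0 < e\<close> unfolding Cauchy_def by blast
    have "L2_set (\<lambda>x. cmod (Rep_ell2 (X n) x - l x)) F \<le> e" if "n \<ge> M" "finite F" for n F
    proof (rule tendsto_upperbound)
      show "(\<lambda>m. L2_set (\<lambda>x. cmod (Rep_ell2 (X n) x - Rep_ell2 (X m) x)) F) \<longlonglongrightarrow>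
          L2_set (\<lambda>x. cmod (Rep_ell2 (X n) x - l x)) F"
        unfolding L2_set_def by (intro tendsto_intros l)
      show "\<forall>\<^sub>F m in sequentially. L2_set (\<lambda>x. cmod (Rep_ell2 (X n) x - Rep_ell2 (X m) x)) F \<le> e"
        using eventually_ge_at_top[of M]
      proof eventually_elim
        case (elim m)
        then have "norm (X n - X m) \<le> e" using M[of n m] that by (simp add: dist_ell2_def)
        then show ?case
          using L2_set_le_norm_ell2[OF \<open>finite F\<close>, of "X n - X m"]
          by (simp add: minus_ell2.rep_eq)
      qed
    qed simp
    then show ?thesis by blast
  qed
  have "(\<lambda>x. (cmod (l x))\<^sup>2) summable_on UNIV"
  proof -
    obtain M where "\<And>F. finite F \<Longrightarrow> L2_set (\<lambda>x. cmod (Rep_ell2 (X M) x - l x)) F \<le> 1"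
      using tail[of 1] by auto
    then have "(\<lambda>x. (cmod (Rep_ell2 (X M) x - l x))\<^sup>2) summable_on UNIV"
      unfolding square_summable_iff by blast
    then have "(\<lambda>x. (cmod (l x - Rep_ell2 (X M) x))\<^sup>2) summable_on UNIV"
      by (simp only: norm_minus_commute)
    from square_summable_add[OF this, of "Rep_ell2 (X M)"] Rep_ell2[of "X M"]
    show ?thesis by simp
  qed
  then have L: "Rep_ell2 (Abs_ell2 l) = l" by (simp add: Abs_ell2_inverse)
  have "X \<longlonglongrightarrow> Abs_ell2 l"
  proof (rule metric_LIMSEQ_I)
    fix e :: real assume "0 < e"
    then obtain M where M: "\<forall>n\<ge>M. \<forall>F. finite F \<longrightarrow>
        L2_set (\<lambda>x. cmod (Rep_ell2 (X n) x - l x)) F \<le> e / 2"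
      using tail[of "e / 2"] by auto
    have "dist (X n) (Abs_ell2 l) < e" if "n \<ge> M" for n
    proof -
      have "norm (X n - Abs_ell2 l) \<le> e / 2"
        unfolding norm_ell2_le_iff minus_ell2.rep_eq L using M that by blast
      then show ?thesis using \<open>0 < e\<close> by (simp add: dist_ell2_def)
    qed
    then show "\<exists>M. \<forall>n\<ge>M. dist (X n) (Abs_ell2 l) < e" by blast
  qed
  then show "convergent X" by (auto simp: convergent_def)
qed

instantiation ell2 :: (type) complex_hilbert_space
begin

lift_definition scaleC_ell2 :: "complex \<Rightarrow> 'a ell2 \<Rightarrow> 'a ell2" is "\<lambda>c f x. c * f x"
  by (rule square_summable_scale)
lift_definition cinner_ell2 :: "'a ell2 \<Rightarrow> 'a ell2 \<Rightarrow> complex"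
  is "\<lambda>f g. \<Sum>\<^sub>\<infinity>x. f x * cnj (g x)" .

instance
proof
  fix f g h :: "'a ell2" and r :: real and c d :: complex
  show "c *\<^sub>C (f + g) = c *\<^sub>C f + c *\<^sub>C g" by transfer (simp add: algebra_simps)
  show "(c + d) *\<^sub>C f = c *\<^sub>C f + d *\<^sub>C f" by transfer (simp add: algebra_simps)
  show "c *\<^sub>C d *\<^sub>C f = (c * d) *\<^sub>C f" by transfer (simp add: algebra_simps)
  show "complex_of_real r *\<^sub>C f = r *\<^sub>R f" by transfer simp
  show "cinner (f + g) h = cinner f h + cinner g h"
    by transfer (simp add: distrib_right infsum_add square_summable_mult)
  show "cinner (c *\<^sub>C f) g = c * cinner f g"
    by transfer (simp add: mult.assoc infsum_cmult_right')
  show "cinner f g = cnj (cinner g f)"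
    by transfer (simp flip: infsum_cnj add: mult.commute)
  show "norm f = sqrt (Re (cinner f f))"
  proof -
    have "cinner f f = (\<Sum>\<^sub>\<infinity>x. of_real ((cmod (Rep_ell2 f x))\<^sup>2))"
      unfolding cinner_ell2.rep_eq by (intro infsum_cong) (simp only: complex_norm_square)
    also have "\<dots> = of_real (\<Sum>\<^sub>\<infinity>x. (cmod (Rep_ell2 f x))\<^sup>2)"
      using Rep_ell2[of f] by (intro infsumI has_sum_of_real has_sum_infsum) simp
    finally show ?thesis by (simp add: norm_ell2.rep_eq)
  qed
qed

end

lift_definition ell2_basis :: "'a \<Rightarrow> 'a ell2" (\<open>\<xi>\<close>) is "\<lambda>w x. of_bool (x = w)"
proof -
  fix w :: 'a
  have "(\<lambda>x. (cmod (of_bool (x = w)))\<^sup>2) summable_on {w}" by (rule summable_on_finite) simp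
  then show "(\<lambda>x. (cmod (of_bool (x = w)))\<^sup>2) summable_on UNIV"
    by (rule summable_on_cong_neutral[THEN iffD1, rotated -1]) auto
qed


section \<open>Single vertex 2-graphs\<close>

text \<open>The numbers \<open>m\<close> and \<open>n\<close> of generators are the cardinalities of the finite index types
  \<open>'m\<close> and \<open>'n\<close>; the letter \<open>Inl i\<close> stands for \<open>e_i\<close>, and \<open>Inr j\<close> for \<open>f_j\<close>. The semigroup is
  the monoid presented by these generators and the relations
  \<open>e_i f_j = f_j' e_i'\<close>, where \<open>\<theta> (i, j) = (i', j')\<close>. It is cancellative and the \<open>e_i\<close> and the
  \<open>f_j\<close> generate free semigroups whenever \<open>\<theta>\<close> is bijective.\<close>

inductive commute_step ::
    "('m \<times> 'n \<Rightarrow> 'm \<times> 'n) \<Rightarrow> ('m + 'n) list \<Rightarrow> ('m + 'n) list \<Rightarrow> bool" for \<theta> where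
  "\<theta> (i, j) = (i', j') \<Longrightarrow>
    commute_step \<theta> (x @ [Inl i, Inr j] @ y) (x @ [Inr j', Inl i'] @ y)"

definition word_rel :: "('m \<times> 'n \<Rightarrow> 'm \<times> 'n) \<Rightarrow> (('m + 'n) list \<times> ('m + 'n) list) set" where
  "word_rel \<theta> = {(x, y). equivclp (commute_step \<theta>) x y}"

definition sgrp :: "('m \<times> 'n \<Rightarrow> 'm \<times> 'n) \<Rightarrow> ('m + 'n) list set set" where
  "sgrp \<theta> = UNIV // word_rel \<theta>"

definition sclass :: "('m \<times> 'n \<Rightarrow> 'm \<times> 'n) \<Rightarrow> ('m + 'n) list \<Rightarrow> ('m + 'n) list set" where
  "sclass \<theta> x = word_rel \<theta> `` {x}"

definition smult :: "('m \<times> 'n \<Rightarrow> 'm \<times> 'n) \<Rightarrow>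
    ('m + 'n) list set \<Rightarrow> ('m + 'n) list set \<Rightarrow> ('m + 'n) list set" where
  "smult \<theta> X Y = (\<Union>x\<in>X. \<Union>y\<in>Y. sclass \<theta> (x @ y))"

definition e_word :: "('m \<times> 'n \<Rightarrow> 'm \<times> 'n) \<Rightarrow> 'm list \<Rightarrow> ('m + 'n) list set" where
  "e_word \<theta> u = sclass \<theta> (map Inl u)"

definition f_word :: "('m \<times> 'n \<Rightarrow> 'm \<times> 'n) \<Rightarrow> 'n list \<Rightarrow> ('m + 'n) list set" where
  "f_word \<theta> v = sclass \<theta> (map Inr v)"

definition periodic :: "('m :: finite \<times> 'n :: finite \<Rightarrow> 'm \<times> 'n) \<Rightarrow> bool" where
  "periodic \<theta> \<longleftrightarrow> CARD('m) = 1 \<or> CARD('n) = 1 \<or>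
    (\<exists>a b \<gamma>. a > 0 \<and> b > 0 \<and>
      bij_betw \<gamma> {u :: 'm list. length u = a} {v :: 'n list. length v = b} \<and>
      (\<forall>u v. length u = a \<longrightarrow> length v = b \<longrightarrow>
        smult \<theta> (e_word \<theta> u) (f_word \<theta> v) =
        smult \<theta> (f_word \<theta> (\<gamma> u)) (e_word \<theta> (inv_into {u. length u = a} \<gamma> v))))"

definition aperiodic :: "('m :: finite \<times> 'n :: finite \<Rightarrow> 'm \<times> 'n) \<Rightarrow> bool" where
  "aperiodic \<theta> \<longleftrightarrow> \<not> periodic \<theta>"


section \<open>Representations\<close>

definition isometric_rep ::
    "('m :: finite \<times> 'n :: finite \<Rightarrow> 'm \<times> 'n) \<Rightarrow> ('h :: complex_hilbert_space \<Rightarrow>\<^sub>L 'h) \<Rightarrow>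
      ('m \<Rightarrow> 'h \<Rightarrow>\<^sub>L 'h) \<Rightarrow> ('n \<Rightarrow> 'h \<Rightarrow>\<^sub>L 'h) \<Rightarrow> bool" where
  "isometric_rep \<theta> U S T \<longleftrightarrow>
    (\<forall>i. S i \<in> bounded_ops U) \<and> (\<forall>j. T j \<in> bounded_ops U) \<and>
    (\<forall>i j. adj (S i) o\<^sub>L S j = (if i = j then U else 0)) \<and>
    (\<forall>k l. adj (T k) o\<^sub>L T l = (if k = l then U else 0)) \<and>
    (\<forall>i j i' j'. \<theta> (i, j) = (i', j') \<longrightarrow> S i o\<^sub>L T j = T j' o\<^sub>L S i')"

definition cuntz_rep ::
    "('m :: finite \<times> 'n :: finite \<Rightarrow> 'm \<times> 'n) \<Rightarrow> ('h :: complex_hilbert_space \<Rightarrow>\<^sub>L 'h) \<Rightarrow>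
      ('m \<Rightarrow> 'h \<Rightarrow>\<^sub>L 'h) \<Rightarrow> ('n \<Rightarrow> 'h \<Rightarrow>\<^sub>L 'h) \<Rightarrow> bool" where
  "cuntz_rep \<theta> U S T \<longleftrightarrow> isometric_rep \<theta> U S T \<and>
    (\<Sum>i\<in>UNIV. S i o\<^sub>L adj (S i)) = U \<and> (\<Sum>j\<in>UNIV. T j o\<^sub>L adj (T j)) = U"

definition rep_alg :: "('h :: complex_hilbert_space \<Rightarrow>\<^sub>L 'h) \<Rightarrow>
      ('m \<Rightarrow> 'h \<Rightarrow>\<^sub>L 'h) \<Rightarrow> ('n \<Rightarrow> 'h \<Rightarrow>\<^sub>L 'h) \<Rightarrow> ('h \<Rightarrow>\<^sub>L 'h) set" where
  "rep_alg U S T = closed_unital_alg U (range S \<union> range T)"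

text \<open>The Hilbert space of the left regular representation is the subspace of
  \<open>('m + 'n) list set ell2\<close> spanned by the \<open>\<xi> w\<close> with \<open>w \<in> sgrp \<theta>\<close>; accordingly the
  operators vanish on the remaining basis vectors, and translation by the unit of the
  semigroup is the projection onto that subspace.\<close>

definition left_translation :: "('m \<times> 'n \<Rightarrow> 'm \<times> 'n) \<Rightarrow> ('m + 'n) list set \<Rightarrow>
    ('m + 'n) list set ell2 \<Rightarrow>\<^sub>L ('m + 'n) list set ell2" where
  "left_translation \<theta> g = (THE T :: ('m + 'n) list set ell2 \<Rightarrow>\<^sub>L ('m + 'n) list set ell2. clinear_op T \<and>
    (\<forall>w. T (\<xi> w) = (if w \<in> sgrp \<theta> then \<xi> (smult \<theta> g w) else 0)))"

definition left_regular_alg :: "('m \<times> 'n \<Rightarrow> 'm \<times> 'n) \<Rightarrow>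
    (('m + 'n) list set ell2 \<Rightarrow>\<^sub>L ('m + 'n) list set ell2) set" where
  "left_regular_alg \<theta> =
    rep_alg (left_translation \<theta> (sclass \<theta> []))
      (\<lambda>i. left_translation \<theta> (e_word \<theta> [i])) (\<lambda>j. left_translation \<theta> (f_word \<theta> [j]))"

definition rigid ::
    "('m :: finite \<times> 'n :: finite \<Rightarrow> 'm \<times> 'n) \<Rightarrow> ('h :: complex_hilbert_space \<Rightarrow>\<^sub>L 'h) \<Rightarrow>
      ('m \<Rightarrow> 'h \<Rightarrow>\<^sub>L 'h) \<Rightarrow> ('n \<Rightarrow> 'h \<Rightarrow>\<^sub>L 'h) \<Rightarrow> bool" where
  "rigid \<theta> U S T \<longleftrightarrow> isometric_rep \<theta> U S T \<and>
    completely_isometrically_isomorphic (rep_alg U S T) (left_regular_alg \<theta>)"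

end

theory Submission
  imports Defs
begin

text \<open>Three estimates for a polynomial \<open>p\<close> with matrix coefficients are chained together:
  \<open>\<parallel>p(E,F)\<parallel> \<le> \<parallel>p(PSP,PTP)\<parallel> \<le> \<parallel>p(S,T)\<parallel> \<le> \<parallel>p(E,F)\<parallel>\<close>.

  For the first one, aperiodicity yields, for every finite set of words \<open>w\<close>, a word \<open>u\<close> such that
  different elements \<open>w u\<close> and \<open>w' u\<close> have no common right multiple; in a Cuntz-type representation
  the operators \<open>S_w S_u\<close> and \<open>S_w' S_u\<close> then have orthogonal ranges. Hence for a unit vector
  \<open>y\<close> in the range of \<open>P\<close> the vectors \<open>S_w S_u y\<close> are orthonormal, and on their span the
  representation acts like the left regular one. The second estimate is restriction to an invariant
  subspace. The third one is a Foelner type argument: \<open>x \<mapsto> N\<inverse> \<Sum>\<^sub>w S_w\<^sup>* x \<otimes> \<xi>_w\<close>, with \<open>w\<close> running over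
  the elements whose two degrees are less than \<open>N\<close>, is an isometry by the Cuntz relations, and up to
  boundary terms that vanish for \<open>N \<rightarrow> \<infinity>\<close> it intertwines \<open>(S,T)\<close> with a multiple of the left regular
  representation.\<close>

section \<open>The semigroup of a 2-graph\<close>

text \<open>All estimates are made for noncommutative polynomials, formal lists of coefficients and
  words that can be evaluated in every representation. As the three estimates form a cycle, the
  norms agree; equality passes to closures, and the compressed algebra turns out to be closed
  already. The obstacle in the lower bound is that periodicity is stated by a bijection between
  words of two fixed lengths. The link is the relation that \<open>x u\<close> and
  \<open>y u\<close> have a common right multiple for every \<open>u\<close>. If it held for two
  different elements, cancelling their common initial part would leave either the empty word against
  a nonempty one, which is impossible, or a pure e-word against a pure f-word, which produces the
  bijection. The factor 1/N arises because the words of each single degree already carry the full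
  norm of \<open>x\<close> and there are N squared degrees. If \<open>D\<close> bounds the degrees
  in the polynomial, the intertwining is exact in all coordinates whose degrees are at least
  \<open>D\<close>, so the loss is a factor N/(N - D).\<close>

text \<open>If \<open>pull_e \<theta> j u = (u', j')\<close>, then \<open>f_j e_u = e_u' f_j'\<close>.\<close>

fun pull_e :: "('m \<times> 'n \<Rightarrow> 'm \<times> 'n) \<Rightarrow> 'n \<Rightarrow> 'm list \<Rightarrow> 'm list \<times> 'n" where
  "pull_e \<theta> j [] = ([], j)"
| "pull_e \<theta> j (i # u) =
    (let (i1, j1) = inv \<theta> (i, j); (u1, j2) = pull_e \<theta> j1 u in (i1 # u1, j2))"

text \<open>The representative e_u f_v of an element. Computing it by recursion from the right end
  of the word tells unequal elements apart without a confluence argument for the rewriting by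
  \<open>\<theta>\<close>.\<close>

fun normal_form :: "('m \<times> 'n \<Rightarrow> 'm \<times> 'n) \<Rightarrow> ('m + 'n) list \<Rightarrow> 'm list \<times> 'n list" where
  "normal_form \<theta> [] = ([], [])"
| "normal_form \<theta> (Inl i # w) = (let (u, v) = normal_form \<theta> w in (i # u, v))"
| "normal_form \<theta> (Inr j # w) =
    (let (u, v) = normal_form \<theta> w; (u', j') = pull_e \<theta> j u in (u', j' # v))"

definition nword :: "'m list \<Rightarrow> 'n list \<Rightarrow> ('m + 'n) list" where
  "nword u v = map Inl u @ map Inr v"

definition edeg :: "('m + 'n) list \<Rightarrow> nat" where "edeg w = length (filter isl w)"
definition fdeg :: "('m + 'n) list \<Rightarrow> nat" where "fdeg w = length (filter (Not \<circ> isl) w)"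

lemma deg_simps [simp]:
  "edeg [] = 0" "edeg (Inl i # w) = Suc (edeg w)" "edeg (Inr j # w) = edeg w"
  "edeg (x @ y) = edeg x + edeg y"
  "fdeg [] = 0" "fdeg (Inl i # w) = fdeg w" "fdeg (Inr j # w) = Suc (fdeg w)"
  "fdeg (x @ y) = fdeg x + fdeg y"
  by (simp_all add: edeg_def fdeg_def)

lemma deg_map_Inr [simp]: "edeg (map Inr v) = 0" "fdeg (map Inr v) = length v"
  by (induction v) simp_all

lemma deg_map_Inl [simp]: "edeg (map Inl u) = length u" "fdeg (map Inl u) = 0"
  by (induction u) simp_all

lemma deg_nword [simp]: "edeg (nword u v) = length u" "fdeg (nword u v) = length v"
  by (simp_all add: nword_def)

lemma nword_simps:
  "nword [] [] = []" "nword (i # u) v = Inl i # nword u v" "nword [] (j # v) = Inr j # nword [] v"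
  by (simp_all add: nword_def)

lemma edeg_0_iff: "edeg x = 0 \<longleftrightarrow> (\<exists>v. x = map Inr v)"
proof
  show "edeg x = 0 \<Longrightarrow> \<exists>v. x = map Inr v"
  proof (induction x)
    case (Cons a x)
    then show ?case by (cases a) (auto intro: exI[of _ "_ # _"])
  qed simp
qed auto

lemma fdeg_0_iff: "fdeg x = 0 \<longleftrightarrow> (\<exists>u. x = map Inl u)"
proof
  show "fdeg x = 0 \<Longrightarrow> \<exists>u. x = map Inl u"
  proof (induction x)
    case (Cons a x)
    then show ?case by (cases a) (auto intro: exI[of _ "_ # _"])
  qed simp
qed auto

locale two_graph =
  fixes \<theta> :: "'m :: finite \<times> 'n :: finite \<Rightarrow> 'm \<times> 'n"
  assumes bij_theta: "bij \<theta>"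
begin

abbreviation weq :: "('m + 'n) list \<Rightarrow> ('m + 'n) list \<Rightarrow> bool" (infix \<open>\<doteq>\<close> 50) where
  "x \<doteq> y \<equiv> equivclp (commute_step \<theta>) x y"

lemma weq_sym: "x \<doteq> y \<Longrightarrow> y \<doteq> x"
  by (rule equivclp_sym)

lemma weq_append_left: assumes "x \<doteq> y" shows "z @ x \<doteq> z @ y"
  using assms
proof (induction rule: equivclp_induct)
  case (step y y')
  have *: "commute_step \<theta> (z @ a) (z @ b)" if "commute_step \<theta> a b" for a b
    using that
  proof cases
    case (1 i j i' j' p q)
    then show ?thesis using commute_step.intros[of \<theta> i j i' j' "z @ p" q] by simp
  qed
  from step * show ?case by (meson equivclp_into_equivclp)
qed simp

lemma weq_append_right: assumes "x \<doteq> y" shows "x @ z \<doteq> y @ z"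
  using assms
proof (induction rule: equivclp_induct)
  case (step y y')
  have *: "commute_step \<theta> (a @ z) (b @ z)" if "commute_step \<theta> a b" for a b
    using that
  proof cases
    case (1 i j i' j' p q)
    then show ?thesis using commute_step.intros[of \<theta> i j i' j' p "q @ z"] by simp
  qed
  from step * show ?case by (meson equivclp_into_equivclp)
qed simp

lemma weq_append: "x \<doteq> y \<Longrightarrow> x' \<doteq> y' \<Longrightarrow> x @ x' \<doteq> y @ y'"
  by (meson weq_append_left weq_append_right equivclp_trans)

lemma weq_Cons: "x \<doteq> y \<Longrightarrow> a # x \<doteq> a # y"
  using weq_append_left[of x y "[a]"] by simp

lemma weq_swap: "\<theta> (i, j) = (i', j') \<Longrightarrow> Inl i # Inr j # x \<doteq> Inr j' # Inl i' # x"
  using commute_step.intros[of \<theta> i j i' j' "[]" x] by auto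

lemma weq_deg: assumes "x \<doteq> y" shows "edeg x = edeg y" "fdeg x = fdeg y"
proof -
  have "edeg a = edeg b \<and> fdeg a = fdeg b" if "commute_step \<theta> a b" for a b
    using that by cases simp
  with assms have "edeg x = edeg y \<and> fdeg x = fdeg y"
    by (induction rule: equivclp_induct) metis+
  then show "edeg x = edeg y" "fdeg x = fdeg y" by auto
qed

lemma inv_theta: "\<theta> (i, j) = (i', j') \<Longrightarrow> inv \<theta> (i', j') = (i, j)"
  using bij_theta by (metis bij_inv_eq_iff)

lemma theta_inv: "inv \<theta> (i', j') = (i, j) \<Longrightarrow> \<theta> (i, j) = (i', j')"
  using bij_theta by (metis bij_inv_eq_iff)

text \<open>The recursion sees of the part already read only its normal form. A defining relation
  inside a word therefore has to be checked only with an empty prefix.\<close>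

lemma normal_form_append_cong:
  "normal_form \<theta> x = normal_form \<theta> y \<Longrightarrow> normal_form \<theta> (z @ x) = normal_form \<theta> (z @ y)"
proof (induction z)
  case (Cons a z)
  then show ?case by (cases a) auto
qed simp

lemma normal_form_weq: assumes "x \<doteq> y" shows "normal_form \<theta> x = normal_form \<theta> y"
proof -
  have "normal_form \<theta> a = normal_form \<theta> b" if "commute_step \<theta> a b" for a b
    using that
  proof cases
    case (1 i j i' j' p q)
    have "normal_form \<theta> ([Inl i, Inr j] @ q) = normal_form \<theta> ([Inr j', Inl i'] @ q)"
      using inv_theta[OF 1(3)] by (simp split: prod.splits)
    then show ?thesis unfolding 1 by (rule normal_form_append_cong)
  qed
  with assms show ?thesis by (induction rule: equivclp_induct) metis+
qed

lemma pull_e_weq: "pull_e \<theta> j u = (u', j') \<Longrightarrow> Inr j # map Inl u \<doteq> map Inl u' @ [Inr j']"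
proof (induction u arbitrary: j u' j')
  case (Cons i u)
  obtain i1 j1 where ij: "inv \<theta> (i, j) = (i1, j1)" by fastforce
  obtain u1 j2 where u1: "pull_e \<theta> j1 u = (u1, j2)" by fastforce
  have r: "u' = i1 # u1" "j' = j2" using Cons.prems by (simp_all add: ij u1)
  have "Inr j # map Inl (i # u) \<doteq> Inl i1 # Inr j1 # map Inl u"
    using weq_sym[OF weq_swap[OF theta_inv[OF ij]]] by simp
  also have "\<dots> \<doteq> Inl i1 # map Inl u1 @ [Inr j2]"
    by (rule weq_Cons[OF Cons.IH[OF u1]])
  finally show ?case by (simp add: r)
qed simp

lemma weq_normal_form: "normal_form \<theta> x = (u, v) \<Longrightarrow> x \<doteq> nword u v"
proof (induction x arbitrary: u v)
  case (Cons a x)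
  obtain u1 v1 where nx: "normal_form \<theta> x = (u1, v1)" by fastforce
  note IH = Cons.IH[OF nx]
  show ?case
  proof (cases a)
    case (Inl i)
    then show ?thesis using Cons.prems nx weq_Cons[OF IH, of a] by (auto simp: nword_simps)
  next
    case (Inr j)
    obtain u2 j2 where p: "pull_e \<theta> j u1 = (u2, j2)" by fastforce
    have "a # x \<doteq> (Inr j # map Inl u1) @ map Inr v1"
      using weq_Cons[OF IH, of a] Inr by (simp add: nword_def)
    also have "\<dots> \<doteq> (map Inl u2 @ [Inr j2]) @ map Inr v1"
      by (rule weq_append_right[OF pull_e_weq[OF p]])
    finally show ?thesis using Cons.prems nx p Inr by (auto simp: nword_def)
  qed
qed (auto simp: nword_simps)

lemma weq_iff_normal_form: "x \<doteq> y \<longleftrightarrow> normal_form \<theta> x = normal_form \<theta> y"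
proof
  assume e: "normal_form \<theta> x = normal_form \<theta> y"
  obtain u v where "normal_form \<theta> x = (u, v)" by fastforce
  with e show "x \<doteq> y"
    using weq_normal_form[of x u v] weq_normal_form[of y u v] by (metis equivclp_trans weq_sym)
qed (rule normal_form_weq)

lemma normal_form_map_Inr: "normal_form \<theta> (map Inr v) = ([], v)"
  by (induction v) auto

lemma normal_form_nword: "normal_form \<theta> (nword u v) = (u, v)"
  by (induction u) (auto simp: nword_def normal_form_map_Inr)

lemma nword_weq_iff: "nword u v \<doteq> nword u' v' \<longleftrightarrow> u = u' \<and> v = v'"
  by (simp add: weq_iff_normal_form normal_form_nword)

lemma map_Inl_weq_iff: "map Inl u \<doteq> map Inl u' \<longleftrightarrow> u = u'"
  using nword_weq_iff[of u "[]" u' "[]"] by (simp add: nword_def)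

lemma map_Inr_weq_iff: "map Inr v \<doteq> map Inr v' \<longleftrightarrow> v = v'"
  using nword_weq_iff[of "[]" v "[]" v'] by (simp add: nword_def)

text \<open>\<open>inv \<theta>\<close> is injective, so the letters can be recovered one by one
  from the right end. This is what allows an initial f-letter to be cancelled: in the normal form it
  has travelled through the whole e-part and is no longer visible.\<close>

lemma pull_e_inj:
  "pull_e \<theta> j u = pull_e \<theta> j' u' \<Longrightarrow> length u = length u' \<Longrightarrow> j = j' \<and> u = u'"
proof (induction u arbitrary: j j' u')
  case (Cons i u)
  then obtain i' u1' where u': "u' = i' # u1'" by (cases u') auto
  obtain i1 j1 where ij: "inv \<theta> (i, j) = (i1, j1)" by fastforce
  obtain i1' j1' where ij': "inv \<theta> (i', j') = (i1', j1')" by fastforce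
  have e: "i1 = i1'" "pull_e \<theta> j1 u = pull_e \<theta> j1' u1'"
    using Cons.prems by (auto simp: u' ij ij' split: prod.splits)
  from Cons.IH[OF e(2)] Cons.prems have "j1 = j1'" "u = u1'" by (auto simp: u')
  with e ij ij' theta_inv[OF ij] theta_inv[OF ij'] show ?case by (simp add: u')
qed auto

lemma length_normal_form:
  "length (fst (normal_form \<theta> x)) = edeg x" "length (snd (normal_form \<theta> x)) = fdeg x"
proof -
  obtain u v where *: "normal_form \<theta> x = (u, v)" by fastforce
  show "length (fst (normal_form \<theta> x)) = edeg x" "length (snd (normal_form \<theta> x)) = fdeg x"
    using weq_deg[OF weq_normal_form[OF *]] by (simp_all add: *)
qed

lemma weq_Inl_Cons: "Inl i # x \<doteq> Inl i' # x' \<Longrightarrow> i = i' \<and> x \<doteq> x'"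
  unfolding weq_iff_normal_form
  by (cases "normal_form \<theta> x"; cases "normal_form \<theta> x'") auto

lemma weq_Inr_Cons: assumes "Inr j # x \<doteq> Inr j' # x'" shows "j = j' \<and> x \<doteq> x'"
proof -
  obtain u v u' v' where n: "normal_form \<theta> x = (u, v)" "normal_form \<theta> x' = (u', v')" by fastforce
  have "edeg x = edeg x'" using weq_deg[OF assms] by simp
  then have l: "length u = length u'" using length_normal_form[of x] length_normal_form[of x'] n by simp
  have "normal_form \<theta> (Inr j # x) = normal_form \<theta> (Inr j' # x')" using assms weq_iff_normal_form by blast
  then have "pull_e \<theta> j u = pull_e \<theta> j' u'" "v = v'" using n by (auto split: prod.splits)
  with pull_e_inj[OF this(1) l] n show ?thesis by (simp add: weq_iff_normal_form)
qed

section \<open>Unique factorization along degrees\<close>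

lemma pull_Inl: "edeg x > 0 \<Longrightarrow> \<exists>i y. x \<doteq> Inl i # y"
proof (induction x)
  case (Cons a x)
  show ?case
  proof (cases a)
    case (Inl i)
    then show ?thesis by (metis equivclp_refl)
  next
    case (Inr j)
    with Cons obtain i y where *: "x \<doteq> Inl i # y" by auto
    obtain i1 j1 where ij: "inv \<theta> (i, j) = (i1, j1)" by fastforce
    have "a # x \<doteq> Inl i1 # Inr j1 # y"
      using equivclp_trans[OF weq_Cons[OF *, of a]] weq_sym[OF weq_swap[OF theta_inv[OF ij]]] Inr
      by blast
    then show ?thesis by blast
  qed
qed simp

lemma pull_Inr: "fdeg x > 0 \<Longrightarrow> \<exists>j y. x \<doteq> Inr j # y"
proof (induction x)
  case (Cons a x)
  show ?case
  proof (cases a)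
    case (Inr i)
    then show ?thesis by (metis equivclp_refl)
  next
    case (Inl i)
    with Cons obtain j y where *: "x \<doteq> Inr j # y" by auto
    obtain i1 j1 where ij: "\<theta> (i, j) = (i1, j1)" by fastforce
    have "a # x \<doteq> Inr j1 # Inl i1 # y"
      using equivclp_trans[OF weq_Cons[OF *, of a]] weq_swap[OF ij] Inl by blast
    then show ?thesis by blast
  qed
qed simp

lemma factor:
  assumes "p \<le> edeg x" "q \<le> fdeg x"
  obtains y y' where "x \<doteq> y @ y'" "edeg y = p" "fdeg y = q"
proof -
  have "\<exists>y y'. x \<doteq> y @ y' \<and> edeg y = p \<and> fdeg y = q"
    using assms
  proof (induction "p + q" arbitrary: p q x)
    case 0
    then show ?case by (intro exI[of _ "[]"] exI[of _ x]) simp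
  next
    case (Suc n)
    show ?case
    proof (cases p)
      case 0
      then obtain q' where q: "q = Suc q'" using Suc by (cases q) auto
      then obtain j y where x: "x \<doteq> Inr j # y" using pull_Inr Suc by fastforce
      have "p \<le> edeg y" "q' \<le> fdeg y" using weq_deg[OF x] Suc q by auto
      with Suc.hyps(1)[of p q' y] Suc.hyps(2) q obtain z z' where
        "y \<doteq> z @ z'" "edeg z = p" "fdeg z = q'" by auto
      then show ?thesis using q equivclp_trans[OF x weq_Cons]
        by (intro exI[of _ "Inr j # z"] exI[of _ z']) auto
    next
      case (Suc p')
      then obtain j y where x: "x \<doteq> Inl j # y" using pull_Inl Suc.prems by fastforce
      have "p' \<le> edeg y" "q \<le> fdeg y" using weq_deg[OF x] Suc Suc.prems by auto
      with Suc.hyps(1)[of p' q y] Suc.hyps(2) Suc obtain z z' where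
        "y \<doteq> z @ z'" "edeg z = p'" "fdeg z = q" by auto
      then show ?thesis using Suc equivclp_trans[OF x weq_Cons]
        by (intro exI[of _ "Inl j # z"] exI[of _ z']) auto
    qed
  qed
  then show thesis using that by blast
qed

text \<open>Together with \<open>factor\<close> this is the factorization property of a 2-graph. In
  the induction \<open>x'\<close> is rewritten to begin with a letter of the same kind as
  \<open>x\<close>; then a single letter can be cancelled on the left.\<close>

lemma unique_factor:
  "x @ y \<doteq> x' @ y' \<Longrightarrow> edeg x = edeg x' \<Longrightarrow> fdeg x = fdeg x' \<Longrightarrow> x \<doteq> x' \<and> y \<doteq> y'"
proof (induction x arbitrary: x')
  case Nil
  then have "edeg x' = 0" "fdeg x' = 0" by simp_all
  then have "x' = []" by (auto simp: edeg_0_iff)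
  with Nil show ?case by simp
next
  case (Cons a x)
  show ?case
  proof (cases a)
    case (Inl i)
    then obtain i' z where x': "x' \<doteq> Inl i' # z" using Cons.prems(2) pull_Inl[of x'] by auto
    have "Inl i # x @ y \<doteq> Inl i' # z @ y'"
      using equivclp_trans[OF Cons.prems(1) weq_append_right[OF x']] Inl by simp
    from weq_Inl_Cons[OF this] have *: "i = i'" "x @ y \<doteq> z @ y'" by auto
    have "x \<doteq> z \<and> y \<doteq> y'"
      by (rule Cons.IH[OF *(2)]) (use weq_deg[OF x'] Cons.prems Inl in auto)
    then show ?thesis using x' Inl *(1) by (meson weq_Cons weq_sym equivclp_trans)
  next
    case (Inr i)
    then obtain i' z where x': "x' \<doteq> Inr i' # z" using Cons.prems(3) pull_Inr[of x'] by auto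
    have "Inr i # x @ y \<doteq> Inr i' # z @ y'"
      using equivclp_trans[OF Cons.prems(1) weq_append_right[OF x']] Inr by simp
    from weq_Inr_Cons[OF this] have *: "i = i'" "x @ y \<doteq> z @ y'" by auto
    have "x \<doteq> z \<and> y \<doteq> y'"
      by (rule Cons.IH[OF *(2)]) (use weq_deg[OF x'] Cons.prems Inr in auto)
    then show ?thesis using x' Inr *(1) by (meson weq_Cons weq_sym equivclp_trans)
  qed
qed

lemma cancel_left: "x @ y \<doteq> x @ y' \<Longrightarrow> y \<doteq> y'"
  using unique_factor by blast

lemma cancel_right: assumes "x @ y \<doteq> x' @ y" shows "x \<doteq> x'"
  using unique_factor[OF assms] weq_deg[OF assms] by simp

lemma sclass_eq_iff: "sclass \<theta> x = sclass \<theta> y \<longleftrightarrow> x \<doteq> y"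
  unfolding sclass_def word_rel_def by (auto intro: weq_sym equivclp_trans)

lemma sclass_in_sgrp: "sclass \<theta> x \<in> sgrp \<theta>"
  unfolding sclass_def sgrp_def by (rule quotientI) simp

lemma sgrpE: assumes "g \<in> sgrp \<theta>" obtains u v where "g = sclass \<theta> (nword u v)"
proof -
  from assms obtain x where x: "g = sclass \<theta> x" unfolding sgrp_def sclass_def by (rule quotientE)
  obtain u v where "normal_form \<theta> x = (u, v)" by fastforce
  from weq_normal_form[OF this] x show thesis using that sclass_eq_iff by blast
qed

lemma smult_sclass: "smult \<theta> (sclass \<theta> x) (sclass \<theta> y) = sclass \<theta> (x @ y)"
proof -
  have "sclass \<theta> (x' @ y') = sclass \<theta> (x @ y)" if "x' \<in> sclass \<theta> x" "y' \<in> sclass \<theta> y" for x' y'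
    using that unfolding sclass_eq_iff
    by (auto simp: sclass_def word_rel_def intro: weq_append weq_sym)
  moreover have "x \<in> sclass \<theta> x" "y \<in> sclass \<theta> y"
    by (auto simp: sclass_def word_rel_def)
  ultimately show ?thesis unfolding smult_def by blast
qed

section \<open>Common right multiples and aperiodicity\<close>

definition compat :: "('m + 'n) list \<Rightarrow> ('m + 'n) list \<Rightarrow> bool" where
  "compat x y \<longleftrightarrow> (\<exists>p q. x @ p \<doteq> y @ q)"

lemma compat_sym: "compat x y \<Longrightarrow> compat y x"
  unfolding compat_def using weq_sym by blast

lemma compat_cong: assumes "x \<doteq> x'" "y \<doteq> y'" "compat x y" shows "compat x' y'"
proof -
  obtain p q where "x @ p \<doteq> y @ q" using assms unfolding compat_def by blast
  then have "x' @ p \<doteq> y' @ q"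
    using assms by (meson weq_append_right weq_sym equivclp_trans)
  then show ?thesis unfolding compat_def by blast
qed

lemma compat_cancel: "compat (z @ x) (z @ y) \<Longrightarrow> compat x y"
  unfolding compat_def using cancel_left by force

lemma compat_append: "compat (x @ p) (y @ q) \<Longrightarrow> compat x y"
  unfolding compat_def by (metis append.assoc)

lemma compat_same_deg:
  "compat x y \<Longrightarrow> edeg x = edeg y \<Longrightarrow> fdeg x = fdeg y \<Longrightarrow> x \<doteq> y"
  unfolding compat_def using unique_factor by blast

text \<open>The relation below says that \<open>x z = y z\<close> for every infinite path \<open>z\<close>.\<close>

definition always_compat :: "('m + 'n) list \<Rightarrow> ('m + 'n) list \<Rightarrow> bool" where
  "always_compat x y \<longleftrightarrow> (\<forall>u. compat (x @ u) (y @ u))"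

lemma always_compatD: "always_compat x y \<Longrightarrow> compat x y"
  unfolding always_compat_def by (metis append_Nil2)

lemma always_compat_sym: "always_compat x y \<Longrightarrow> always_compat y x"
  unfolding always_compat_def using compat_sym by blast

lemma always_compat_cong:
  assumes "x \<doteq> x'" "y \<doteq> y'" "always_compat x y" shows "always_compat x' y'"
  using assms compat_cong unfolding always_compat_def by (meson weq_append_right)

lemma always_compat_append: "always_compat x y \<Longrightarrow> always_compat (x @ z) (y @ z)"
  unfolding always_compat_def by simp

lemma always_compat_cancel: "always_compat (z @ x) (z @ y) \<Longrightarrow> always_compat x y"
  unfolding always_compat_def using compat_cancel[of z] by simp

lemma always_compat_append_left: "always_compat x y \<Longrightarrow> always_compat (z @ x) (z @ y)"
  unfolding always_compat_def compat_def by (simp, blast intro: weq_append_left)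

text \<open>\<open>compat\<close> alone is not transitive in general, because a short middle word
  forgets too much. Here the middle word may be extended: \<open>y @ x\<close> has an initial part
  \<open>y1\<close> of the degree of \<open>x\<close>, and for words of one degree compatibility is
  equality.\<close>

lemma always_compat_trans:
  assumes "always_compat x y" "always_compat y z" "edeg x = edeg z" "fdeg x = fdeg z"
  shows "x \<doteq> z"
proof -
  obtain y1 y2 where y: "y @ x \<doteq> y1 @ y2" "edeg y1 = edeg x" "fdeg y1 = fdeg x"
    by (rule factor[of "edeg x" "y @ x" "fdeg x"]) auto
  have "compat (x @ x) (y @ x)" "compat (y @ x) (z @ x)"
    using assms unfolding always_compat_def by auto
  then have "compat (x @ x) (y1 @ y2)" "compat (y1 @ y2) (z @ x)"
    using compat_cong[OF equivclp_refl y(1)] compat_cong[OF y(1) equivclp_refl] by auto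
  then have "compat x y1" "compat y1 z" using compat_append by blast+
  then show ?thesis using compat_same_deg[of x y1] compat_same_deg[of y1 z] y assms
    by (auto intro: equivclp_trans)
qed

text \<open>Let \<open>i'\<close> be of the same kind as a first letter of \<open>g\<close> but
  different from it. Then \<open>i'\<close> and \<open>g i'\<close> begin with different letters of
  one kind, and no extension on the right can repair this.\<close>

lemma not_always_compat_Nil:
  assumes m: "CARD('m) \<noteq> 1" and n: "CARD('n) \<noteq> 1" and "always_compat [] g"
  shows "g = []"
proof (rule ccontr)
  have two: "\<exists>b. b \<noteq> a" if "CARD('k) \<noteq> 1" for a :: "'k :: finite"
  proof (rule ccontr)
    assume "\<not> ?thesis"
    then have "(UNIV :: 'k set) = {a}" by auto
    then have "CARD('k) = card {a}" by simp
    with that show False by simp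
  qed
  assume "g \<noteq> []"
  then consider "edeg g > 0" | "fdeg g > 0" using fdeg_0_iff[of g] by fastforce
  then show False
  proof cases
    case 1
    then obtain i y where g: "g \<doteq> Inl i # y" using pull_Inl by blast
    obtain i' where "i' \<noteq> i" using two[OF m] by blast
    have "compat [Inl i'] ((Inl i # y) @ [Inl i'])"
      using always_compat_cong[OF equivclp_refl g assms(3)] unfolding always_compat_def by fastforce
    then show False using weq_Inl_Cons \<open>i' \<noteq> i\<close> unfolding compat_def by fastforce
  next
    case 2
    then obtain i y where g: "g \<doteq> Inr i # y" using pull_Inr by blast
    obtain i' where "i' \<noteq> i" using two[OF n] by blast
    have "compat [Inr i'] ((Inr i # y) @ [Inr i'])"
      using always_compat_cong[OF equivclp_refl g assms(3)] unfolding always_compat_def by fastforce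
    then show False using weq_Inr_Cons \<open>i' \<noteq> i\<close> unfolding compat_def by fastforce
  qed
qed

text \<open>Comparing the initial parts of \<open>e_u0 f_v z\<close> and \<open>f_v0 f_v z\<close> gives \<open>e_u0 f_v = f_v0 e_u\<close> with
  \<open>e_u z = f_v z\<close> for every infinite path \<open>z\<close>; this correspondence between \<open>u\<close> and \<open>v\<close> is the
  bijection that witnesses periodicity.\<close>

lemma always_compat_ef_imp_periodic:
  assumes ac: "always_compat (map Inl u0) (map Inr v0)" and "u0 \<noteq> []" "v0 \<noteq> []"
  shows "periodic \<theta>"
proof -
  define a b where "a = length u0" and "b = length v0"
  have ex1: "\<exists>u. length u = a \<and> map Inl u0 @ map Inr v \<doteq> map Inr v0 @ map Inl u \<and>
      always_compat (map Inl u) (map Inr v)" if "length v = b" for v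
  proof -
    have "b \<le> fdeg (map Inl u0 @ map Inr v)" using that by simp
    then obtain y y' where f: "map Inl u0 @ map Inr v \<doteq> y @ y'" "edeg y = 0" "fdeg y = b"
      by (rule factor[of 0 _ b, rotated]) auto
    have y': "edeg y' = a" "fdeg y' = 0" using weq_deg[OF f(1)] f that by (auto simp: a_def)
    obtain v' where v': "y = map Inr v'" using f edeg_0_iff by blast
    obtain u where u: "y' = map Inl u" using y' fdeg_0_iff by blast
    have "always_compat (map Inl u0 @ map Inr v) (map Inr v0 @ map Inr v)"
      by (rule always_compat_append[OF ac])
    then have *: "always_compat (y @ y') (map Inr v0 @ map Inr v)"
      using always_compat_cong[OF f(1) equivclp_refl] by blast
    have "y \<doteq> map Inr v0"
      by (rule compat_same_deg[OF compat_append[OF always_compatD[OF *]]])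
        (use f in \<open>auto simp: b_def\<close>)
    then have e: "y @ y' \<doteq> map Inr v0 @ y'" by (rule weq_append_right)
    have "always_compat y' (map Inr v)"
      using always_compat_cancel[OF always_compat_cong[OF e equivclp_refl *]] .
    then show ?thesis using equivclp_trans[OF f(1) e] y' u by auto
  qed
  have ex2: "\<exists>v. length v = b \<and> map Inr v0 @ map Inl u \<doteq> map Inl u0 @ map Inr v \<and>
      always_compat (map Inl u) (map Inr v)" if "length u = a" for u
  proof -
    have "a \<le> edeg (map Inr v0 @ map Inl u)" using that by simp
    then obtain y y' where f: "map Inr v0 @ map Inl u \<doteq> y @ y'" "edeg y = a" "fdeg y = 0"
      by (rule factor[of a _ 0]) auto
    have y': "edeg y' = 0" "fdeg y' = b" using weq_deg[OF f(1)] f that by (auto simp: b_def)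
    obtain u' where u': "y = map Inl u'" using f fdeg_0_iff by blast
    obtain v where v: "y' = map Inr v" using y' edeg_0_iff by blast
    have "always_compat (map Inl u0 @ map Inl u) (map Inr v0 @ map Inl u)"
      by (rule always_compat_append[OF ac])
    then have *: "always_compat (map Inl u0 @ map Inl u) (y @ y')"
      using always_compat_cong[OF equivclp_refl f(1)] by blast
    have "y \<doteq> map Inl u0"
      by (rule weq_sym, rule compat_same_deg[OF compat_append[OF always_compatD[OF *]]])
        (use f in \<open>auto simp: a_def\<close>)
    then have e: "y @ y' \<doteq> map Inl u0 @ y'" by (rule weq_append_right)
    have "always_compat (map Inl u) y'"
      using always_compat_cancel[OF always_compat_cong[OF equivclp_refl e *]] .
    then show ?thesis using equivclp_trans[OF f(1) e] y' v by auto
  qed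
  obtain \<delta> where \<delta>: "\<And>v. length v = b \<Longrightarrow> length (\<delta> v) = a"
    "\<And>v. length v = b \<Longrightarrow> map Inl u0 @ map Inr v \<doteq> map Inr v0 @ map Inl (\<delta> v)"
    "\<And>v. length v = b \<Longrightarrow> always_compat (map Inl (\<delta> v)) (map Inr v)"
    using ex1 by metis
  obtain \<gamma> where \<gamma>: "\<And>u. length u = a \<Longrightarrow> length (\<gamma> u) = b"
    "\<And>u. length u = a \<Longrightarrow> map Inr v0 @ map Inl u \<doteq> map Inl u0 @ map Inr (\<gamma> u)"
    "\<And>u. length u = a \<Longrightarrow> always_compat (map Inl u) (map Inr (\<gamma> u))"
    using ex2 by metis
  have gd: "\<gamma> (\<delta> v) = v" if "length v = b" for v
    using equivclp_trans[OF \<delta>(2)[OF that] \<gamma>(2)[OF \<delta>(1)[OF that]]] cancel_left map_Inr_weq_iff by metis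
  have dg: "\<delta> (\<gamma> u) = u" if "length u = a" for u
    using equivclp_trans[OF \<gamma>(2)[OF that] \<delta>(2)[OF \<gamma>(1)[OF that]]] cancel_left map_Inl_weq_iff by metis
  have bij: "bij_betw \<gamma> {u. length u = a} {v. length v = b}"
    by (rule bij_betw_byWitness[where f' = \<delta>]) (auto simp: gd dg \<gamma> \<delta>)
  have inv: "inv_into {u. length u = a} \<gamma> v = \<delta> v" if "length v = b" for v
    by (rule inv_into_f_eq[OF bij_betw_imp_inj_on[OF bij]]) (use that gd \<delta> in auto)
  \<comment> \<open>The two sides have degree (a, b) and are compared through the word for
    f_{\<gamma> u} f_v of degree (0, 2b); \<open>always_compat_trans\<close> permits such a middle
    word.\<close>
  have "map Inl u @ map Inr v \<doteq> map Inr (\<gamma> u) @ map Inl (\<delta> v)" if "length u = a" "length v = b" for u v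
  proof (rule always_compat_trans)
    show "always_compat (map Inl u @ map Inr v) (map Inr (\<gamma> u) @ map Inr v)"
      by (rule always_compat_append[OF \<gamma>(3)[OF that(1)]])
    show "always_compat (map Inr (\<gamma> u) @ map Inr v) (map Inr (\<gamma> u) @ map Inl (\<delta> v))"
      using always_compat_append_left[OF always_compat_sym[OF \<delta>(3)[OF that(2)]]] .
  qed (use that \<gamma> \<delta> in auto)
  then have "\<forall>u v. length u = a \<longrightarrow> length v = b \<longrightarrow>
        smult \<theta> (e_word \<theta> u) (f_word \<theta> v) =
        smult \<theta> (f_word \<theta> (\<gamma> u)) (e_word \<theta> (inv_into {u. length u = a} \<gamma> v))"
    by (simp add: e_word_def f_word_def smult_sclass sclass_eq_iff inv)
  with bij show ?thesis unfolding periodic_def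
    by (intro disjI2 exI[of _ a] exI[of _ b] exI[of _ \<gamma>]) (use assms in \<open>auto simp: a_def b_def\<close>)
qed

text \<open>The initial parts whose degree is the coordinatewise minimum coincide and are cancelled.
  In each coordinate the degree of one of the remainders \<open>g\<close>, \<open>h\<close> then
  vanishes, which leaves only an empty remainder or an e-word against an f-word.\<close>

lemma aperiodic_not_always_compat:
  assumes ap: "aperiodic \<theta>" and ac: "always_compat x y"
  shows "x \<doteq> y"
proof -
  have card: "CARD('m) \<noteq> 1" "CARD('n) \<noteq> 1" using ap unfolding aperiodic_def periodic_def by auto
  define k l where "k = min (edeg x) (edeg y)" and "l = min (fdeg x) (fdeg y)"
  obtain r g where x: "x \<doteq> r @ g" "edeg r = k" "fdeg r = l"
    using factor[of k x l] by (auto simp: k_def l_def)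
  obtain r' h where y: "y \<doteq> r' @ h" "edeg r' = k" "fdeg r' = l"
    using factor[of k y l] by (auto simp: k_def l_def)
  have dx: "edeg x = k + edeg g" "fdeg x = l + fdeg g" using weq_deg[OF x(1)] x by auto
  have dy: "edeg y = k + edeg h" "fdeg y = l + fdeg h" using weq_deg[OF y(1)] y by auto
  have ac1: "always_compat (r @ g) (r' @ h)" using always_compat_cong[OF x(1) y(1) ac] .
  have rr: "r' \<doteq> r"
    using compat_same_deg[OF compat_append[OF always_compatD[OF ac1]]] x y weq_sym by simp
  have gh: "always_compat g h"
    using always_compat_cancel[OF always_compat_cong[OF equivclp_refl weq_append_right[OF rr] ac1]] .
  consider "edeg g = 0" "fdeg g = 0" | "edeg h = 0" "fdeg h = 0"
    | "edeg g = 0" "fdeg h = 0" "edeg h \<noteq> 0" "fdeg g \<noteq> 0"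
    | "edeg h = 0" "fdeg g = 0" "edeg g \<noteq> 0" "fdeg h \<noteq> 0"
    using dx dy unfolding k_def l_def by linarith
  then have "g = h"
  proof cases
    case 1
    then have "g = []" by (auto simp: edeg_0_iff)
    then show ?thesis using not_always_compat_Nil[OF card, of h] gh by simp
  next
    case 2
    then have "h = []" by (auto simp: edeg_0_iff)
    then show ?thesis using not_always_compat_Nil[OF card, of g] always_compat_sym[OF gh] by simp
  next
    case 3
    then obtain v u where "g = map Inr v" "h = map Inl u" by (auto simp: edeg_0_iff fdeg_0_iff)
    with 3 always_compat_ef_imp_periodic[of u v] always_compat_sym[OF gh] ap
    show ?thesis by (auto simp: aperiodic_def)
  next
    case 4
    then obtain v u where "h = map Inr v" "g = map Inl u" by (auto simp: edeg_0_iff fdeg_0_iff)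
    with 4 always_compat_ef_imp_periodic[of u v] gh ap
    show ?thesis by (auto simp: aperiodic_def)
  qed
  then show ?thesis using x y rr by (meson weq_append_right weq_sym equivclp_trans)
qed

text \<open>Incompatibility survives extension on the right, so the pairs can be treated one after
  another by lengthening \<open>u\<close>. Right cancellation keeps a new pair unequal after
  \<open>u\<close> has been appended.\<close>

lemma aperiodic_separation:
  assumes ap: "aperiodic \<theta>" and "finite Q"
  shows "\<exists>u. \<forall>(x, y) \<in> Q. x \<doteq> y \<or> \<not> compat (x @ u) (y @ u)"
  using \<open>finite Q\<close>
proof induction
  case (insert xy Q)
  then obtain u where u: "\<forall>(x, y) \<in> Q. x \<doteq> y \<or> \<not> compat (x @ u) (y @ u)" by blast
  obtain x y where xy: "xy = (x, y)" by fastforce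
  show ?case
  proof (cases "x \<doteq> y")
    case True
    then show ?thesis using u xy by blast
  next
    case False
    then have "\<not> x @ u \<doteq> y @ u" using cancel_right by blast
    then obtain u' where u': "\<not> compat ((x @ u) @ u') ((y @ u) @ u')"
      using aperiodic_not_always_compat[OF ap] unfolding always_compat_def by blast
    have "x' \<doteq> y' \<or> \<not> compat (x' @ u @ u') (y' @ u @ u')" if "(x', y') \<in> Q" for x' y'
      using u that compat_append[of "x' @ u" u' "y' @ u" u'] by auto
    with u' xy show ?thesis by (intro exI[of _ "u @ u'"]) auto
  qed
qed simp

end

section \<open>Hilbert spaces\<close>

context
  notes [simp] = cinner_add_left cinner_scaleC_left
begin

lemma scaleC_zero [simp]: "c *\<^sub>C (0 :: 'a :: complex_hilbert_space) = 0"
  by (metis norm_eq_zero norm_scaleC norm_zero mult_zero_right)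

lemma zero_scaleC [simp]: "0 *\<^sub>C (x :: 'a :: complex_hilbert_space) = 0"
  by (metis norm_eq_zero norm_scaleC norm_zero mult_zero_left)

lemma one_scaleC [simp]: "1 *\<^sub>C (x :: 'a :: complex_hilbert_space) = x"
  by (metis scaleC_of_real of_real_1 scaleR_one)

lemma minus_scaleC [simp]: "(- c) *\<^sub>C (x :: 'a :: complex_hilbert_space) = - (c *\<^sub>C x)"
  by (metis add_eq_0_iff add.right_inverse scaleC_add_left zero_scaleC)

lemma scaleC_minus [simp]: "c *\<^sub>C (- x :: 'a :: complex_hilbert_space) = - (c *\<^sub>C x)"
  by (metis add_eq_0_iff add.right_inverse scaleC_add_right scaleC_zero)

lemma scaleC_diff: "c *\<^sub>C (x - y :: 'a :: complex_hilbert_space) = c *\<^sub>C x - c *\<^sub>C y"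
  by (metis diff_conv_add_uminus scaleC_add_right scaleC_minus)

lemma scaleC_sum: "c *\<^sub>C (\<Sum>i\<in>I. f i :: 'a :: complex_hilbert_space) = (\<Sum>i\<in>I. c *\<^sub>C f i)"
  by (induction I rule: infinite_finite_induct) (simp_all add: scaleC_add_right)

lemma cinner_zero_left [simp]: "cinner (0 :: 'a :: complex_hilbert_space) y = 0"
  by (metis cinner_scaleC_left mult_zero_left zero_scaleC)

lemma cinner_zero_right [simp]: "cinner x (0 :: 'a :: complex_hilbert_space) = 0"
  by (metis cinner_commute cinner_zero_left complex_cnj_zero)

lemma cinner_add_right:
  "cinner x (y + z :: 'a :: complex_hilbert_space) = cinner x y + cinner x z"
  by (metis cinner_add_left cinner_commute complex_cnj_add)

lemma cinner_scaleC_right: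
  "cinner x (c *\<^sub>C y :: 'a :: complex_hilbert_space) = cnj c * cinner x y"
  by (metis cinner_scaleC_left cinner_commute complex_cnj_mult)

lemma cinner_scaleR_left:
  "cinner (r *\<^sub>R x :: 'a :: complex_hilbert_space) y = r *\<^sub>R cinner x y"
  by (metis cinner_scaleC_left scaleC_of_real scaleR_conv_of_real)

lemma cinner_scaleR_right:
  "cinner x (r *\<^sub>R y :: 'a :: complex_hilbert_space) = r *\<^sub>R cinner x y"
  by (metis cinner_scaleC_right complex_cnj_complex_of_real scaleC_of_real scaleR_conv_of_real)

lemma cinner_minus_left: "cinner (- x :: 'a :: complex_hilbert_space) y = - cinner x y"
  by (metis add_eq_0_iff add.right_inverse cinner_add_left cinner_zero_left)

lemma cinner_minus_right: "cinner x (- y :: 'a :: complex_hilbert_space) = - cinner x y"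
  by (metis add_eq_0_iff add.right_inverse cinner_add_right cinner_zero_right)

lemma cinner_diff_left:
  "cinner (x - y :: 'a :: complex_hilbert_space) z = cinner x z - cinner y z"
  by (metis cinner_add_left cinner_minus_left diff_conv_add_uminus)

lemma cinner_diff_right:
  "cinner x (y - z :: 'a :: complex_hilbert_space) = cinner x y - cinner x z"
  by (metis cinner_add_right cinner_minus_right diff_conv_add_uminus)

lemma cinner_sum_left:
  "cinner (\<Sum>i\<in>I. f i :: 'a :: complex_hilbert_space) y = (\<Sum>i\<in>I. cinner (f i) y)"
  by (induction I rule: infinite_finite_induct) simp_all

lemma cinner_sum_right:
  "cinner y (\<Sum>i\<in>I. f i :: 'a :: complex_hilbert_space) = (\<Sum>i\<in>I. cinner y (f i))"
  by (induction I rule: infinite_finite_induct) (simp_all add: cinner_add_right)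

lemma cinner_self: "cinner x x = of_real ((norm (x :: 'a :: complex_hilbert_space))\<^sup>2)"
proof -
  have "Im (cinner x x) = 0"
    using cinner_commute[of x x] by (metis complex_cnj complex.sel(2) complex.exhaust_sel
      neg_equal_zero)
  moreover have "(norm x)\<^sup>2 = Re (cinner x x)"
    using norm_eq_sqrt_cinner[of x] by (metis norm_ge_zero real_sqrt_ge_0_iff real_sqrt_pow2)
  ultimately show ?thesis by (simp add: complex_eq_iff)
qed

lemma cinner_self_eq_0_iff: "cinner x x = 0 \<longleftrightarrow> (x :: 'a :: complex_hilbert_space) = 0"
  by (simp add: cinner_self)

lemma norm_add_squared:
  "(norm (x + y :: 'a :: complex_hilbert_space))\<^sup>2 = (norm x)\<^sup>2 + (norm y)\<^sup>2 + 2 * Re (cinner x y)"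
proof -
  have "of_real ((norm (x + y))\<^sup>2) =
      of_real ((norm x)\<^sup>2) + of_real ((norm y)\<^sup>2) + (cinner x y + cnj (cinner x y))"
    unfolding cinner_self[symmetric] using cinner_commute[of y x]
    by (simp add: cinner_add_right)
  also have "\<dots> = of_real ((norm x)\<^sup>2 + (norm y)\<^sup>2 + 2 * Re (cinner x y))"
    by (simp add: complex_eq_iff)
  finally show ?thesis by (simp only: of_real_eq_iff)
qed

lemma norm_diff_squared:
  "(norm (x - y :: 'a :: complex_hilbert_space))\<^sup>2 = (norm x)\<^sup>2 + (norm y)\<^sup>2 - 2 * Re (cinner x y)"
  using norm_add_squared[of x "- y"] by (simp add: cinner_minus_right)

lemma cinner_cauchy_schwarz:
  "cmod (cinner x y) \<le> norm x * norm (y :: 'a :: complex_hilbert_space)"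
proof (cases "y = 0")
  case False
  define c where "c = cinner x y / of_real ((norm y)\<^sup>2)"
  have "0 \<le> (norm (x - c *\<^sub>C y))\<^sup>2" by simp
  also have "\<dots> = (norm x)\<^sup>2 + (cmod c)\<^sup>2 * (norm y)\<^sup>2 - 2 * Re (cnj c * cinner x y)"
    by (simp add: norm_diff_squared cinner_scaleC_right norm_scaleC power_mult_distrib)
  also have "cnj c * cinner x y = of_real ((cmod c)\<^sup>2 * (norm y)\<^sup>2)"
  proof -
    have "cinner x y = c * of_real ((norm y)\<^sup>2)" using False by (simp add: c_def)
    then show ?thesis by (metis complex_norm_square mult.assoc mult.commute of_real_mult)
  qed
  also have "cmod c = cmod (cinner x y) / (norm y)\<^sup>2"
    unfolding c_def norm_divide norm_of_real by simp
  finally have "(cmod (cinner x y) / (norm y)\<^sup>2)\<^sup>2 * (norm y)\<^sup>2 \<le> (norm x)\<^sup>2"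
    by (simp add: mult.commute)
  then have "(cmod (cinner x y))\<^sup>2 \<le> (norm x)\<^sup>2 * (norm y)\<^sup>2"
    using False by (simp add: power_divide divide_simps power2_eq_square)
  then have "(cmod (cinner x y))\<^sup>2 \<le> (norm x * norm y)\<^sup>2" by (simp add: power_mult_distrib)
  then show ?thesis by (rule power2_le_imp_le) simp
qed simp

section \<open>Riesz representation and adjoints\<close>

lemma orthogonal_if_minimal:
  fixes z k :: "'a :: complex_hilbert_space"
  assumes "\<And>c. norm z \<le> norm (z + c *\<^sub>C k)"
  shows "cinner z k = 0"
proof (cases "k = 0")
  case False
  \<comment> \<open>The minimizer of the norm of \<open>z + c k\<close>: here the squared norm drops
    by the squared norm of \<open>c k\<close>, so minimality at 0 forces
    \<open>c = 0\<close>.\<close>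
  define c where "c = - cinner z k / of_real ((norm k)\<^sup>2)"
  have nk: "(norm k)\<^sup>2 > 0" using False by simp
  have "(norm z)\<^sup>2 \<le> (norm (z + c *\<^sub>C k))\<^sup>2" using assms by (simp add: power_mono)
  also have "\<dots> = (norm z)\<^sup>2 + (cmod c)\<^sup>2 * (norm k)\<^sup>2 + 2 * Re (cnj c * cinner z k)"
    by (simp add: norm_add_squared cinner_scaleC_right norm_scaleC power_mult_distrib)
  also have "cnj c * cinner z k = of_real (- ((cmod c)\<^sup>2 * (norm k)\<^sup>2))"
  proof -
    have "cinner z k = - c * of_real ((norm k)\<^sup>2)" using False by (simp add: c_def)
    then show ?thesis
      by (metis complex_norm_square mult.assoc mult.commute mult_minus_left of_real_minus of_real_mult)
  qed
  finally have "(cmod c)\<^sup>2 * (norm k)\<^sup>2 \<le> 0" by (simp add: mult.commute)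
  then have "c = 0" using nk by (simp add: mult_le_0_iff)
  then show ?thesis using False by (simp add: c_def)
qed simp

text \<open>The representing vector is a multiple of the point \<open>z\<close> of least norm in the
  hyperplane \<open>f x = 1\<close>. Midpoints stay in the hyperplane, so a minimizing sequence is
  Cauchy by the parallelogram law. Minimality makes \<open>z\<close> orthogonal to the kernel, which
  contains \<open>x\<close> minus \<open>f x\<close> times \<open>z\<close>.\<close>

lemma riesz_representation:
  fixes f :: "'a :: complex_hilbert_space \<Rightarrow> complex"
  assumes bl: "bounded_linear f" and cl: "\<And>c x. f (c *\<^sub>C x) = c * f x"
  shows "\<exists>y. \<forall>x. f x = cinner x y"
proof (cases "\<forall>x. f x = 0")
  case True
  then show ?thesis by (intro exI[of _ 0]) simp
next
  case False
  interpret bounded_linear f by fact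
  from False obtain x0 where "f x0 \<noteq> 0" by blast
  then have "f (inverse (f x0) *\<^sub>C x0) = 1" by (simp add: cl)
  then have ne: "{x. f x = 1} \<noteq> {}" by blast
  define d where "d = (INF x\<in>{x. f x = 1}. norm x)"
  have bdd: "bdd_below (norm ` {x. f x = 1})" by (rule bdd_belowI2[of _ 0]) simp
  have d_le: "d \<le> norm x" if "f x = 1" for x
    unfolding d_def by (rule cINF_lower[OF bdd]) (use that in simp)
  have d0: "0 \<le> d" unfolding d_def by (rule cINF_greatest[OF ne]) simp
  have "\<exists>x. f x = 1 \<and> norm x < d + 1 / real (Suc n)" for n
  proof -
    have "d < d + 1 / real (Suc n)" by simp
    then have "\<exists>x\<in>{x. f x = 1}. norm x < d + 1 / real (Suc n)"
      unfolding d_def using cINF_less_iff[OF ne bdd] by blast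
    then show ?thesis by blast
  qed
  then obtain X where X: "\<And>n. f (X n) = 1" "\<And>n. norm (X n) < d + 1 / real (Suc n)" by metis
  have near: "(norm (x - y))\<^sup>2 \<le> 4 * (d + e)\<^sup>2 - 4 * d\<^sup>2"
    if "f x = 1" "f y = 1" "norm x \<le> d + e" "norm y \<le> d + e" for x y e
  proof -
    have "f ((1/2) *\<^sub>R (x + y)) = 1" using that by (simp add: scaleR add scaleR_conv_of_real)
    from d_le[OF this] have "2 * d \<le> norm (x + y)" by simp
    then have "(2 * d)\<^sup>2 \<le> (norm (x + y))\<^sup>2" using d0 by (intro power_mono) auto
    moreover have "(norm (x + y))\<^sup>2 + (norm (x - y))\<^sup>2 = 2 * (norm x)\<^sup>2 + 2 * (norm y)\<^sup>2"
      by (simp add: norm_add_squared norm_diff_squared)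
    moreover have "(norm x)\<^sup>2 \<le> (d + e)\<^sup>2" "(norm y)\<^sup>2 \<le> (d + e)\<^sup>2"
      using that by (auto intro: power_mono)
    ultimately show ?thesis by (simp add: power_mult_distrib)
  qed
  have "Cauchy X"
  proof (rule metric_CauchyI)
    fix e :: real assume e: "0 < e"
    have "(\<lambda>n. 4 * (d + 1 / real (Suc n))\<^sup>2 - 4 * d\<^sup>2) \<longlonglongrightarrow> 4 * (d + 0)\<^sup>2 - 4 * d\<^sup>2"
      by (intro tendsto_intros LIMSEQ_Suc[OF lim_1_over_n])
    then have "\<forall>\<^sub>F n in sequentially. 4 * (d + 1 / real (Suc n))\<^sup>2 - 4 * d\<^sup>2 < e\<^sup>2"
      using e by (intro order_tendstoD(2)) auto
    then obtain M where M: "4 * (d + 1 / real (Suc M))\<^sup>2 - 4 * d\<^sup>2 < e\<^sup>2"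
      by (auto simp: eventually_sequentially)
    have "dist (X m) (X n) < e" if "m \<ge> M" "n \<ge> M" for m n
    proof -
      have "norm (X k) \<le> d + 1 / real (Suc M)" if "k \<ge> M" for k
      proof -
        have "1 / real (Suc k) \<le> 1 / real (Suc M)" using that by (simp add: frac_le)
        then show ?thesis using X(2)[of k] by linarith
      qed
      then have "(norm (X m - X n))\<^sup>2 < e\<^sup>2"
        using near[OF X(1) X(1), of m "1 / real (Suc M)" n] M that by fastforce
      then show ?thesis using e by (simp add: dist_norm power_less_imp_less_base)
    qed
    then show "\<exists>M. \<forall>m\<ge>M. \<forall>n\<ge>M. dist (X m) (X n) < e" by blast
  qed
  then obtain z where z: "X \<longlonglongrightarrow> z" by (auto simp: Cauchy_convergent_iff convergent_def)
  have fz: "f z = 1"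
    using LIMSEQ_unique[OF tendsto[OF z]] X(1) by (simp add: LIMSEQ_unique)
  have "norm z \<le> d + 0"
  proof (rule LIMSEQ_le)
    show "(\<lambda>n. norm (X n)) \<longlonglongrightarrow> norm z" by (intro tendsto_intros z)
    show "(\<lambda>n. d + 1 / real (Suc n)) \<longlonglongrightarrow> d + 0"
      by (intro tendsto_intros LIMSEQ_Suc[OF lim_1_over_n])
    show "\<exists>N. \<forall>n\<ge>N. norm (X n) \<le> d + 1 / real (Suc n)" using X(2) less_imp_le by blast
  qed
  then have zmin: "norm z \<le> norm x" if "f x = 1" for x using d_le[OF that] by simp
  have orth: "cinner k z = 0" if "f k = 0" for k
  proof -
    have "cinner z k = 0"
      by (rule orthogonal_if_minimal, rule zmin) (simp add: add cl that fz)
    then show ?thesis by (metis cinner_commute complex_cnj_zero)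
  qed
  have z0: "z \<noteq> 0" using fz zero by auto
  show ?thesis
  proof (intro exI allI)
    fix x
    have "f (x - f x *\<^sub>C z) = 0" by (simp add: diff cl fz)
    from orth[OF this] have "cinner x z = f x * cinner z z" by (simp add: cinner_diff_left)
    then show "f x = cinner x (of_real (inverse ((norm z)\<^sup>2)) *\<^sub>C z)"
      using z0 by (simp add: cinner_scaleC_right cinner_self del: of_real_inverse of_real_power)
        (simp flip: of_real_mult)
  qed
qed

lemma cinner_eqI:
  fixes y :: "'a :: complex_hilbert_space"
  assumes "\<And>x. cinner x y = cinner x z" shows "y = z"
proof -
  have "cinner (y - z) (y - z) = 0" by (simp add: cinner_diff_right assms)
  then show ?thesis by (simp add: cinner_self_eq_0_iff)
qed

lemma adj_eqI:
  fixes T T' :: "'a :: complex_hilbert_space \<Rightarrow>\<^sub>L 'a"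
  assumes "\<And>x y. cinner (T x) y = cinner x (T' y)"
  shows "adj T = T'"
  unfolding adj_def
proof (rule the_equality)
  fix T'' :: "'a \<Rightarrow>\<^sub>L 'a" assume "\<forall>x y. cinner (T x) y = cinner x (T'' y)"
  then show "T'' = T'" using assms by (intro blinfun_eqI cinner_eqI) metis
qed (use assms in blast)

text \<open>\<open>adj\<close> is a definite description and obeys its equation only once an adjoint
  exists. Riesz representation provides it pointwise; linearity and the norm bound are then read off
  from the inner product.\<close>

lemma cinner_adj:
  fixes T :: "'a :: complex_hilbert_space \<Rightarrow>\<^sub>L 'a"
  assumes "clinear_op T"
  shows "cinner (T x) y = cinner x (adj T y)"
proof -
  have "\<exists>y'. \<forall>x. cinner (T x) y = cinner x y'" for y
  proof (rule riesz_representation)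
    show "bounded_linear (\<lambda>x. cinner (T x) y)"
    proof (rule bounded_linear_intro)
      show "cinner (T (r *\<^sub>R x)) y = r *\<^sub>R cinner (T x) y" for r x
        by (simp add: blinfun.scaleR_right cinner_scaleR_left)
      show "norm (cinner (T x) y) \<le> norm x * (norm T * norm y)" for x
      proof -
        have "norm (cinner (T x) y) \<le> norm (T x) * norm y" by (rule cinner_cauchy_schwarz)
        also have "\<dots> \<le> (norm T * norm x) * norm y"
          by (intro mult_right_mono norm_blinfun) simp
        finally show ?thesis by (simp add: mult_ac)
      qed
    qed (simp add: blinfun.add_right)
  qed (use assms in \<open>simp add: clinear_op_def\<close>)
  then obtain g where g: "\<And>x y. cinner (T x) y = cinner x (g y)" by metis
  have "bounded_linear g"
  proof (rule bounded_linear_intro)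
    show "g (x + y) = g x + g y" for x y
      by (rule cinner_eqI) (simp add: cinner_add_right flip: g)
    show "g (r *\<^sub>R x) = r *\<^sub>R g x" for r x
      by (rule cinner_eqI) (simp add: cinner_scaleR_right flip: g)
    show "norm (g y) \<le> norm y * norm T" for y
    proof -
      have "(norm (g y))\<^sup>2 = cmod (cinner (T (g y)) y)" by (simp add: g cinner_self norm_power)
      also have "\<dots> \<le> norm (T (g y)) * norm y" by (rule cinner_cauchy_schwarz)
      also have "\<dots> \<le> (norm T * norm (g y)) * norm y" by (intro mult_right_mono norm_blinfun) simp
      finally show ?thesis
        by (cases "norm (g y) = 0") (simp_all add: power2_eq_square mult_ac)
    qed
  qed
  then have "cinner (T x) y = cinner x (Blinfun g y)" for x y
    by (simp add: bounded_linear_Blinfun_apply g)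
  from adj_eqI[of T, OF this] this show ?thesis by simp
qed

definition orthonormal :: "'a :: complex_hilbert_space set \<Rightarrow> bool" where
  "orthonormal E \<longleftrightarrow> (\<forall>e\<in>E. \<forall>e'\<in>E. cinner e e' = of_bool (e = e'))"

text \<open>Gram-Schmidt, one vector at a time. The expansion says both that \<open>x\<close> lies
  in the span of \<open>E\<close> and what its coordinates are; \<open>parseval\<close> needs just
  this form.\<close>

lemma finite_orthonormal_basis:
  fixes X :: "'a :: complex_hilbert_space set"
  assumes "finite X"
  shows "\<exists>E. finite E \<and> orthonormal E \<and> (\<forall>x\<in>X. x = (\<Sum>e\<in>E. cinner x e *\<^sub>C e))"
  using assms
proof induction
  case empty
  then show ?case by (intro exI[of _ "{}"]) (simp add: orthonormal_def)
next
  case (insert x X)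
  then obtain E where E: "finite E" "orthonormal E" "\<forall>x\<in>X. x = (\<Sum>e\<in>E. cinner x e *\<^sub>C e)"
    by blast
  define y where "y = x - (\<Sum>e\<in>E. cinner x e *\<^sub>C e)"
  show ?case
  proof (cases "y = 0")
    case True
    with E show ?thesis unfolding y_def by (intro exI[of _ E]) simp
  next
    case False
    define e0 where "e0 = of_real (inverse (norm y)) *\<^sub>C y"
    have yE: "cinner y e = 0" if "e \<in> E" for e
    proof -
      have "(\<Sum>e'\<in>E. cinner x e' * cinner e' e) = (\<Sum>e'\<in>E. if e' = e then cinner x e' else 0)"
        using E(2) that by (intro sum.cong) (auto simp: orthonormal_def)
      then show ?thesis using that E(1) by (simp add: y_def cinner_diff_left cinner_sum_left)
    qed
    have e0E: "cinner e0 e = 0" "cinner e e0 = 0" if "e \<in> E" for e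
      using yE[OF that] cinner_commute[of e y] by (auto simp: e0_def cinner_scaleC_right)
    have e00: "cinner e0 e0 = 1"
    proof -
      have "norm e0 = 1" using False by (simp add: e0_def norm_scaleC norm_inverse)
      then show ?thesis by (simp add: cinner_self)
    qed
    have e0n: "e0 \<notin> E" using e0E e00 by fastforce
    have on: "orthonormal (insert e0 E)"
      using E(2) e0E e00 unfolding orthonormal_def by auto
    have "cinner z e0 = 0" if "z \<in> X" for z
    proof -
      have "cinner z e0 = cinner (\<Sum>e\<in>E. cinner z e *\<^sub>C e) e0" using E(3) that by metis
      then show ?thesis using e0E by (simp add: cinner_sum_left)
    qed
    then have X: "\<forall>z\<in>X. z = (\<Sum>e\<in>insert e0 E. cinner z e *\<^sub>C e)"
      using E e0n by simp
    have "x = y + (\<Sum>e\<in>E. cinner x e *\<^sub>C e)" by (simp add: y_def)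
    moreover have "cinner (\<Sum>e\<in>E. cinner x e *\<^sub>C e) e0 = 0"
      using e0E by (simp add: cinner_sum_left)
    ultimately have "cinner x e0 = cinner y e0" by (metis add_0_right cinner_add_left)
    also have "\<dots> = of_real (norm y)"
      using False by (simp add: e0_def cinner_scaleC_right cinner_self power2_eq_square)
    finally have "cinner x e0 *\<^sub>C e0 = y"
      using False by (simp add: e0_def scaleC_scaleC flip: of_real_mult of_real_inverse)
    then have "x = (\<Sum>e\<in>insert e0 E. cinner x e *\<^sub>C e)" using E(1) e0n by (simp add: y_def)
    with X on E(1) show ?thesis by (intro exI[of _ "insert e0 E"]) blast
  qed
qed

lemma parseval:
  fixes x :: "'a :: complex_hilbert_space"
  assumes "x = (\<Sum>e\<in>E. cinner x e *\<^sub>C e)"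
  shows "(norm x)\<^sup>2 = (\<Sum>e\<in>E. (cmod (cinner x e))\<^sup>2)"
proof -
  have "of_real ((norm x)\<^sup>2) = cinner (\<Sum>e\<in>E. cinner x e *\<^sub>C e) x"
    using assms cinner_self by metis
  also have "\<dots> = (\<Sum>e\<in>E. cinner x e * cnj (cinner x e))"
    unfolding cinner_sum_left cinner_scaleC_left by (metis cinner_commute)
  also have "\<dots> = of_real (\<Sum>e\<in>E. (cmod (cinner x e))\<^sup>2)"
    by (simp only: of_real_sum complex_norm_square)
  finally show ?thesis by (simp only: of_real_eq_iff)
qed

end

section \<open>Matrix norms\<close>

lemma scaleC_blinfun_apply [simp]: "blinfun_apply (c *\<^sub>C T) x = c *\<^sub>C blinfun_apply T x"
  by (simp add: scaleC_blinfun.rep_eq)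

lemma norm_scaleC_blinfun:
  fixes T :: "'a :: real_normed_vector \<Rightarrow>\<^sub>L 'b :: complex_hilbert_space"
  shows "norm (c *\<^sub>C T) \<le> cmod c * norm T"
proof (rule norm_blinfun_bound)
  show "norm ((c *\<^sub>C T) x) \<le> cmod c * norm T * norm x" for x
    using mult_left_mono[OF norm_blinfun[of T x], of "cmod c"] by (simp add: norm_scaleC mult.assoc)
qed simp

lemma scaleC_blinfun_diff:
  fixes S T :: "'a :: real_normed_vector \<Rightarrow>\<^sub>L 'b :: complex_hilbert_space"
  shows "c *\<^sub>C (S - T) = c *\<^sub>C S - c *\<^sub>C T"
  by (rule blinfun_eqI) (simp add: blinfun.diff_left scaleC_diff)

lemma tendsto_scaleC_blinfun:
  fixes T :: "'a :: real_normed_vector \<Rightarrow>\<^sub>L 'b :: complex_hilbert_space"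
  assumes "(X \<longlongrightarrow> T) F"
  shows "((\<lambda>n. c *\<^sub>C X n) \<longlongrightarrow> c *\<^sub>C T) F"
proof (rule LIM_zero_cancel, rule Lim_null_comparison)
  show "\<forall>\<^sub>F n in F. norm (c *\<^sub>C X n - c *\<^sub>C T) \<le> cmod c * norm (X n - T)"
    by (simp add: norm_scaleC_blinfun flip: scaleC_blinfun_diff)
  show "((\<lambda>n. cmod c * norm (X n - T)) \<longlongrightarrow> 0) F"
    using tendsto_mult_right_zero[OF tendsto_norm_zero[OF LIM_zero[OF assms]]] .
qed

definition matrix_apply_norm ::
    "nat \<Rightarrow> (nat \<Rightarrow> nat \<Rightarrow> ('a :: complex_hilbert_space \<Rightarrow>\<^sub>L 'a)) \<Rightarrow> (nat \<Rightarrow> 'a) \<Rightarrow> real" where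
  "matrix_apply_norm k A x = L2_set (\<lambda>i. norm (\<Sum>j<k. A i j (x j))) {..<k}"

lemma matrix_apply_norm_scaleR:
  "matrix_apply_norm k A (\<lambda>j. r *\<^sub>R x j) = \<bar>r\<bar> * matrix_apply_norm k A x"
  unfolding matrix_apply_norm_def
  by (simp add: blinfun.scaleR_right L2_set_right_distrib flip: scaleR_sum_right)

text \<open>A crude bound, but it makes the supremum in \<open>matrix_norm\<close> one over a
  bounded set, without which \<open>SUP\<close> carries no information, and it controls
  perturbations of the entries and of the vector.\<close>

lemma matrix_apply_norm_le_sum:
  "matrix_apply_norm k A x \<le> (\<Sum>i<k. \<Sum>j<k. norm (A i j)) * L2_set (\<lambda>j. norm (x j)) {..<k}"
proof -
  have "matrix_apply_norm k A x \<le> (\<Sum>i<k. norm (\<Sum>j<k. A i j (x j)))"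
    unfolding matrix_apply_norm_def by (rule L2_set_le_sum) simp
  also have "\<dots> \<le> (\<Sum>i<k. \<Sum>j<k. norm (A i j) * L2_set (\<lambda>j. norm (x j)) {..<k})"
  proof (intro sum_mono sum_norm_le)
    fix i j assume "j \<in> {..<k}"
    then have "norm (x j) \<le> L2_set (\<lambda>j. norm (x j)) {..<k}" by (intro member_le_L2_set) auto
    then show "norm (A i j (x j)) \<le> norm (A i j) * L2_set (\<lambda>j. norm (x j)) {..<k}"
      by (intro order_trans[OF norm_blinfun] mult_left_mono) auto
  qed
  finally show ?thesis by (simp add: sum_distrib_right)
qed

lemma matrix_norm_eq_SUP:
  "matrix_norm k A = (SUP x \<in> {x. L2_set (\<lambda>j. norm (x j)) {..<k} \<le> 1}. matrix_apply_norm k A x)"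
  unfolding matrix_norm_def matrix_apply_norm_def ..

lemma bdd_above_matrix_apply_norm:
  "bdd_above (matrix_apply_norm k A ` {x. L2_set (\<lambda>j. norm (x j)) {..<k} \<le> 1})"
proof (rule bdd_aboveI2)
  fix x :: "nat \<Rightarrow> 'a" assume "x \<in> {x. L2_set (\<lambda>j. norm (x j)) {..<k} \<le> 1}"
  then have "(\<Sum>i<k. \<Sum>j<k. norm (A i j)) * L2_set (\<lambda>j. norm (x j)) {..<k} \<le> (\<Sum>i<k. \<Sum>j<k. norm (A i j)) * 1"
    by (intro mult_left_mono sum_nonneg) auto
  with matrix_apply_norm_le_sum[of k A x]
  show "matrix_apply_norm k A x \<le> (\<Sum>i<k. \<Sum>j<k. norm (A i j))" by linarith
qed

lemma matrix_norm_nonneg: "0 \<le> matrix_norm k A"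
proof -
  have "matrix_apply_norm k A (\<lambda>_. 0) \<le> matrix_norm k A"
    unfolding matrix_norm_eq_SUP
    by (rule cSUP_upper[OF _ bdd_above_matrix_apply_norm]) (simp add: L2_set_def)
  then show ?thesis by (simp add: matrix_apply_norm_def L2_set_def)
qed

lemma matrix_apply_norm_le:
  "matrix_apply_norm k A x \<le> matrix_norm k A * L2_set (\<lambda>j. norm (x j)) {..<k}"
proof (cases "L2_set (\<lambda>j. norm (x j)) {..<k} = 0")
  case True
  with matrix_apply_norm_le_sum[of k A x] show ?thesis by simp
next
  case False
  define r where "r = L2_set (\<lambda>j. norm (x j)) {..<k}"
  have r: "r > 0" using False unfolding r_def by (metis L2_set_nonneg less_eq_real_def)
  have "L2_set (\<lambda>j. norm (inverse r *\<^sub>R x j)) {..<k} = inverse r * r"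
    using r by (simp add: r_def L2_set_right_distrib)
  then have "matrix_apply_norm k A (\<lambda>j. inverse r *\<^sub>R x j) \<le> matrix_norm k A"
    unfolding matrix_norm_eq_SUP using r
    by (intro cSUP_upper[OF _ bdd_above_matrix_apply_norm]) auto
  then show ?thesis using r by (simp add: matrix_apply_norm_scaleR r_def[symmetric] field_simps)
qed

lemma matrix_norm_leI:
  assumes "0 \<le> C" "\<And>x. matrix_apply_norm k A x \<le> C * L2_set (\<lambda>j. norm (x j)) {..<k}"
  shows "matrix_norm k A \<le> C"
  unfolding matrix_norm_eq_SUP
proof (rule cSUP_least)
  have "(\<lambda>_. 0) \<in> {x :: nat \<Rightarrow> 'a. L2_set (\<lambda>j. norm (x j)) {..<k} \<le> 1}" by (simp add: L2_set_def)
  then show "{x :: nat \<Rightarrow> 'a. L2_set (\<lambda>j. norm (x j)) {..<k} \<le> 1} \<noteq> {}"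
    by (rule ex_in_conv[THEN iffD1, OF exI])
  fix x :: "nat \<Rightarrow> 'a" assume "x \<in> {x. L2_set (\<lambda>j. norm (x j)) {..<k} \<le> 1}"
  then have "C * L2_set (\<lambda>j. norm (x j)) {..<k} \<le> C * 1" using assms(1) by (intro mult_left_mono) auto
  with assms(2)[of x] show "matrix_apply_norm k A x \<le> C" by linarith
qed

text \<open>Applied in both directions this is continuity of \<open>matrix_norm\<close> in the
  entries, the reason why equality of matrix norms for polynomials passes to limits.\<close>

lemma matrix_norm_perturb:
  "matrix_norm k A \<le> matrix_norm k B + (\<Sum>i<k. \<Sum>j<k. norm (A i j - B i j))"
proof (rule matrix_norm_leI)
  show "0 \<le> matrix_norm k B + (\<Sum>i<k. \<Sum>j<k. norm (A i j - B i j))"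
    by (intro add_nonneg_nonneg matrix_norm_nonneg sum_nonneg) auto
  fix x :: "nat \<Rightarrow> 'a"
  have "matrix_apply_norm k A x \<le>
      L2_set (\<lambda>i. norm (\<Sum>j<k. B i j (x j)) + norm (\<Sum>j<k. (A i j - B i j) (x j))) {..<k}"
    unfolding matrix_apply_norm_def
  proof (rule L2_set_mono)
    fix i
    have "(\<Sum>j<k. A i j (x j)) = (\<Sum>j<k. B i j (x j)) + (\<Sum>j<k. (A i j - B i j) (x j))"
      by (simp add: blinfun.diff_left flip: sum.distrib)
    then show "norm (\<Sum>j<k. A i j (x j)) \<le>
        norm (\<Sum>j<k. B i j (x j)) + norm (\<Sum>j<k. (A i j - B i j) (x j))"
      by (simp add: norm_triangle_ineq)
  qed simp
  also have "\<dots> \<le> matrix_apply_norm k B x + matrix_apply_norm k (\<lambda>i j. A i j - B i j) x"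
    unfolding matrix_apply_norm_def by (rule L2_set_triangle_ineq)
  also have "\<dots> \<le> matrix_norm k B * L2_set (\<lambda>j. norm (x j)) {..<k} +
      (\<Sum>i<k. \<Sum>j<k. norm (A i j - B i j)) * L2_set (\<lambda>j. norm (x j)) {..<k}"
    by (intro add_mono matrix_apply_norm_le matrix_apply_norm_le_sum)
  finally show "matrix_apply_norm k A x \<le>
      (matrix_norm k B + (\<Sum>i<k. \<Sum>j<k. norm (A i j - B i j))) * L2_set (\<lambda>j. norm (x j)) {..<k}"
    by (simp add: distrib_right)
qed

lemma tendsto_matrix_norm:
  assumes "\<And>i j. i < k \<Longrightarrow> j < k \<Longrightarrow> (\<lambda>n. X n i j) \<longlonglongrightarrow> A i j"
  shows "(\<lambda>n. matrix_norm k (X n)) \<longlonglongrightarrow> matrix_norm k A"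
proof (rule LIM_zero_cancel, rule Lim_null_comparison)
  have "\<bar>matrix_norm k (X n) - matrix_norm k A\<bar> \<le> (\<Sum>i<k. \<Sum>j<k. norm (X n i j - A i j))" for n
    using matrix_norm_perturb[of k "X n" A] matrix_norm_perturb[of k A "X n"]
    by (simp add: norm_minus_commute)
  then show "\<forall>\<^sub>F n in sequentially. norm (matrix_norm k (X n) - matrix_norm k A) \<le>
      (\<Sum>i<k. \<Sum>j<k. norm (X n i j - A i j))" by simp
  have "(\<lambda>n. \<Sum>i<k. \<Sum>j<k. norm (X n i j - A i j)) \<longlonglongrightarrow> (\<Sum>i<k. \<Sum>j<k. 0)"
    using assms by (intro tendsto_sum tendsto_norm_zero LIM_zero) auto
  then show "(\<lambda>n. \<Sum>i<k. \<Sum>j<k. norm (X n i j - A i j)) \<longlonglongrightarrow> 0" by simp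
qed

lemma norm_eq_matrix_norm: "norm T = matrix_norm 1 (\<lambda>_ _. T)"
proof (rule antisym)
  have "{..<1::nat} = {0}" by auto
  then have 1: "matrix_apply_norm 1 (\<lambda>_ _. T) x = norm (T (x 0))"
    "L2_set (\<lambda>j. norm (x j)) {..<1} = norm (x 0)" for x
    by (simp_all add: matrix_apply_norm_def)
  show "norm T \<le> matrix_norm 1 (\<lambda>_ _. T)"
  proof (rule norm_blinfun_bound[OF matrix_norm_nonneg])
    show "norm (T x) \<le> matrix_norm 1 (\<lambda>_ _. T) * norm x" for x
      using matrix_apply_norm_le[of 1 "\<lambda>_ _. T" "\<lambda>_. x"] unfolding 1 .
  qed
  show "matrix_norm 1 (\<lambda>_ _. T) \<le> norm T"
    by (rule matrix_norm_leI) (simp_all only: 1 norm_blinfun norm_ge_zero)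
qed

section \<open>Extension of isometric correspondences to closures\<close>

lemma cauchy_transfer:
  fixes X :: "nat \<Rightarrow> 'a :: real_normed_vector" and Y :: "nat \<Rightarrow> 'b :: banach"
  assumes "\<And>m n. norm (Y m - Y n) = norm (X m - X n)" and "X \<longlonglongrightarrow> a"
  shows "\<exists>b. Y \<longlonglongrightarrow> b"
proof -
  have "Cauchy X" using assms(2) LIMSEQ_imp_Cauchy by blast
  then have "Cauchy Y" using assms(1) unfolding Cauchy_def dist_norm by simp
  then show ?thesis by (simp add: Cauchy_convergent_iff convergent_def)
qed

text \<open>The index type stands for polynomials, which in general are not determined by their
  values, so \<open>\<pi> p \<mapsto> \<rho> p\<close> is not a map to begin with. The case
  \<open>k = 1\<close> of \<open>iso\<close>, applied to differences, makes it well defined and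
  injective, also between limits.\<close>

lemma completely_isometrically_isomorphic_closure:
  fixes \<pi> :: "'p \<Rightarrow> 'a :: complex_hilbert_space \<Rightarrow>\<^sub>L 'a"
    and \<rho> :: "'p \<Rightarrow> 'b :: complex_hilbert_space \<Rightarrow>\<^sub>L 'b"
  assumes add: "\<And>p q. \<exists>r. \<pi> r = \<pi> p + \<pi> q \<and> \<rho> r = \<rho> p + \<rho> q"
    and scale: "\<And>c p. \<exists>r. \<pi> r = c *\<^sub>C \<pi> p \<and> \<rho> r = c *\<^sub>C \<rho> p"
    and mult: "\<And>p q. \<exists>r. \<pi> r = \<pi> p o\<^sub>L \<pi> q \<and> \<rho> r = \<rho> p o\<^sub>L \<rho> q"
    and iso: "\<And>k p. matrix_norm k (\<lambda>i j. \<rho> (p i j)) = matrix_norm k (\<lambda>i j. \<pi> (p i j))"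
  shows "completely_isometrically_isomorphic (closure (range \<pi>)) (closure (range \<rho>))"
proof -
  have norm: "norm (\<rho> p - \<rho> q) = norm (\<pi> p - \<pi> q)" for p q
  proof -
    obtain q' where q': "\<pi> q' = (-1) *\<^sub>C \<pi> q" "\<rho> q' = (-1) *\<^sub>C \<rho> q" using scale by blast
    obtain r where r: "\<pi> r = \<pi> p + \<pi> q'" "\<rho> r = \<rho> p + \<rho> q'" using add by blast
    have "\<pi> r = \<pi> p - \<pi> q" "\<rho> r = \<rho> p - \<rho> q"
      unfolding r q' by (auto intro!: blinfun_eqI simp: blinfun.add_left blinfun.diff_left blinfun.minus_left)
    then show ?thesis using iso[of 1 "\<lambda>_ _. r"] by (simp add: norm_eq_matrix_norm)
  qed
  \<comment> \<open>Two limits are related if one sequence of indices produces both. Existence,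
    uniqueness and the algebraic laws can then be shown before a function is chosen.\<close>
  define R where "R a b \<longleftrightarrow> (\<exists>X. (\<lambda>n. \<pi> (X n)) \<longlonglongrightarrow> a \<and> (\<lambda>n. \<rho> (X n)) \<longlonglongrightarrow> b)" for a b
  have R_E: thesis
    if "R a b" "\<And>X. (\<lambda>n. \<pi> (X n)) \<longlonglongrightarrow> a \<Longrightarrow> (\<lambda>n. \<rho> (X n)) \<longlonglongrightarrow> b \<Longrightarrow> thesis" for a b thesis
    using that unfolding R_def by (elim exE conjE)
  have ex1: "\<exists>b\<in>closure (range \<rho>). R a b" if "a \<in> closure (range \<pi>)" for a
  proof -
    from that obtain Z where Z: "(\<forall>n. Z n \<in> range \<pi>) \<and> Z \<longlonglongrightarrow> a"
      unfolding closure_sequential by (rule exE)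
    then have "\<forall>n. \<exists>p. Z n = \<pi> p" by blast
    then obtain X where "\<forall>n. Z n = \<pi> (X n)" by (rule choice[THEN exE])
    then have "Z = (\<lambda>n. \<pi> (X n))" by (simp add: fun_eq_iff)
    with Z have X: "(\<lambda>n. \<pi> (X n)) \<longlonglongrightarrow> a" by simp
    with cauchy_transfer[of "\<lambda>n. \<rho> (X n)", OF norm] obtain b where b: "(\<lambda>n. \<rho> (X n)) \<longlonglongrightarrow> b" by blast
    have "b \<in> closure (range \<rho>)" unfolding closure_sequential
      by (rule exI[where x = "\<lambda>n. \<rho> (X n)"]) (simp add: b)
    then show ?thesis using X b unfolding R_def by blast
  qed
  have ex2: "\<exists>a\<in>closure (range \<pi>). R a b" if "b \<in> closure (range \<rho>)" for b
  proof -
    from that obtain Z where Z: "(\<forall>n. Z n \<in> range \<rho>) \<and> Z \<longlonglongrightarrow> b"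
      unfolding closure_sequential by (rule exE)
    then have "\<forall>n. \<exists>p. Z n = \<rho> p" by blast
    then obtain X where "\<forall>n. Z n = \<rho> (X n)" by (rule choice[THEN exE])
    then have "Z = (\<lambda>n. \<rho> (X n))" by (simp add: fun_eq_iff)
    with Z have X: "(\<lambda>n. \<rho> (X n)) \<longlonglongrightarrow> b" by simp
    with cauchy_transfer[of "\<lambda>n. \<pi> (X n)", OF norm[symmetric]]
    obtain a where a: "(\<lambda>n. \<pi> (X n)) \<longlonglongrightarrow> a" by blast
    have "a \<in> closure (range \<pi>)" unfolding closure_sequential
      by (rule exI[where x = "\<lambda>n. \<pi> (X n)"]) (simp add: a)
    then show ?thesis using X a unfolding R_def by blast
  qed
  have uniq: "b = b' \<longleftrightarrow> a = a'" if "R a b" "R a' b'" for a a' b b'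
  proof -
    from that(1) obtain X where X: "(\<lambda>n. \<pi> (X n)) \<longlonglongrightarrow> a" "(\<lambda>n. \<rho> (X n)) \<longlonglongrightarrow> b"
      by (rule R_E)
    from that(2) obtain Y where Y: "(\<lambda>n. \<pi> (Y n)) \<longlonglongrightarrow> a'" "(\<lambda>n. \<rho> (Y n)) \<longlonglongrightarrow> b'"
      by (rule R_E)
    have "(\<lambda>n. norm (\<pi> (X n) - \<pi> (Y n))) \<longlonglongrightarrow> norm (a - a')"
      "(\<lambda>n. norm (\<pi> (X n) - \<pi> (Y n))) \<longlonglongrightarrow> norm (b - b')"
      using tendsto_norm[OF tendsto_diff[OF X(1) Y(1)]] tendsto_norm[OF tendsto_diff[OF X(2) Y(2)]]
      unfolding norm by auto
    then have "norm (a - a') = norm (b - b')" by (rule LIMSEQ_unique)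
    then show ?thesis by auto
  qed
  define \<phi> where "\<phi> a = (SOME b. R a b)" for a
  have \<phi>: "R a (\<phi> a)" if "a \<in> closure (range \<pi>)" for a
    unfolding \<phi>_def using ex1[OF that] someI_ex by metis
  have \<phi>_eq: "\<phi> a = b" if "R a b" for a b
  proof -
    have "R a (\<phi> a)" unfolding \<phi>_def using that by (rule someI)
    from uniq[OF this that] show ?thesis by simp
  qed
  have R_add: "R (a + a') (b + b')" if "R a b" "R a' b'" for a a' b b'
  proof -
    from that(1) obtain X where X: "(\<lambda>n. \<pi> (X n)) \<longlonglongrightarrow> a" "(\<lambda>n. \<rho> (X n)) \<longlonglongrightarrow> b"
      by (rule R_E)
    from that(2) obtain Y where Y: "(\<lambda>n. \<pi> (Y n)) \<longlonglongrightarrow> a'" "(\<lambda>n. \<rho> (Y n)) \<longlonglongrightarrow> b'"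
      by (rule R_E)
    have "\<forall>n. \<exists>r. \<pi> r = \<pi> (X n) + \<pi> (Y n) \<and> \<rho> r = \<rho> (X n) + \<rho> (Y n)" using add by blast
    then obtain Z where "\<forall>n. \<pi> (Z n) = \<pi> (X n) + \<pi> (Y n) \<and> \<rho> (Z n) = \<rho> (X n) + \<rho> (Y n)" by (rule choice[THEN exE])
    then show ?thesis unfolding R_def
      using tendsto_add[OF X(1) Y(1)] tendsto_add[OF X(2) Y(2)] by (intro exI[of _ Z]) simp
  qed
  have R_mult: "R (a o\<^sub>L a') (b o\<^sub>L b')" if "R a b" "R a' b'" for a a' b b'
  proof -
    from that(1) obtain X where X: "(\<lambda>n. \<pi> (X n)) \<longlonglongrightarrow> a" "(\<lambda>n. \<rho> (X n)) \<longlonglongrightarrow> b"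
      by (rule R_E)
    from that(2) obtain Y where Y: "(\<lambda>n. \<pi> (Y n)) \<longlonglongrightarrow> a'" "(\<lambda>n. \<rho> (Y n)) \<longlonglongrightarrow> b'"
      by (rule R_E)
    have "\<forall>n. \<exists>r. \<pi> r = \<pi> (X n) o\<^sub>L \<pi> (Y n) \<and> \<rho> r = \<rho> (X n) o\<^sub>L \<rho> (Y n)" using mult by blast
    then obtain Z where "\<forall>n. \<pi> (Z n) = \<pi> (X n) o\<^sub>L \<pi> (Y n) \<and> \<rho> (Z n) = \<rho> (X n) o\<^sub>L \<rho> (Y n)" by (rule choice[THEN exE])
    then show ?thesis unfolding R_def
      using bounded_bilinear.tendsto[OF bounded_bilinear_blinfun_compose X(1) Y(1)]
        bounded_bilinear.tendsto[OF bounded_bilinear_blinfun_compose X(2) Y(2)]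
      by (intro exI[of _ Z]) simp
  qed
  have R_scale: "R (c *\<^sub>C a) (c *\<^sub>C b)" if "R a b" for c a b
  proof -
    from that obtain X where X: "(\<lambda>n. \<pi> (X n)) \<longlonglongrightarrow> a" "(\<lambda>n. \<rho> (X n)) \<longlonglongrightarrow> b"
      by (rule R_E)
    have "\<forall>n. \<exists>r. \<pi> r = c *\<^sub>C \<pi> (X n) \<and> \<rho> r = c *\<^sub>C \<rho> (X n)" using scale by blast
    then obtain Z where "\<forall>n. \<pi> (Z n) = c *\<^sub>C \<pi> (X n) \<and> \<rho> (Z n) = c *\<^sub>C \<rho> (X n)" by (rule choice[THEN exE])
    then show ?thesis unfolding R_def
      using tendsto_scaleC_blinfun[OF X(1)] tendsto_scaleC_blinfun[OF X(2)]
      by (intro exI[of _ Z]) simp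
  qed
  have "bij_betw \<phi> (closure (range \<pi>)) (closure (range \<rho>))"
  proof (rule bij_betw_imageI)
    show "inj_on \<phi> (closure (range \<pi>))" using \<phi> uniq by (metis inj_onI)
    show "\<phi> ` closure (range \<pi>) = closure (range \<rho>)"
      using ex1 ex2 \<phi>_eq by (fastforce simp: image_iff)
  qed
  moreover have "matrix_norm k (\<lambda>i j. \<phi> (A i j)) = matrix_norm k A"
    if "\<forall>i<k. \<forall>j<k. A i j \<in> closure (range \<pi>)" for k A
  proof -
    have "\<forall>i j. \<exists>X. i < k \<and> j < k \<longrightarrow>
        (\<lambda>n. \<pi> (X n)) \<longlonglongrightarrow> A i j \<and> (\<lambda>n. \<rho> (X n)) \<longlonglongrightarrow> \<phi> (A i j)"
      using that \<phi> unfolding R_def by blast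
    then obtain X where X: "\<And>i j. i < k \<Longrightarrow> j < k \<Longrightarrow> (\<lambda>n. \<pi> (X i j n)) \<longlonglongrightarrow> A i j"
      "\<And>i j. i < k \<Longrightarrow> j < k \<Longrightarrow> (\<lambda>n. \<rho> (X i j n)) \<longlonglongrightarrow> \<phi> (A i j)" by metis
    have "(\<lambda>n. matrix_norm k (\<lambda>i j. \<pi> (X i j n))) \<longlonglongrightarrow> matrix_norm k A"
      by (rule tendsto_matrix_norm) (rule X)
    moreover have "(\<lambda>n. matrix_norm k (\<lambda>i j. \<rho> (X i j n))) \<longlonglongrightarrow> matrix_norm k (\<lambda>i j. \<phi> (A i j))"
      by (rule tendsto_matrix_norm) (rule X)
    ultimately show ?thesis unfolding iso by (rule LIMSEQ_unique[rotated])
  qed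
  ultimately show ?thesis unfolding completely_isometrically_isomorphic_def
    by (intro exI[of _ \<phi>] conjI allI ballI impI \<phi>_eq R_add R_mult R_scale \<phi>) auto
qed

section \<open>Bases of square summable families\<close>

lemma Rep_ell2_sum_basis:
  "finite F \<Longrightarrow> Rep_ell2 (\<Sum>w\<in>F. c w *\<^sub>C \<xi> w) x = (if x \<in> F then c x else 0)"
  by (induction F rule: finite_induct)
    (auto simp: zero_ell2.rep_eq plus_ell2.rep_eq scaleC_ell2.rep_eq ell2_basis.rep_eq)

lemma ell2_approx:
  assumes "0 < e"
  shows "\<exists>F. finite F \<and> norm (f - (\<Sum>w\<in>F. Rep_ell2 f w *\<^sub>C \<xi> w)) \<le> e"
proof -
  let ?g = "\<lambda>x. (cmod (Rep_ell2 f x))\<^sup>2"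
  have s: "?g summable_on UNIV" using Rep_ell2[of f] by simp
  obtain F where F: "finite F" "dist (sum ?g F) (infsum ?g UNIV) \<le> e\<^sup>2"
    using infsum_finite_approximation[OF s, of "e\<^sup>2"] assms by auto
  have "L2_set (\<lambda>x. cmod (Rep_ell2 (f - (\<Sum>w\<in>F. Rep_ell2 f w *\<^sub>C \<xi> w)) x)) G \<le> e" if "finite G" for G
  proof -
    have "(\<Sum>x\<in>G. (cmod (Rep_ell2 (f - (\<Sum>w\<in>F. Rep_ell2 f w *\<^sub>C \<xi> w)) x))\<^sup>2) = sum ?g (G - F)"
      by (rule sum.mono_neutral_cong_right)
        (auto simp: that F minus_ell2.rep_eq Rep_ell2_sum_basis)
    also have "\<dots> = sum ?g (G \<union> F) - sum ?g F"
      using sum.union_disjoint[of "G - F" F ?g] that F(1) by (simp add: Int_commute)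
    also have "sum ?g (G \<union> F) \<le> infsum ?g UNIV"
      by (rule finite_sum_le_infsum[OF s]) (auto simp: that F)
    finally have "(\<Sum>x\<in>G. (cmod (Rep_ell2 (f - (\<Sum>w\<in>F. Rep_ell2 f w *\<^sub>C \<xi> w)) x))\<^sup>2) \<le> e\<^sup>2"
      using F(2) by (simp add: dist_real_def)
    then show ?thesis unfolding L2_set_def using assms by (intro real_le_lsqrt) auto
  qed
  then show ?thesis using F(1) unfolding norm_ell2_le_iff by blast
qed

lemma cinner_basis: "cinner f (\<xi> w) = Rep_ell2 f w"
proof -
  have "cinner f (\<xi> w) = infsum (\<lambda>x. Rep_ell2 f x * cnj (of_bool (x = w))) {w}"
    unfolding cinner_ell2.rep_eq ell2_basis.rep_eq by (rule infsum_cong_neutral) auto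
  then show ?thesis by simp
qed

lemma cinner_basis_basis: "cinner (\<xi> v) (\<xi> w) = of_bool (v = w)"
  by (auto simp: cinner_basis ell2_basis.rep_eq)

lemma clinear_op_sum:
  assumes "clinear_op T"
  shows "T (\<Sum>i\<in>I. c i *\<^sub>C x i) = (\<Sum>i\<in>I. c i *\<^sub>C T (x i))"
  using assms by (simp add: blinfun.sum_right clinear_op_def)

lemma clinear_op_eq_on_basis:
  fixes T T' :: "'a ell2 \<Rightarrow>\<^sub>L 'b :: complex_hilbert_space"
  assumes "clinear_op T" "clinear_op T'" and eq: "\<And>w. T (\<xi> w) = T' (\<xi> w)"
  shows "T = T'"
proof (rule blinfun_eqI)
  fix f
  have "norm (T f - T' f) \<le> 0 + e" if "0 < e" for e
  proof -
    define e' where "e' = e / (norm (T - T') + 1)"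
    have n: "0 < norm (T - T') + 1" using norm_ge_zero[of "T - T'"] by linarith
    then have "e' > 0" using that by (simp add: e'_def)
    then obtain F where F: "norm (f - (\<Sum>w\<in>F. Rep_ell2 f w *\<^sub>C \<xi> w)) \<le> e'" using ell2_approx by blast
    define g where "g = (\<Sum>w\<in>F. Rep_ell2 f w *\<^sub>C \<xi> w)"
    have "T g = T' g" unfolding g_def by (simp add: clinear_op_sum assms)
    then have "T f - T' f = (T - T') (f - g)" by (simp add: blinfun.diff_left blinfun.diff_right)
    then have "norm (T f - T' f) \<le> norm (T - T') * norm (f - g)" by (simp add: norm_blinfun)
    also have "\<dots> \<le> (norm (T - T') + 1) * e'"
      using F by (intro mult_mono) (auto simp: g_def)
    also have "\<dots> = e" using n by (simp add: e'_def)
    finally show ?thesis by simp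
  qed
  then have "norm (T f - T' f) \<le> 0" by (rule field_le_epsilon)
  then show "T f = T' f" by simp
qed

text \<open>\<open>left_translation\<close> is a definite description, and this provides the
  operator. Coefficients are moved along the inverse of \<open>\<sigma>\<close>; by injectivity no
  two of them are added up, so the norm does not grow.\<close>

lemma ex_partial_shift:
  fixes \<sigma> :: "'a \<Rightarrow> 'a"
  assumes inj: "inj_on \<sigma> A"
  shows "\<exists>T :: 'a ell2 \<Rightarrow>\<^sub>L 'a ell2. clinear_op T \<and> (\<forall>w. T (\<xi> w) = (if w \<in> A then \<xi> (\<sigma> w) else 0))"
proof -
  define h where "h f z = (if z \<in> \<sigma> ` A then Rep_ell2 f (inv_into A \<sigma> z) else 0)" for f z
  have L2: "L2_set (\<lambda>z. cmod (h f z)) F \<le> norm f" if "finite F" for f F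
  proof -
    let ?G = "inv_into A \<sigma> ` (F \<inter> \<sigma> ` A)"
    have "(\<Sum>z\<in>F. (cmod (h f z))\<^sup>2) = (\<Sum>z\<in>F \<inter> \<sigma> ` A. (cmod (Rep_ell2 f (inv_into A \<sigma> z)))\<^sup>2)"
      by (rule sum.mono_neutral_cong_right) (auto simp: that h_def)
    also have "\<dots> = (\<Sum>w\<in>?G. (cmod (Rep_ell2 f w))\<^sup>2)"
      by (rule sum.reindex_cong[symmetric, where l = "inv_into A \<sigma>"]) (auto intro!: inj_on_inv_into)
    finally have "L2_set (\<lambda>z. cmod (h f z)) F = L2_set (\<lambda>w. cmod (Rep_ell2 f w)) ?G"
      by (simp add: L2_set_def)
    also have "\<dots> \<le> norm f" by (rule L2_set_le_norm_ell2) (simp add: that)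
    finally show ?thesis .
  qed
  have R: "Rep_ell2 (Abs_ell2 (h f)) = h f" for f
  proof (rule Abs_ell2_inverse)
    show "h f \<in> {f. (\<lambda>x. (cmod (f x))\<^sup>2) summable_on UNIV}"
      using L2[of _ f] square_summable_iff[of "h f"] by blast
  qed
  have bl: "bounded_linear (\<lambda>f. Abs_ell2 (h f))"
  proof (rule bounded_linear_intro[where K = 1])
    show "Abs_ell2 (h (f + g)) = Abs_ell2 (h f) + Abs_ell2 (h g)" for f g
      by (auto simp: Rep_ell2_inject[symmetric] R plus_ell2.rep_eq h_def fun_eq_iff)
    show "Abs_ell2 (h (r *\<^sub>R f)) = r *\<^sub>R Abs_ell2 (h f)" for r f
      by (auto simp: Rep_ell2_inject[symmetric] R scaleR_ell2.rep_eq h_def fun_eq_iff)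
    show "norm (Abs_ell2 (h f)) \<le> norm f * 1" for f
      unfolding norm_ell2_le_iff R using L2 by simp
  qed
  have "Abs_ell2 (h (c *\<^sub>C f)) = c *\<^sub>C Abs_ell2 (h f)" for c f
    by (auto simp: Rep_ell2_inject[symmetric] R scaleC_ell2.rep_eq h_def fun_eq_iff)
  moreover have "Abs_ell2 (h (\<xi> w)) = (if w \<in> A then \<xi> (\<sigma> w) else 0)" for w
    using inj by (auto simp: Rep_ell2_inject[symmetric] R zero_ell2.rep_eq ell2_basis.rep_eq h_def
        fun_eq_iff inv_into_into)
  ultimately show ?thesis
    by (intro exI[of _ "Blinfun (\<lambda>f. Abs_ell2 (h f))"])
      (simp add: clinear_op_def bounded_linear_Blinfun_apply[OF bl])
qed

section \<open>Representations and noncommutative polynomials\<close>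

text \<open>The lists are formal polynomials whose words are not reduced, so one object can be
  evaluated in every representation, on operators as well as on vectors. The weak sort is due to the
  operators, which are not of sort \<open>complex_hilbert_space\<close>.\<close>

definition comb :: "('w \<Rightarrow> 'v) \<Rightarrow> (complex \<times> 'w) list \<Rightarrow> 'v :: {scaleC, comm_monoid_add}" where
  "comb z p = (\<Sum>(c, w)\<leftarrow>p. c *\<^sub>C z w)"

definition comb_scale :: "complex \<Rightarrow> (complex \<times> 'w) list \<Rightarrow> (complex \<times> 'w) list" where
  "comb_scale c p = map (\<lambda>(d, w). (c * d, w)) p"

definition comb_mult ::
    "(complex \<times> 'l list) list \<Rightarrow> (complex \<times> 'l list) list \<Rightarrow> (complex \<times> 'l list) list" where
  "comb_mult p q = concat (map (\<lambda>(c, g). map (\<lambda>(d, w). (c * d, g @ w)) q) p)"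

lemma comb_simps [simp]:
  "comb z [] = 0" "comb z ((c, w) # p) = c *\<^sub>C z w + comb z p"
  "comb z (p @ q) = comb z p + comb z q"
  by (simp_all add: comb_def)

lemma comb_concat: "comb z (concat (map f [0..<k])) = (\<Sum>j<k. comb z (f j))"
  by (induction k) (simp_all add: comb_def)

lemma blinfun_apply_comb:
  fixes Z :: "'w \<Rightarrow> 'a :: complex_hilbert_space \<Rightarrow>\<^sub>L 'b :: complex_hilbert_space"
  shows "blinfun_apply (comb Z p) x = comb (\<lambda>w. Z w x) p"
  by (induction p) (auto simp: blinfun.add_left)

lemma comb_comb_scale: "comb z (comb_scale c p) = c *\<^sub>C (comb z p :: 'a :: complex_hilbert_space)"
  by (induction p) (auto simp: comb_scale_def scaleC_add_right scaleC_scaleC)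

lemma comb_comb_scale_blinfun:
  fixes Z :: "'w \<Rightarrow> 'a :: complex_hilbert_space \<Rightarrow>\<^sub>L 'b :: complex_hilbert_space"
  shows "comb Z (comb_scale c p) = c *\<^sub>C comb Z p"
  by (rule blinfun_eqI) (simp add: blinfun_apply_comb comb_comb_scale)

lemma clinear_op_comb:
  assumes "clinear_op T" shows "T (comb z p) = comb (\<lambda>w. T (z w)) p"
  using assms by (induction p) (auto simp: blinfun.add_right clinear_op_def)

text \<open>\<open>z\<close> is an orbit: \<open>Z g\<close> acts on its index by left
  multiplication. One calculation thus serves for products of operators, for the regular
  representation on basis vectors and for the orbit of a single vector.\<close>

lemma comb_comb_mult:
  fixes Z :: "'l list \<Rightarrow> 'a :: complex_hilbert_space \<Rightarrow>\<^sub>L 'a"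
  assumes "\<And>g. clinear_op (Z g)" and "\<And>g w. Z g (z w) = z (g @ w)"
  shows "comb Z p (comb z q) = comb z (comb_mult p q)"
proof -
  have *: "comb z (map (\<lambda>(d, w). (c * d, g @ w)) q) = c *\<^sub>C comb (\<lambda>w. z (g @ w)) q" for c g
    by (induction q) (auto simp: scaleC_add_right scaleC_scaleC)
  show ?thesis
    by (induction p)
      (auto simp: comb_mult_def blinfun.add_left clinear_op_comb assms *)
qed

lemma blinfun_compose_assoc: "(A o\<^sub>L B) o\<^sub>L C = A o\<^sub>L (B o\<^sub>L C)"
  by (rule blinfun_eqI) simp

lemma clinear_op_comp: "clinear_op A \<Longrightarrow> clinear_op B \<Longrightarrow> clinear_op (A o\<^sub>L B)"
  by (simp add: clinear_op_def)

lemma clinear_op_id [simp]: "clinear_op id_blinfun"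
  by (simp add: clinear_op_def)

fun word_op :: "('h :: complex_hilbert_space \<Rightarrow>\<^sub>L 'h) \<Rightarrow> ('m \<Rightarrow> 'h \<Rightarrow>\<^sub>L 'h) \<Rightarrow> ('n \<Rightarrow> 'h \<Rightarrow>\<^sub>L 'h) \<Rightarrow>
    ('m + 'n) list \<Rightarrow> ('h \<Rightarrow>\<^sub>L 'h)" where
  "word_op U S T [] = U"
| "word_op U S T (Inl i # w) = S i o\<^sub>L word_op U S T w"
| "word_op U S T (Inr j # w) = T j o\<^sub>L word_op U S T w"

text \<open>The algebraic relations in a corner with unit \<open>U\<close>, shared by the Cuntz-type
  representation, its compression to an invariant subspace and the left regular representation. The
  algebra generated is identified with the values of polynomials for all three at once.\<close>

locale graph_rep = two_graph \<theta>
  for \<theta> :: "'m :: finite \<times> 'n :: finite \<Rightarrow> 'm \<times> 'n" +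
  fixes U :: "'h :: complex_hilbert_space \<Rightarrow>\<^sub>L 'h" and S :: "'m \<Rightarrow> 'h \<Rightarrow>\<^sub>L 'h" and T :: "'n \<Rightarrow> 'h \<Rightarrow>\<^sub>L 'h"
  assumes clinear_U: "clinear_op U" and U_idem: "U o\<^sub>L U = U"
    and S_bounded_ops: "S i \<in> bounded_ops U" and T_bounded_ops: "T j \<in> bounded_ops U"
    and commutation: "\<theta> (i, j) = (i', j') \<Longrightarrow> S i o\<^sub>L T j = T j' o\<^sub>L S i'"
begin

abbreviation "wop \<equiv> word_op U S T"

lemma clinear_wop: "clinear_op (wop w)"
proof (induction w)
  case (Cons a w)
  then show ?case using S_bounded_ops T_bounded_ops
    by (cases a) (auto simp: bounded_ops_def intro: clinear_op_comp)
qed (simp add: clinear_U)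

lemma U_wop: "U o\<^sub>L wop w = wop w"
proof (cases w)
  case (Cons a w')
  then show ?thesis using S_bounded_ops T_bounded_ops
    by (cases a) (auto simp: bounded_ops_def simp flip: blinfun_compose_assoc)
qed (simp add: U_idem)

lemma wop_U: "wop w o\<^sub>L U = wop w"
proof (induction w)
  case (Cons a w)
  then show ?case by (cases a) (auto simp: blinfun_compose_assoc)
qed (simp add: U_idem)

lemma wop_append: "wop (x @ y) = wop x o\<^sub>L wop y"
proof (induction x)
  case (Cons a x)
  then show ?case by (cases a) (auto simp: blinfun_compose_assoc)
qed (simp add: U_wop)

lemma wop_weq: assumes "x \<doteq> y" shows "wop x = wop y"
proof -
  have "wop a = wop b" if "commute_step \<theta> a b" for a b
    using that
  proof cases
    case (1 i j i' j' p q)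
    have "wop ([Inl i, Inr j] @ q) = wop ([Inr j', Inl i'] @ q)"
      using commutation[OF 1(3)] by (simp flip: blinfun_compose_assoc)
    then show ?thesis unfolding 1 by (subst (1 2) wop_append) simp
  qed
  with assms show ?thesis by (induction rule: equivclp_induct) metis+
qed

lemma comb_wop_mult: "comb wop (comb_mult p q) = comb wop p o\<^sub>L comb wop q"
proof (rule blinfun_eqI)
  fix x
  have "comb wop p (comb (\<lambda>w. wop w x) q) = comb (\<lambda>w. wop w x) (comb_mult p q)"
    by (rule comb_comb_mult) (simp_all add: clinear_wop wop_append)
  then show "comb wop (comb_mult p q) x = (comb wop p o\<^sub>L comb wop q) x"
    by (simp add: blinfun_apply_comb)
qed

lemma unital_alg_eq: "unital_alg U (range S \<union> range T) = range (comb wop)"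
proof
  show "unital_alg U (range S \<union> range T) \<subseteq> range (comb wop)"
  proof
    fix A assume "A \<in> unital_alg U (range S \<union> range T)"
    then show "A \<in> range (comb wop)"
    proof induction
      case unit
      have "comb wop [(1, [])] = U" by (intro blinfun_eqI) (simp add: blinfun.add_left)
      then show ?case by (rule range_eqI[OF sym])
    next
      case (gen A)
      then obtain a where "A = wop [a]"
        using S_bounded_ops T_bounded_ops
        by (auto simp: bounded_ops_def) (metis word_op.simps(1,2), metis word_op.simps(1,3))
      moreover have "comb wop [(1, [a])] = wop [a]" by (intro blinfun_eqI) (simp add: blinfun.add_left)
      ultimately show ?case by (metis rangeI)
    next
      case (add A B)
      then obtain p q where "A = comb wop p" "B = comb wop q" by blast
      then show ?case using rangeI[of "comb wop" "p @ q"] by simp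
    next
      case (scale A c)
      then obtain p where "A = comb wop p" by blast
      then show ?case using rangeI[of "comb wop" "comb_scale c p"] by (simp add: comb_comb_scale_blinfun)
    next
      case (mult A B)
      then obtain p q where "A = comb wop p" "B = comb wop q" by blast
      then show ?case using rangeI[of "comb wop" "comb_mult p q"] by (simp add: comb_wop_mult)
    qed
  qed
  have w: "wop w \<in> unital_alg U (range S \<union> range T)" for w
  proof (induction w)
    case (Cons a w)
    moreover have "S i \<in> unital_alg U (range S \<union> range T)" "T j \<in> unital_alg U (range S \<union> range T)" for i j
      by (simp_all add: unital_alg.gen)
    ultimately show ?case by (cases a) (auto intro: unital_alg.mult)
  qed (simp add: unital_alg.unit)
  have "comb wop p \<in> unital_alg U (range S \<union> range T)" for p
  proof (induction p)
    case Nil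
    have "0 *\<^sub>C U = 0" by (rule blinfun_eqI) simp
    then show ?case using unital_alg.scale[OF unital_alg.unit[of U], of 0] by simp
  next
    case (Cons cw p)
    then show ?case by (cases cw) (auto intro: unital_alg.add unital_alg.scale w)
  qed
  then show "range (comb wop) \<subseteq> unital_alg U (range S \<union> range T)" by blast
qed

lemma rep_alg_eq: "rep_alg U S T = closure (range (comb wop))"
  by (simp add: rep_alg_def closed_unital_alg_def unital_alg_eq)

end

lemma graph_rep_completely_isometrically_isomorphic:
  assumes "graph_rep \<theta> U S T" and "graph_rep \<theta> U' S' T'"
    and "\<And>k p. matrix_norm k (\<lambda>i j. comb (word_op U' S' T') (p i j)) =
      matrix_norm k (\<lambda>i j. comb (word_op U S T) (p i j))"
  shows "completely_isometrically_isomorphic (rep_alg U S T) (rep_alg U' S' T')"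
  unfolding graph_rep.rep_alg_eq[OF assms(1)] graph_rep.rep_alg_eq[OF assms(2)]
proof (rule completely_isometrically_isomorphic_closure)
  show "\<exists>r. comb (word_op U S T) r = comb (word_op U S T) p + comb (word_op U S T) q \<and>
    comb (word_op U' S' T') r = comb (word_op U' S' T') p + comb (word_op U' S' T') q" for p q
    by (intro exI[of _ "p @ q"]) simp
  show "\<exists>r. comb (word_op U S T) r = c *\<^sub>C comb (word_op U S T) p \<and>
    comb (word_op U' S' T') r = c *\<^sub>C comb (word_op U' S' T') p" for c p
    by (intro exI[of _ "comb_scale c p"]) (simp add: comb_comb_scale_blinfun)
  show "\<exists>r. comb (word_op U S T) r = comb (word_op U S T) p o\<^sub>L comb (word_op U S T) q \<and>
    comb (word_op U' S' T') r = comb (word_op U' S' T') p o\<^sub>L comb (word_op U' S' T') q" for p q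
    by (intro exI[of _ "comb_mult p q"])
      (simp add: graph_rep.comb_wop_mult[OF assms(1)] graph_rep.comb_wop_mult[OF assms(2)])
qed (rule assms(3))

section \<open>The left regular representation\<close>

context two_graph
begin

abbreviation "ltr x \<equiv> left_translation \<theta> (sclass \<theta> x)"

text \<open>Left cancellation makes translation injective on the semigroup, so a partial shift
  realizes it; the values on the basis determine this operator, so the definite description denotes
  it.\<close>

lemma left_translation_spec:
  "clinear_op (ltr x) \<and>
    (\<forall>w. ltr x (\<xi> w) = (if w \<in> sgrp \<theta> then \<xi> (smult \<theta> (sclass \<theta> x) w) else 0))"
proof -
  have "inj_on (smult \<theta> (sclass \<theta> x)) (sgrp \<theta>)"
  proof (rule inj_onI)
    fix g h assume "g \<in> sgrp \<theta>" "h \<in> sgrp \<theta>"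
      and eq: "smult \<theta> (sclass \<theta> x) g = smult \<theta> (sclass \<theta> x) h"
    then obtain y z where gh: "g = sclass \<theta> y" "h = sclass \<theta> z" by (meson sgrpE)
    from eq cancel_left[of x y z] show "g = h" unfolding gh smult_sclass sclass_eq_iff by blast
  qed
  from ex_partial_shift[OF this] obtain V :: "('m + 'n) list set ell2 \<Rightarrow>\<^sub>L ('m + 'n) list set ell2" where
    V: "clinear_op V" "\<And>w. V (\<xi> w) = (if w \<in> sgrp \<theta> then \<xi> (smult \<theta> (sclass \<theta> x) w) else 0)" by blast
  show ?thesis unfolding left_translation_def
  proof (rule theI[where a = V])
    show "clinear_op V \<and> (\<forall>w. V (\<xi> w) = (if w \<in> sgrp \<theta> then \<xi> (smult \<theta> (sclass \<theta> x) w) else 0))"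
      using V by blast
    fix V' :: "('m + 'n) list set ell2 \<Rightarrow>\<^sub>L ('m + 'n) list set ell2"
    assume V': "clinear_op V' \<and>
      (\<forall>w. V' (\<xi> w) = (if w \<in> sgrp \<theta> then \<xi> (smult \<theta> (sclass \<theta> x) w) else 0))"
    show "V' = V" by (rule clinear_op_eq_on_basis) (use V V' in simp_all)
  qed
qed

lemma clinear_left_translation: "clinear_op (ltr x)"
  using left_translation_spec by blast

lemma left_translation_basis: "ltr x (\<xi> (sclass \<theta> y)) = \<xi> (sclass \<theta> (x @ y))"
  using left_translation_spec by (simp add: sclass_in_sgrp smult_sclass)

lemma left_translation_not_sgrp: "w \<notin> sgrp \<theta> \<Longrightarrow> ltr x (\<xi> w) = 0"
  using left_translation_spec by simp

lemma left_translation_comp: "ltr x o\<^sub>L ltr y = ltr (x @ y)"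
proof (rule clinear_op_eq_on_basis)
  show "(ltr x o\<^sub>L ltr y) (\<xi> w) = ltr (x @ y) (\<xi> w)" for w
    by (cases "w \<in> sgrp \<theta>")
      (auto elim!: sgrpE simp: left_translation_basis left_translation_not_sgrp)
qed (simp_all add: clinear_left_translation clinear_op_comp)

abbreviation "reg_op \<equiv> word_op (ltr []) (\<lambda>i. ltr [Inl i]) (\<lambda>j. ltr [Inr j])"

lemma reg_op_eq: "reg_op w = ltr w"
proof (induction w)
  case (Cons a w)
  then show ?case by (cases a) (simp_all add: left_translation_comp)
qed simp

lemma left_regular_graph_rep: "graph_rep \<theta> (ltr []) (\<lambda>i. ltr [Inl i]) (\<lambda>j. ltr [Inr j])"
proof unfold_locales
  fix i j i' j' assume "\<theta> (i, j) = (i', j')"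
  then have "sclass \<theta> [Inl i, Inr j] = sclass \<theta> [Inr j', Inl i']"
    by (simp add: sclass_eq_iff weq_swap)
  then show "ltr [Inl i] o\<^sub>L ltr [Inr j] = ltr [Inr j'] o\<^sub>L ltr [Inl i']"
    by (simp add: left_translation_comp)
qed (simp_all add: clinear_left_translation left_translation_comp bounded_ops_def)

lemma left_regular_alg_eq:
  "left_regular_alg \<theta> = rep_alg (ltr []) (\<lambda>i. ltr [Inl i]) (\<lambda>j. ltr [Inr j])"
  by (simp add: left_regular_alg_def e_word_def f_word_def)

section \<open>Words of fixed degree and boxes of degrees\<close>

definition nwords :: "nat \<Rightarrow> nat \<Rightarrow> ('m + 'n) list set" where
  "nwords k l = {nword u v |u v. length u = k \<and> length v = l}"

lemma nwords_deg: "w \<in> nwords k l \<Longrightarrow> edeg w = k \<and> fdeg w = l"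
  by (auto simp: nwords_def)

lemma nwords_0_0: "nwords 0 0 = {[]}"
  by (auto simp: nwords_def nword_simps)

lemma nwordsI: "length u = k \<Longrightarrow> length v = l \<Longrightarrow> nword u v \<in> nwords k l"
  by (auto simp: nwords_def)

text \<open>In a normal form an f-letter stands in front only if there is no e-letter. Sums over
  \<open>nwords\<close> are therefore unfolded along \<open>k\<close>, and along \<open>l\<close>
  only for \<open>k = 0\<close>.\<close>

lemma nwords_0_Suc: "nwords 0 (Suc l) = (\<Union>j. Cons (Inr j) ` nwords 0 l)"
proof (intro equalityI subsetI)
  fix w :: "('m + 'n) list" assume "w \<in> (\<Union>j. Cons (Inr j) ` nwords 0 l)"
  then obtain j v where "w = nword [] (j # v)" "length v = l" by (auto simp: nwords_def nword_simps)
  then show "w \<in> nwords 0 (Suc l)" using nwordsI[of "[]" 0 "j # v"] by simp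
next
  fix w :: "('m + 'n) list" assume "w \<in> nwords 0 (Suc l)"
  then obtain j v where "w = Inr j # nword [] v" "length v = l"
    by (auto simp: nwords_def nword_simps length_Suc_conv)
  then show "w \<in> (\<Union>j. Cons (Inr j) ` nwords 0 l)" using nwordsI[of "[]" 0 v l] by blast
qed

lemma nwords_Suc: "nwords (Suc k) l = (\<Union>i. Cons (Inl i) ` nwords k l)"
proof (intro equalityI subsetI)
  fix w :: "('m + 'n) list" assume "w \<in> (\<Union>i. Cons (Inl i) ` nwords k l)"
  then obtain i u v where "w = nword (i # u) v" "length u = k" "length v = l"
    by (auto simp: nwords_def nword_simps)
  then show "w \<in> nwords (Suc k) l" using nwordsI[of "i # u" "Suc k" v l] by simp
next
  fix w :: "('m + 'n) list" assume "w \<in> nwords (Suc k) l"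
  then obtain i u v where "w = Inl i # nword u v" "length u = k" "length v = l"
    by (auto simp: nwords_def nword_simps length_Suc_conv)
  then show "w \<in> (\<Union>i. Cons (Inl i) ` nwords k l)" using nwordsI[of u k v l] by blast
qed

lemma finite_nwords: "finite (nwords k l)"
proof (induction k)
  case 0
  show ?case by (induction l) (simp_all add: nwords_0_0 nwords_0_Suc)
qed (simp add: nwords_Suc)

lemma sum_nwords_0_Suc: "sum f (nwords 0 (Suc l)) = (\<Sum>j\<in>UNIV. \<Sum>w\<in>nwords 0 l. f (Inr j # w))"
  unfolding nwords_0_Suc by (subst sum.UNION_disjoint) (auto simp: finite_nwords sum.reindex)

lemma sum_nwords_Suc: "sum f (nwords (Suc k) l) = (\<Sum>i\<in>UNIV. \<Sum>w\<in>nwords k l. f (Inl i # w))"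
  unfolding nwords_Suc by (subst sum.UNION_disjoint) (auto simp: finite_nwords sum.reindex)

text \<open>The Foelner sets, one normal form for each element. The whole box is taken with
  \<open>{..<N}\<close>; \<open>{D..<N}\<close> gives its interior, whose elements have initial
  parts of every degree up to \<open>D\<close> in both coordinates.\<close>

definition box :: "nat set \<Rightarrow> ('m + 'n) list set" where
  "box K = (\<Union>k\<in>K. \<Union>l\<in>K. nwords k l)"

lemma box_iff: "w \<in> box K \<longleftrightarrow> (\<exists>u v. w = nword u v) \<and> edeg w \<in> K \<and> fdeg w \<in> K"
  by (auto simp: box_def nwords_def) (metis deg_nword)

lemma finite_box: "finite K \<Longrightarrow> finite (box K)"
  by (simp add: box_def finite_nwords)

lemma sum_box: "finite K \<Longrightarrow> sum f (box K) = (\<Sum>k\<in>K. \<Sum>l\<in>K. sum f (nwords k l))"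
  unfolding box_def
  by (subst sum.UNION_disjoint; (subst sum.UNION_disjoint)?)
    (auto simp: finite_nwords dest: nwords_deg)

lemma box_weq_iff: "x \<in> box K \<Longrightarrow> y \<in> box K \<Longrightarrow> x \<doteq> y \<longleftrightarrow> x = y"
  by (auto simp: box_iff nword_weq_iff)

end

section \<open>Cuntz-type representations\<close>

lemma adj_comp:
  assumes "clinear_op A" "clinear_op B" shows "adj (A o\<^sub>L B) = adj B o\<^sub>L adj A"
  by (rule adj_eqI) (simp add: cinner_adj assms)

lemma adj_id: "adj id_blinfun = id_blinfun"
  by (rule adj_eqI) simp

lemma cinner_adj_left:
  assumes "clinear_op A" shows "cinner (adj A x) y = cinner x (A y)"
  using cinner_adj[OF assms, of y x] cinner_commute by metis

lemma comb_cinner_eq: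
  assumes "\<And>a b. a \<in> snd ` set p \<Longrightarrow> b \<in> snd ` set q \<Longrightarrow> cinner (z a) (z b) = cinner (z' a) (z' b)"
  shows "cinner (comb z p) (comb z q) = cinner (comb z' p) (comb z' q)"
proof -
  have *: "cinner (z a) (comb z q) = cinner (z' a) (comb z' q)" if "a \<in> snd ` set p" for a
    using assms[OF that] by (induction q) (auto simp: cinner_add_right cinner_scaleC_right)
  show ?thesis using * by (induction p) (auto simp: cinner_add_left cinner_scaleC_left)
qed

text \<open>The norm of a combination depends only on the Gram matrix of the vectors. Two families
  can thus be compared without constructing an isometry between their spans.\<close>

lemma comb_norm_eq:
  assumes "\<And>a b. a \<in> snd ` set p \<Longrightarrow> b \<in> snd ` set p \<Longrightarrow> cinner (z a) (z b) = cinner (z' a) (z' b)"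
  shows "norm (comb z p) = norm (comb z' p)"
  unfolding norm_eq_sqrt_cinner by (subst comb_cinner_eq[OF assms]) simp_all

locale cuntz_graph_rep = two_graph \<theta>
  for \<theta> :: "'m :: finite \<times> 'n :: finite \<Rightarrow> 'm \<times> 'n" +
  fixes S :: "'m \<Rightarrow> 'h :: complex_hilbert_space \<Rightarrow>\<^sub>L 'h" and T :: "'n \<Rightarrow> 'h \<Rightarrow>\<^sub>L 'h"
  assumes cuntz: "cuntz_rep \<theta> id_blinfun S T"

sublocale cuntz_graph_rep \<subseteq> graph_rep \<theta> id_blinfun S T
  using cuntz by unfold_locales (auto simp: cuntz_rep_def isometric_rep_def intro: blinfun_eqI)

context cuntz_graph_rep
begin

lemma clinear_S: "clinear_op (S i)" and clinear_T: "clinear_op (T j)"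
  using S_bounded_ops T_bounded_ops by (auto simp: bounded_ops_def)

lemma adj_S_S: "adj (S i) (S j x) = (if i = j then x else 0)"
proof -
  have "adj (S i) o\<^sub>L S j = (if i = j then id_blinfun else 0)"
    using cuntz unfolding cuntz_rep_def isometric_rep_def by blast
  then show ?thesis by (metis blinfun_apply_blinfun_compose blinfun_apply_id_blinfun id_apply zero_blinfun.rep_eq)
qed

lemma adj_T_T: "adj (T i) (T j x) = (if i = j then x else 0)"
proof -
  have "adj (T i) o\<^sub>L T j = (if i = j then id_blinfun else 0)"
    using cuntz unfolding cuntz_rep_def isometric_rep_def by blast
  then show ?thesis by (metis blinfun_apply_blinfun_compose blinfun_apply_id_blinfun id_apply zero_blinfun.rep_eq)
qed

lemma sum_S_adj_S: "(\<Sum>i\<in>UNIV. S i (adj (S i) x)) = x"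
proof -
  have "(\<Sum>i\<in>UNIV. S i o\<^sub>L adj (S i)) = id_blinfun" using cuntz unfolding cuntz_rep_def by blast
  from arg_cong[OF this, of "\<lambda>A. blinfun_apply A x"] show ?thesis by (simp add: blinfun.sum_left)
qed

lemma sum_T_adj_T: "(\<Sum>j\<in>UNIV. T j (adj (T j) x)) = x"
proof -
  have "(\<Sum>j\<in>UNIV. T j o\<^sub>L adj (T j)) = id_blinfun" using cuntz unfolding cuntz_rep_def by blast
  from arg_cong[OF this, of "\<lambda>A. blinfun_apply A x"] show ?thesis by (simp add: blinfun.sum_left)
qed

lemma adj_wop_simps:
  "adj (wop []) x = x"
  "adj (wop (Inl i # w)) x = adj (wop w) (adj (S i) x)"
  "adj (wop (Inr j # w)) x = adj (wop w) (adj (T j) x)"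
  by (simp_all add: adj_comp clinear_S clinear_T clinear_wop adj_id)

lemma adj_wop_append: "adj (wop (x @ y)) v = adj (wop y) (adj (wop x) v)"
  by (simp add: wop_append adj_comp clinear_wop)

text \<open>\<open>y\<close> is rewritten to begin with the kind of letter that \<open>x\<close>
  begins with; the relation for the generators then cancels the two letters or gives 0. Equality of
  the degrees keeps this going down to the empty word.\<close>

lemma adj_wop_wop:
  "edeg x = edeg y \<Longrightarrow> fdeg x = fdeg y \<Longrightarrow> adj (wop x) (wop y v) = (if x \<doteq> y then v else 0)"
proof (induction x arbitrary: y)
  case Nil
  then have "y = []" by (auto simp: edeg_0_iff)
  then show ?case by (simp add: adj_wop_simps(1)[simplified])
next
  case (Cons a x)
  show ?case
  proof (cases a)
    case (Inl i)
    then obtain j z where y: "y \<doteq> Inl j # z" using pull_Inl[of y] Cons.prems by auto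
    have d: "edeg x = edeg z" "fdeg x = fdeg z" using weq_deg[OF y] Cons.prems Inl by auto
    have "a # x \<doteq> y \<longleftrightarrow> Inl i # x \<doteq> Inl j # z" using y Inl by (meson equivclp_trans weq_sym)
    then have "a # x \<doteq> y \<longleftrightarrow> i = j \<and> x \<doteq> z" using weq_Inl_Cons weq_Cons by blast
    moreover have "adj (wop (a # x)) (wop y v) = adj (wop x) (adj (S i) (S j (wop z v)))"
      unfolding wop_weq[OF y] by (simp add: Inl adj_wop_simps(2)[simplified])
    ultimately show ?thesis using Cons.IH[OF d] by (simp add: adj_S_S blinfun.zero_right)
  next
    case (Inr i)
    then obtain j z where y: "y \<doteq> Inr j # z" using pull_Inr[of y] Cons.prems by auto
    have d: "edeg x = edeg z" "fdeg x = fdeg z" using weq_deg[OF y] Cons.prems Inr by auto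
    have "a # x \<doteq> y \<longleftrightarrow> Inr i # x \<doteq> Inr j # z" using y Inr by (meson equivclp_trans weq_sym)
    then have "a # x \<doteq> y \<longleftrightarrow> i = j \<and> x \<doteq> z" using weq_Inr_Cons weq_Cons by blast
    moreover have "adj (wop (a # x)) (wop y v) = adj (wop x) (adj (T i) (T j (wop z v)))"
      unfolding wop_weq[OF y] by (simp add: Inr adj_wop_simps(3)[simplified])
    ultimately show ?thesis using Cons.IH[OF d] by (simp add: adj_T_T blinfun.zero_right)
  qed
qed

text \<open>The Cuntz relations for \<open>S\<close> and \<open>T\<close>, iterated: in every degree
  the range projections of the words sum to the identity.\<close>

lemma wop_expansion: "(\<Sum>w\<in>nwords k l. wop w (adj (wop w) x)) = x"
proof (induction k arbitrary: x)
  case 0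
  show ?case
  proof (induction l arbitrary: x)
    case 0
    show ?case by (simp add: nwords_0_0 adj_wop_simps(1)[simplified])
  next
    case (Suc l)
    have "(\<Sum>w\<in>nwords 0 (Suc l). wop w (adj (wop w) x)) =
        (\<Sum>j\<in>UNIV. T j (\<Sum>w\<in>nwords 0 l. wop w (adj (wop w) (adj (T j) x))))"
      by (simp add: sum_nwords_0_Suc adj_wop_simps(3)[simplified] blinfun.sum_right)
    then show ?case by (simp add: Suc sum_T_adj_T)
  qed
next
  case (Suc k)
  have "(\<Sum>w\<in>nwords (Suc k) l. wop w (adj (wop w) x)) =
      (\<Sum>j\<in>UNIV. S j (\<Sum>w\<in>nwords k l. wop w (adj (wop w) (adj (S j) x))))"
    by (simp add: sum_nwords_Suc adj_wop_simps(2)[simplified] blinfun.sum_right)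
  then show ?case by (simp add: Suc sum_S_adj_S)
qed

lemma norm_expansion: "(\<Sum>w\<in>nwords k l. (norm (adj (wop w) x))\<^sup>2) = (norm x)\<^sup>2"
proof -
  have "complex_of_real ((norm x)\<^sup>2) = cinner (\<Sum>w\<in>nwords k l. wop w (adj (wop w) x)) x"
    by (simp only: wop_expansion cinner_self)
  also have "\<dots> = (\<Sum>w\<in>nwords k l. cinner (adj (wop w) x) (adj (wop w) x))"
    by (simp add: cinner_sum_left cinner_adj clinear_wop)
  also have "\<dots> = complex_of_real (\<Sum>w\<in>nwords k l. (norm (adj (wop w) x))\<^sup>2)"
    by (simp only: cinner_self of_real_sum)
  finally show ?thesis by (simp only: of_real_eq_iff)
qed

text \<open>The degrees in the box number \<open>card K\<close> squared, and each contributes the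
  squared norm of \<open>x\<close> by \<open>norm_expansion\<close>.\<close>

lemma norm_box_expansion:
  "finite K \<Longrightarrow> (\<Sum>w\<in>box K. (norm (adj (wop w) x))\<^sup>2) = (real (card K) * norm x)\<^sup>2"
  by (simp add: sum_box norm_expansion power_mult_distrib) (simp add: power2_eq_square)

lemma cinner_wop_wop_same_deg:
  assumes "edeg x = edeg y" "fdeg x = fdeg y"
  shows "cinner (wop x v) (wop y v') = (if x \<doteq> y then cinner v v' else 0)"
  by (simp add: cinner_adj clinear_wop adj_wop_wop assms)

text \<open>The degrees of \<open>a\<close> and \<open>b\<close> may differ. Expanding
  \<open>y\<close> in the degree of \<open>b\<close> and \<open>z\<close> in the degree of
  \<open>a\<close> leads to words \<open>a @ p\<close> and \<open>b @ q\<close> of equal degree,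
  which cannot represent the same element, as this would be a common multiple.\<close>

lemma cinner_wop_incompat:
  assumes "\<not> compat a b" shows "cinner (wop a y) (wop b z) = 0"
proof -
  let ?N = "nwords (edeg b) (fdeg b)" and ?M = "nwords (edeg a) (fdeg a)"
  have "wop a y = (\<Sum>p\<in>?N. wop (a @ p) (adj (wop p) y))"
    using arg_cong[OF wop_expansion[where k = "edeg b" and l = "fdeg b" and x = y], of "wop a"]
    by (simp add: blinfun.sum_right wop_append)
  moreover have "wop b z = (\<Sum>q\<in>?M. wop (b @ q) (adj (wop q) z))"
    using arg_cong[OF wop_expansion[where k = "edeg a" and l = "fdeg a" and x = z], of "wop b"]
    by (simp add: blinfun.sum_right wop_append)
  moreover have "cinner (wop (a @ p) v) (wop (b @ q) v') = 0" if "p \<in> ?N" "q \<in> ?M" for p q v v'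
  proof -
    have "\<not> a @ p \<doteq> b @ q" using assms unfolding compat_def by blast
    then show ?thesis using nwords_deg[OF that(1)] nwords_deg[OF that(2)]
      by (subst cinner_wop_wop_same_deg) auto
  qed
  ultimately show ?thesis by (simp add: cinner_sum_left cinner_sum_right)
qed

text \<open>One \<open>u\<close> separates all unequal pairs from \<open>Q\<close>. The right-hand
  side uses \<open>\<doteq>\<close> because several words of \<open>Q\<close> may name one element;
  for those the isometry property gives 1.\<close>

lemma ex_orthonormal_orbit:
  assumes ap: "aperiodic \<theta>" and Q: "finite Q" and y: "norm y = 1"
  shows "\<exists>u. \<forall>a\<in>Q. \<forall>b\<in>Q. cinner (wop a (wop u y)) (wop b (wop u y)) = of_bool (a \<doteq> b)"
proof -
  obtain u where u: "\<forall>(a, b) \<in> Q \<times> Q. a \<doteq> b \<or> \<not> compat (a @ u) (b @ u)"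
    using aperiodic_separation[OF ap, of "Q \<times> Q"] Q by blast
  have "cinner (wop (a @ u) y) (wop (b @ u) y) = of_bool (a \<doteq> b)" if "a \<in> Q" "b \<in> Q" for a b
  proof (cases "a \<doteq> b")
    case True
    have "edeg (a @ u) = edeg (b @ u)" "fdeg (a @ u) = fdeg (b @ u)" using weq_deg[OF True] by auto
    from cinner_wop_wop_same_deg[OF this] show ?thesis
      using True weq_append_right[OF True, of u] y by (simp add: cinner_self)
  next
    case False
    then show ?thesis using u that by (auto intro!: cinner_wop_incompat)
  qed
  then show ?thesis by (intro exI[of _ u]) (simp add: wop_append)
qed

end

section \<open>Comparison with the left regular representation\<close>

text \<open>By boundedness it suffices to test vectors \<open>x'\<close> near \<open>x\<close>. A
  bound by the norm of \<open>x\<close> itself suits truncations, which do not increase the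
  norm.\<close>

lemma matrix_norm_leI_approx:
  assumes M: "0 \<le> M"
    and approx: "\<And>x e. 0 < e \<Longrightarrow> \<exists>x'. (\<forall>j<k. norm (x j - x' j) \<le> e) \<and>
      matrix_apply_norm k A x' \<le> M * L2_set (\<lambda>j. norm (x j)) {..<k}"
  shows "matrix_norm k A \<le> M"
proof (rule matrix_norm_leI[OF M])
  fix x
  let ?C = "\<Sum>i<k. \<Sum>j<k. norm (A i j)"
  have C: "0 \<le> ?C" by (intro sum_nonneg) auto
  show "matrix_apply_norm k A x \<le> M * L2_set (\<lambda>j. norm (x j)) {..<k}"
  proof (rule field_le_epsilon)
    fix e :: real assume e: "0 < e"
    \<comment> \<open>Replacing \<open>x\<close> by \<open>x'\<close> costs at most
      \<open>?C * real k * e'\<close>; the summand 1 keeps the divisor positive.\<close>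
    define e' where "e' = e / (?C * real k + 1)"
    have pos: "0 < ?C * real k + 1" using C by (simp add: add_nonneg_pos)
    then have "0 < e'" using e by (simp add: e'_def)
    from approx[OF this] obtain x' where x': "\<And>j. j < k \<Longrightarrow> norm (x j - x' j) \<le> e'"
      "matrix_apply_norm k A x' \<le> M * L2_set (\<lambda>j. norm (x j)) {..<k}" by blast
    have "matrix_apply_norm k A x \<le>
        L2_set (\<lambda>i. norm (\<Sum>j<k. A i j (x' j)) + norm (\<Sum>j<k. A i j (x j - x' j))) {..<k}"
      unfolding matrix_apply_norm_def
    proof (rule L2_set_mono)
      fix i
      have "(\<Sum>j<k. A i j (x j)) = (\<Sum>j<k. A i j (x' j)) + (\<Sum>j<k. A i j (x j - x' j))"
        by (simp add: blinfun.diff_right flip: sum.distrib)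
      then show "norm (\<Sum>j<k. A i j (x j)) \<le>
          norm (\<Sum>j<k. A i j (x' j)) + norm (\<Sum>j<k. A i j (x j - x' j))"
        by (simp add: norm_triangle_ineq)
    qed simp
    also have "\<dots> \<le> matrix_apply_norm k A x' + matrix_apply_norm k A (\<lambda>j. x j - x' j)"
      unfolding matrix_apply_norm_def by (rule L2_set_triangle_ineq)
    also have "\<dots> \<le> M * L2_set (\<lambda>j. norm (x j)) {..<k} + ?C * L2_set (\<lambda>j. norm (x j - x' j)) {..<k}"
      by (intro add_mono x'(2) matrix_apply_norm_le_sum)
    also have "L2_set (\<lambda>j. norm (x j - x' j)) {..<k} \<le> (\<Sum>j<k. norm (x j - x' j))"
      by (rule L2_set_le_sum) simp
    also have "(\<Sum>j<k. norm (x j - x' j)) \<le> (\<Sum>j<k. e')" by (intro sum_mono x') simp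
    also have "?C * (\<Sum>j<k. e') \<le> e"
    proof -
      have "?C * (\<Sum>j<k. e') \<le> (?C * real k + 1) * e'" using \<open>0 < e'\<close> by (simp add: algebra_simps)
      also have "\<dots> = e" using pos by (simp add: e'_def)
      finally show ?thesis .
    qed
    finally show "matrix_apply_norm k A x \<le> M * L2_set (\<lambda>j. norm (x j)) {..<k} + e"
      using C by (simp add: mult_left_mono)
  qed
qed

lemma norm_truncate_le:
  assumes "finite F" shows "norm (\<Sum>w\<in>F. Rep_ell2 f w *\<^sub>C \<xi> w) \<le> norm f"
  unfolding norm_ell2_le_iff
proof (intro allI impI)
  fix G :: "'a set" assume G: "finite G"
  have "L2_set (\<lambda>x. cmod (Rep_ell2 (\<Sum>w\<in>F. Rep_ell2 f w *\<^sub>C \<xi> w) x)) G \<le> L2_set (\<lambda>x. cmod (Rep_ell2 f x)) G"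
    by (rule L2_set_mono) (auto simp: Rep_ell2_sum_basis assms)
  also have "\<dots> \<le> norm f" by (rule L2_set_le_norm_ell2[OF G])
  finally show "L2_set (\<lambda>x. cmod (Rep_ell2 (\<Sum>w\<in>F. Rep_ell2 f w *\<^sub>C \<xi> w) x)) G \<le> norm f" .
qed

context two_graph
begin

abbreviation basis :: "('m + 'n) list \<Rightarrow> ('m + 'n) list set ell2" where
  "basis w \<equiv> \<xi> (sclass \<theta> w)"

lemma cinner_basis_sclass: "cinner (basis a) (basis b) = of_bool (a \<doteq> b)"
  by (simp add: cinner_basis_basis sclass_eq_iff)

lemma comb_reg_op_basis: "comb reg_op p (comb basis q) = comb basis (comb_mult p q)"
  by (rule comb_comb_mult) (simp_all add: reg_op_eq clinear_left_translation left_translation_basis)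

lemma finite_sum_eq_comb_basis:
  assumes "finite F" "F \<subseteq> sgrp \<theta>"
  shows "\<exists>q. (\<Sum>w\<in>F. c w *\<^sub>C \<xi> w) = comb basis q"
  using assms
proof induction
  case empty
  show ?case by (rule exI[of _ "[]"]) simp
next
  case (insert w F)
  then obtain q where q: "(\<Sum>w\<in>F. c w *\<^sub>C \<xi> w) = comb basis q" by auto
  obtain u v where "w = sclass \<theta> (nword u v)" using insert by (auto elim: sgrpE)
  then show ?case using insert q by (intro exI[of _ "(c w, nword u v) # q"]) simp
qed

lemma matrix_norm_reg_op_leI:
  assumes M: "0 \<le> M"
    and le: "\<And>q. matrix_apply_norm k (\<lambda>i j. comb reg_op (p i j)) (\<lambda>j. comb basis (q j)) \<le>
      M * L2_set (\<lambda>j. norm (comb basis (q j))) {..<k}"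
  shows "matrix_norm k (\<lambda>i j. comb reg_op (p i j)) \<le> M"
proof (rule matrix_norm_leI_approx[OF M])
  fix x :: "nat \<Rightarrow> ('m + 'n) list set ell2" and e :: real assume e: "0 < e"
  have "\<exists>F. \<forall>j. finite (F j) \<and> norm (x j - (\<Sum>w\<in>F j. Rep_ell2 (x j) w *\<^sub>C \<xi> w)) \<le> e"
    by (rule choice) (use ell2_approx[OF e] in blast)
  then obtain F where F: "\<And>j. finite (F j)"
    "\<And>j. norm (x j - (\<Sum>w\<in>F j. Rep_ell2 (x j) w *\<^sub>C \<xi> w)) \<le> e" by blast
  define x' where "x' j = (\<Sum>w\<in>F j. Rep_ell2 (x j) w *\<^sub>C \<xi> w)" for j
  \<comment> \<open>\<open>x'\<close> approximates \<open>x\<close> but may have coordinates outside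
    the semigroup. The operators vanish on these, so \<open>x''\<close> has the same image, and it
    is a combination of the vectors \<open>basis w\<close>.\<close>
  define x'' where "x'' j = (\<Sum>w\<in>F j \<inter> sgrp \<theta>. Rep_ell2 (x j) w *\<^sub>C \<xi> w)" for j
  have "reg_op g (x' j) = reg_op g (x'' j)" for g j
    unfolding x'_def x''_def reg_op_eq clinear_op_sum[OF clinear_left_translation]
    by (rule sum.mono_neutral_right) (auto simp: F left_translation_not_sgrp)
  then have eq: "comb reg_op r (x' j) = comb reg_op r (x'' j)" for r j
    by (simp add: blinfun_apply_comb)
  have "\<exists>q. \<forall>j. x'' j = comb basis (q j)"
    by (rule choice) (use finite_sum_eq_comb_basis F in \<open>auto simp: x''_def\<close>)
  then obtain q where q: "\<And>j. x'' j = comb basis (q j)" by blast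
  have "matrix_apply_norm k (\<lambda>i j. comb reg_op (p i j)) x' =
      matrix_apply_norm k (\<lambda>i j. comb reg_op (p i j)) (\<lambda>j. comb basis (q j))"
    unfolding matrix_apply_norm_def eq q ..
  also have "\<dots> \<le> M * L2_set (\<lambda>j. norm (x'' j)) {..<k}" unfolding q by (rule le)
  also have "\<dots> \<le> M * L2_set (\<lambda>j. norm (x j)) {..<k}"
    by (intro mult_left_mono L2_set_mono M) (auto simp: x''_def norm_truncate_le F)
  finally show "\<exists>x'. (\<forall>j<k. norm (x j - x' j) \<le> e) \<and>
      matrix_apply_norm k (\<lambda>i j. comb reg_op (p i j)) x' \<le> M * L2_set (\<lambda>j. norm (x j)) {..<k}"
    using F(2) by (intro exI[of _ x']) (simp add: x'_def)
qed

end

section \<open>Lower estimate from a separated orbit\<close>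

context cuntz_graph_rep
begin

text \<open>Orthonormality of the orbit is a fact about \<open>wop\<close>, while the norm to be
  bounded belongs to the operators on the range of \<open>P\<close>. The orbit starts in that range
  and stays there, where \<open>agree\<close> identifies the two.\<close>

lemma matrix_norm_reg_op_le:
  assumes ap: "aperiodic \<theta>" and gr: "graph_rep \<theta> P S' T'" and P: "P \<noteq> 0"
    and agree: "\<And>w v. P v = v \<Longrightarrow> word_op P S' T' w v = wop w v"
  shows "matrix_norm k (\<lambda>i j. comb reg_op (p i j)) \<le> matrix_norm k (\<lambda>i j. comb (word_op P S' T') (p i j))"
proof (rule matrix_norm_reg_op_leI[OF matrix_norm_nonneg])
  fix q :: "nat \<Rightarrow> (complex \<times> ('m + 'n) list) list"
  interpret R: graph_rep \<theta> P S' T' by fact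
  have PP: "P (P v) = P v" for v using R.U_idem by (metis blinfun_apply_blinfun_compose)
  from P obtain v where v: "P v \<noteq> 0" by (metis blinfun_eqI zero_blinfun.rep_eq)
  define y where "y = inverse (norm (P v)) *\<^sub>R P v"
  have y: "norm y = 1" "P y = y" using v by (simp_all add: y_def blinfun.scaleR_right PP)
  \<comment> \<open>The words of the arguments and those of the products, since norms are compared
    both before and after the matrix is applied.\<close>
  define Q where "Q = (\<Union>i<k. \<Union>j<k. snd ` set (comb_mult (p i j) (q j))) \<union> (\<Union>j<k. snd ` set (q j))"
  have "finite Q" by (simp add: Q_def)
  from ex_orthonormal_orbit[OF ap this y(1)] obtain u where
    u: "\<forall>a\<in>Q. \<forall>b\<in>Q. cinner (wop a (wop u y)) (wop b (wop u y)) = of_bool (a \<doteq> b)" by blast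
  define x where "x = R.wop u y"
  have x: "x = wop u y" using agree[OF y(2)] by (simp add: x_def)
  have "P x = x" using R.U_wop by (metis blinfun_apply_blinfun_compose x_def)
  then have agx: "R.wop w x = wop w x" for w by (rule agree)
  define z where "z w = R.wop w x" for w
  have norm_z: "norm (comb basis r) = norm (comb z r)" if "snd ` set r \<subseteq> Q" for r
  proof (rule comb_norm_eq)
    fix a b assume "a \<in> snd ` set r" "b \<in> snd ` set r"
    with that have "a \<in> Q" "b \<in> Q" by auto
    with u have "cinner (wop a x) (wop b x) = of_bool (a \<doteq> b)" unfolding x by blast
    then show "cinner (basis a) (basis b) = cinner (z a) (z b)"
      unfolding z_def agx cinner_basis_sclass by simp
  qed
  have act: "comb R.wop r (comb z s) = comb z (comb_mult r s)" for r s
    by (rule comb_comb_mult) (simp_all add: z_def R.clinear_wop R.wop_append)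
  have "matrix_apply_norm k (\<lambda>i j. comb reg_op (p i j)) (\<lambda>j. comb basis (q j)) =
      matrix_apply_norm k (\<lambda>i j. comb R.wop (p i j)) (\<lambda>j. comb z (q j))"
    unfolding matrix_apply_norm_def comb_reg_op_basis act comb_concat[symmetric]
  proof (rule L2_set_cong[OF refl], rule norm_z)
    fix i assume "i \<in> {..<k}"
    then have "snd ` set (comb_mult (p i j) (q j)) \<subseteq> Q" if "j < k" for j
      using that unfolding Q_def by blast
    then show "snd ` set (concat (map (\<lambda>j. comb_mult (p i j) (q j)) [0..<k])) \<subseteq> Q"
      by fastforce
  qed
  also have "\<dots> \<le> matrix_norm k (\<lambda>i j. comb R.wop (p i j)) * L2_set (\<lambda>j. norm (comb z (q j))) {..<k}"
    by (rule matrix_apply_norm_le)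
  also have "L2_set (\<lambda>j. norm (comb z (q j))) {..<k} = L2_set (\<lambda>j. norm (comb basis (q j))) {..<k}"
    by (rule L2_set_cong[OF refl], rule norm_z[symmetric]) (auto simp: Q_def)
  finally show "matrix_apply_norm k (\<lambda>i j. comb reg_op (p i j)) (\<lambda>j. comb basis (q j)) \<le>
      matrix_norm k (\<lambda>i j. comb R.wop (p i j)) * L2_set (\<lambda>j. norm (comb basis (q j))) {..<k}" .
qed

section \<open>Upper estimate by Foelner boxes\<close>

text \<open>An initial part \<open>h'\<close> of \<open>h\<close> with the degree of
  \<open>g\<close> meets \<open>wop g\<close> and either cancels it entirely or gives 0. What is
  left is the adjoint of the remaining part of \<open>h\<close>, whose normal form lies in the box
  again.\<close>

lemma adj_wop_wop_factor:
  assumes h: "h \<in> box {..<N}" and g: "edeg g \<le> edeg h" "fdeg g \<le> fdeg h"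
  shows "(\<exists>w\<in>box {..<N}. h \<doteq> g @ w \<and> (\<forall>v. adj (wop h) (wop g v) = adj (wop w) v)) \<or>
    ((\<forall>w. \<not> h \<doteq> g @ w) \<and> (\<forall>v. adj (wop h) (wop g v) = 0))"
proof -
  obtain h' w' where f: "h \<doteq> h' @ w'" "edeg h' = edeg g" "fdeg h' = fdeg g"
    using factor[OF g] by blast
  have fac: "adj (wop h) (wop g v) = adj (wop w') (if h' \<doteq> g then v else 0)" for v
    unfolding wop_weq[OF f(1)] adj_wop_append using adj_wop_wop f by simp
  show ?thesis
  proof (cases "h' \<doteq> g")
    case True
    obtain a b where ab: "normal_form \<theta> w' = (a, b)" by fastforce
    define w where "w = nword a b"
    have w: "w' \<doteq> w" using weq_normal_form[OF ab] by (simp add: w_def)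
    have "edeg w < N" "fdeg w < N" using weq_deg[OF f(1)] weq_deg[OF w] h by (auto simp: box_iff)
    then have "w \<in> box {..<N}" by (auto simp: box_iff w_def)
    moreover have "h \<doteq> g @ w" using f(1) weq_append[OF True w] by (rule equivclp_trans)
    ultimately show ?thesis using fac True wop_weq[OF w] by auto
  next
    case False
    have "\<not> h \<doteq> g @ w" for w
    proof
      assume "h \<doteq> g @ w"
      then have "h' @ w' \<doteq> g @ w" using f(1) by (meson equivclp_trans weq_sym)
      from unique_factor[OF this] f False show False by simp
    qed
    with fac False show ?thesis by (simp add: blinfun.zero_right)
  qed
qed

text \<open>The intertwining relation at the coordinate \<open>h\<close>, tested against
  \<open>s\<close>: both sides pick the only \<open>w\<close> with \<open>g w = h\<close>, or are 0.
  The degree hypothesis keeps \<open>h\<close> away from the boundary, where a part of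
  \<open>g\<close> could be left over.\<close>

lemma cinner_reg_op_box:
  assumes h: "h \<in> box {..<N}" and g: "edeg g \<le> edeg h" "fdeg g \<le> fdeg h"
  shows "cinner (reg_op g (\<Sum>w\<in>box {..<N}. cinner (adj (wop w) x) s *\<^sub>C basis w)) (basis h) =
    cinner (adj (wop h) (wop g x)) s"
proof -
  have "cinner (reg_op g (\<Sum>w\<in>box {..<N}. cinner (adj (wop w) x) s *\<^sub>C basis w)) (basis h) =
      (\<Sum>w\<in>box {..<N}. cinner (adj (wop w) x) s * of_bool (g @ w \<doteq> h))"
    unfolding reg_op_eq clinear_op_sum[OF clinear_left_translation] left_translation_basis
    by (simp add: cinner_sum_left cinner_scaleC_left cinner_basis_sclass)
  also have "\<dots> = cinner (adj (wop h) (wop g x)) s"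
    using adj_wop_wop_factor[OF h g]
  proof (elim disjE bexE conjE)
    fix w0 assume w0: "w0 \<in> box {..<N}" "h \<doteq> g @ w0" "\<forall>v. adj (wop h) (wop g v) = adj (wop w0) v"
    have "g @ w \<doteq> h \<longleftrightarrow> w = w0" if "w \<in> box {..<N}" for w
    proof
      assume "g @ w \<doteq> h"
      then have "g @ w \<doteq> g @ w0" using w0(2) by (rule equivclp_trans)
      from cancel_left[OF this] box_weq_iff[OF that w0(1)] show "w = w0" by simp
    qed (use w0 weq_sym in blast)
    then have "(\<Sum>w\<in>box {..<N}. cinner (adj (wop w) x) s * of_bool (g @ w \<doteq> h)) =
        (\<Sum>w\<in>box {..<N}. if w = w0 then cinner (adj (wop w) x) s else 0)"
      by (intro sum.cong) auto
    then show ?thesis using w0 by (simp add: finite_box)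
  next
    assume *: "\<forall>w. \<not> h \<doteq> g @ w" "\<forall>v. adj (wop h) (wop g v) = 0"
    then have "\<not> g @ w \<doteq> h" for w using weq_sym by blast
    with * show ?thesis by simp
  qed
  finally show ?thesis .
qed

lemma cinner_comb_reg_op_box:
  assumes h: "h \<in> box {..<N}"
    and p: "\<And>g. g \<in> snd ` set p \<Longrightarrow> edeg g \<le> edeg h \<and> fdeg g \<le> fdeg h"
  shows "cinner (comb reg_op p (\<Sum>w\<in>box {..<N}. cinner (adj (wop w) x) s *\<^sub>C basis w)) (basis h) =
    cinner (adj (wop h) (comb wop p x)) s"
  using p
proof (induction p)
  case (Cons cg p)
  obtain c g where cg: "cg = (c, g)" by fastforce
  show ?case using Cons cg cinner_reg_op_box[OF h, of g x s]
    by (simp add: blinfun.add_left cinner_add_left cinner_scaleC_left cinner_adj_left clinear_wop)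
qed (simp add: blinfun.zero_right)

lemma matrix_norm_wop_le:
  "matrix_norm k (\<lambda>i j. comb wop (p i j)) \<le> matrix_norm k (\<lambda>i j. comb reg_op (p i j))"
proof (rule matrix_norm_leI[OF matrix_norm_nonneg])
  fix x :: "nat \<Rightarrow> 'h"
  define M where "M = matrix_norm k (\<lambda>i j. comb reg_op (p i j))"
  define y where "y i = (\<Sum>j<k. comb wop (p i j) (x j))" for i
  define b where "b = L2_set (\<lambda>j. norm (x j)) {..<k}"
  define a where "a = L2_set (\<lambda>i. norm (y i)) {..<k}"
  define Q where "Q = (\<Union>i<k. \<Union>j<k. snd ` set (p i j))"
  have "finite (edeg ` Q \<union> fdeg ` Q)" by (simp add: Q_def)
  then obtain D where "\<forall>d \<in> edeg ` Q \<union> fdeg ` Q. d \<le> D" using finite_nat_set_iff_bounded_le by blast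
  then have D: "edeg g \<le> D \<and> fdeg g \<le> D" if "i < k" "j < k" "g \<in> snd ` set (p i j)" for g i j
  proof -
    have "g \<in> Q" using that unfolding Q_def by blast
    with \<open>\<forall>d \<in> edeg ` Q \<union> fdeg ` Q. d \<le> D\<close> show ?thesis by blast
  qed
  have a2: "a\<^sup>2 = (\<Sum>i<k. (norm (y i))\<^sup>2)" and b2: "b\<^sup>2 = (\<Sum>j<k. (norm (x j))\<^sup>2)"
    by (simp_all add: a_def b_def L2_set_def sum_nonneg)
  \<comment> \<open>\<open>D\<close> bounds the degrees of all words in the polynomials. The
    interior has side \<open>n\<close> and the full box side \<open>D + n\<close>, and their ratio
    tends to 1.\<close>
  have key: "real n * a \<le> M * (real (D + n) * b)" for n
  proof -
    define N where "N = D + n"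
    define G where "G = box {..<N}"
    define G' where "G' = box {D..<N}"
    have fin: "finite G" "finite G'" by (simp_all add: G_def G'_def finite_box)
    have G': "h \<in> G" "D \<le> edeg h" "D \<le> fdeg h" if "h \<in> G'" for h
      using that by (auto simp: G_def G'_def box_iff)
    define X where "X = (\<Union>j<k. (\<lambda>w. adj (wop w) (x j)) ` G)"
    have "finite X" using fin by (simp add: X_def)
    from finite_orthonormal_basis[OF this] obtain E where
      E: "finite E" "\<And>v. v \<in> X \<Longrightarrow> v = (\<Sum>e\<in>E. cinner v e *\<^sub>C e)" by blast
    have E0: "0 = (\<Sum>e\<in>E. cinner 0 e *\<^sub>C e)" by simp
    have Eadd: "v + v' = (\<Sum>e\<in>E. cinner (v + v') e *\<^sub>C e)"
      if "v = (\<Sum>e\<in>E. cinner v e *\<^sub>C e)" "v' = (\<Sum>e\<in>E. cinner v' e *\<^sub>C e)" for v v'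
      using that by (simp add: cinner_add_left scaleC_add_left sum.distrib)
    have Escale: "c *\<^sub>C v = (\<Sum>e\<in>E. cinner (c *\<^sub>C v) e *\<^sub>C e)"
      if "v = (\<Sum>e\<in>E. cinner v e *\<^sub>C e)" for v c
      using arg_cong[OF that, of "\<lambda>v. c *\<^sub>C v"]
      unfolding cinner_scaleC_left scaleC_sum scaleC_scaleC .
    have clin: "clinear_op (adj (wop h))" for h
      unfolding clinear_op_def
      by (intro allI cinner_eqI) (simp add: cinner_scaleC_right clinear_wop flip: cinner_adj)
    \<comment> \<open>For \<open>h\<close> in the interior, a word of the polynomial followed by the
      adjoint of \<open>wop h\<close> sends \<open>x j\<close> into \<open>X\<close> or to 0. Hence
      the finite set \<open>E\<close>, chosen for the inputs, expands the outputs as well.\<close>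
    have span1: "adj (wop h) (comb wop r (x j)) = (\<Sum>e\<in>E. cinner (adj (wop h) (comb wop r (x j))) e *\<^sub>C e)"
      if "h \<in> G'" "j < k" "\<And>g. g \<in> snd ` set r \<Longrightarrow> edeg g \<le> D \<and> fdeg g \<le> D" for h j r
      using that(3)
    proof (induction r)
      case Nil
      show ?case using E0 by (simp add: blinfun.zero_right)
    next
      case (Cons cg r)
      obtain c g where cg: "cg = (c, g)" by fastforce
      have "adj (wop h) (wop g (x j)) \<in> X \<or> adj (wop h) (wop g (x j)) = 0"
        using adj_wop_wop_factor[of h N g] G'[OF that(1)] Cons.prems[of g] that(2)
        by (force simp: cg G_def X_def)
      then have "adj (wop h) (wop g (x j)) = (\<Sum>e\<in>E. cinner (adj (wop h) (wop g (x j))) e *\<^sub>C e)"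
        using E(2) E0 by metis
      from Eadd[OF Escale[OF this, of c] Cons.IH] Cons.prems show ?case
        using clin[of h] by (simp add: cg blinfun.add_left blinfun.add_right clinear_op_def)
    qed
    have span: "adj (wop h) (y i) = (\<Sum>e\<in>E. cinner (adj (wop h) (y i)) e *\<^sub>C e)"
      if "h \<in> G'" "i < k" for h i
    proof -
      have "adj (wop h) (\<Sum>j\<in>J. comb wop (p i j) (x j)) =
          (\<Sum>e\<in>E. cinner (adj (wop h) (\<Sum>j\<in>J. comb wop (p i j) (x j))) e *\<^sub>C e)"
        if "finite J" "J \<subseteq> {..<k}" for J
        using that
      proof induction
        case empty
        show ?case using E0 by (simp add: blinfun.zero_right)
      next
        case (insert j J)
        then have j: "j < k" "J \<subseteq> {..<k}" by auto
        note * = Eadd[OF span1[OF \<open>h \<in> G'\<close> j(1) D[OF \<open>i < k\<close> j(1)]] insert.IH[OF j(2)]]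
        show ?case unfolding sum.insert[OF insert.hyps] blinfun.add_right by (rule *)
      qed
      from this[of "{..<k}"] show ?thesis unfolding y_def by simp
    qed
    txt \<open>The vectors \<open>\<eta> s j\<close>, \<open>s \<in> E\<close>, are the coordinates of \<open>\<Sum>\<^sub>w S_w\<^sup>* x_j \<otimes> \<xi>_w\<close>
      with respect to the orthonormal set \<open>E\<close>, so no tensor product is needed.\<close>
    define \<eta> where "\<eta> s j = (\<Sum>w\<in>G. cinner (adj (wop w) (x j)) s *\<^sub>C basis w)" for s j
    have inj: "inj_on (sclass \<theta>) G"
      by (rule inj_onI) (simp add: G_def sclass_eq_iff box_weq_iff)
    have Rep_eta: "Rep_ell2 (\<eta> s j) g = (if g \<in> sclass \<theta> ` G then
        cinner (adj (wop (inv_into G (sclass \<theta>) g)) (x j)) s else 0)" for s j g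
    proof -
      have "\<eta> s j = (\<Sum>g\<in>sclass \<theta> ` G. cinner (adj (wop (inv_into G (sclass \<theta>) g)) (x j)) s *\<^sub>C \<xi> g)"
        unfolding \<eta>_def by (simp add: sum.reindex[OF inj] inv_into_f_f[OF inj])
      then show ?thesis by (simp add: Rep_ell2_sum_basis fin)
    qed
    have norm_eta: "(norm (\<eta> s j))\<^sup>2 = (\<Sum>w\<in>G. (cmod (cinner (adj (wop w) (x j)) s))\<^sup>2)" for s j
    proof -
      have "of_real ((norm (\<eta> s j))\<^sup>2) =
          (\<Sum>w\<in>G. cnj (cinner (adj (wop w) (x j)) s) * cinner (\<eta> s j) (basis w))"
        unfolding cinner_self[symmetric]
        by (subst (2) \<eta>_def) (simp add: cinner_sum_right cinner_scaleC_right)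
      also have "\<dots> = (\<Sum>w\<in>G. of_real ((cmod (cinner (adj (wop w) (x j)) s))\<^sup>2))"
        by (rule sum.cong[OF refl])
          (simp add: cinner_basis Rep_eta inv_into_f_f[OF inj] complex_norm_square mult.commute
            del: of_real_power)
      finally show ?thesis by (simp only: flip: of_real_sum) (simp only: of_real_eq_iff)
    qed
    \<comment> \<open>On \<open>G'\<close> the coordinates of the image of \<open>\<eta> s\<close>
      are exactly those of \<open>y i\<close>; its other coordinates can only add to the
      norm.\<close>
    have lower: "(\<Sum>h\<in>G'. (cmod (cinner (adj (wop h) (y i)) s))\<^sup>2) \<le>
        (norm (\<Sum>j<k. comb reg_op (p i j) (\<eta> s j)))\<^sup>2" if "i < k" for i s
    proof -
      let ?Y = "\<Sum>j<k. comb reg_op (p i j) (\<eta> s j)"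
      have coeff: "Rep_ell2 ?Y (sclass \<theta> h) = cinner (adj (wop h) (y i)) s" if "h \<in> G'" for h
      proof -
        have "cinner (comb reg_op (p i j) (\<eta> s j)) (basis h) =
            cinner (adj (wop h) (comb wop (p i j) (x j))) s" if "j < k" for j
          unfolding \<eta>_def G_def
        proof (rule cinner_comb_reg_op_box)
          show "h \<in> box {..<N}" using G'(1)[OF \<open>h \<in> G'\<close>] by (simp add: G_def)
          show "edeg g \<le> edeg h \<and> fdeg g \<le> fdeg h" if "g \<in> snd ` set (p i j)" for g
            using D[OF \<open>i < k\<close> \<open>j < k\<close> that] G'[OF \<open>h \<in> G'\<close>] by auto
        qed
        then have "cinner ?Y (basis h) = (\<Sum>j<k. cinner (adj (wop h) (comb wop (p i j) (x j))) s)"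
          by (simp add: cinner_sum_left)
        also have "\<dots> = cinner (adj (wop h) (y i)) s"
          by (simp add: y_def blinfun.sum_right cinner_sum_left)
        finally show ?thesis by (simp add: cinner_basis)
      qed
      have inj': "inj_on (sclass \<theta>) G'" using inj G'(1) by (meson inj_on_subset subsetI)
      have "(\<Sum>h\<in>G'. (cmod (cinner (adj (wop h) (y i)) s))\<^sup>2) =
          (\<Sum>g\<in>sclass \<theta> ` G'. (cmod (Rep_ell2 ?Y g))\<^sup>2)"
        by (simp add: sum.reindex[OF inj'] coeff)
      also have "\<dots> = (L2_set (\<lambda>g. cmod (Rep_ell2 ?Y g)) (sclass \<theta> ` G'))\<^sup>2"
        by (simp add: L2_set_def sum_nonneg)
      also have "\<dots> \<le> (norm ?Y)\<^sup>2"
        by (intro power_mono L2_set_le_norm_ell2) (use fin in auto)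
      finally show ?thesis .
    qed
    \<comment> \<open>The matrix bound is applied separately for each \<open>s\<close>; summing over
      \<open>E\<close> afterwards does the work of an amplification of the regular
      representation.\<close>
    have upper: "(\<Sum>i<k. (norm (\<Sum>j<k. comb reg_op (p i j) (\<eta> s j)))\<^sup>2) \<le> M\<^sup>2 * (\<Sum>j<k. (norm (\<eta> s j))\<^sup>2)" for s
    proof -
      have "(matrix_apply_norm k (\<lambda>i j. comb reg_op (p i j)) (\<eta> s))\<^sup>2 \<le>
          (M * L2_set (\<lambda>j. norm (\<eta> s j)) {..<k})\<^sup>2"
        unfolding M_def by (intro power_mono matrix_apply_norm_le) (simp add: matrix_apply_norm_def)
      then show ?thesis by (simp add: matrix_apply_norm_def L2_set_def sum_nonneg power_mult_distrib)
    qed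
    have "(real n * a)\<^sup>2 = (\<Sum>i<k. (real n * norm (y i))\<^sup>2)"
      by (simp add: power_mult_distrib a2 sum_distrib_left)
    also have "\<dots> = (\<Sum>i<k. \<Sum>h\<in>G'. (norm (adj (wop h) (y i)))\<^sup>2)"
      unfolding G'_def by (simp add: norm_box_expansion N_def)
    also have "\<dots> = (\<Sum>i<k. \<Sum>h\<in>G'. \<Sum>s\<in>E. (cmod (cinner (adj (wop h) (y i)) s))\<^sup>2)"
      by (intro sum.cong refl parseval span) auto
    also have "\<dots> = (\<Sum>i<k. \<Sum>s\<in>E. \<Sum>h\<in>G'. (cmod (cinner (adj (wop h) (y i)) s))\<^sup>2)"
      by (intro sum.cong refl) (rule sum.swap)
    also have "\<dots> \<le> (\<Sum>i<k. \<Sum>s\<in>E. (norm (\<Sum>j<k. comb reg_op (p i j) (\<eta> s j)))\<^sup>2)"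
      by (intro sum_mono lower) simp
    also have "\<dots> = (\<Sum>s\<in>E. \<Sum>i<k. (norm (\<Sum>j<k. comb reg_op (p i j) (\<eta> s j)))\<^sup>2)"
      by (rule sum.swap)
    also have "\<dots> \<le> (\<Sum>s\<in>E. M\<^sup>2 * (\<Sum>j<k. (norm (\<eta> s j))\<^sup>2))" by (intro sum_mono upper)
    also have "\<dots> = M\<^sup>2 * (\<Sum>s\<in>E. \<Sum>j<k. \<Sum>w\<in>G. (cmod (cinner (adj (wop w) (x j)) s))\<^sup>2)"
      by (simp add: sum_distrib_left norm_eta)
    also have "(\<Sum>s\<in>E. \<Sum>j<k. \<Sum>w\<in>G. (cmod (cinner (adj (wop w) (x j)) s))\<^sup>2) =
        (\<Sum>j<k. \<Sum>s\<in>E. \<Sum>w\<in>G. (cmod (cinner (adj (wop w) (x j)) s))\<^sup>2)" by (rule sum.swap)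
    also have "\<dots> = (\<Sum>j<k. \<Sum>w\<in>G. \<Sum>s\<in>E. (cmod (cinner (adj (wop w) (x j)) s))\<^sup>2)"
      by (intro sum.cong refl) (rule sum.swap)
    also have "\<dots> = (\<Sum>j<k. \<Sum>w\<in>G. (norm (adj (wop w) (x j)))\<^sup>2)"
      by (intro sum.cong refl parseval[symmetric] E(2)) (auto simp: X_def)
    also have "\<dots> = (\<Sum>j<k. (real N * norm (x j))\<^sup>2)"
      unfolding G_def by (simp add: norm_box_expansion)
    also have "M\<^sup>2 * \<dots> = (M * (real (D + n) * b))\<^sup>2"
      by (simp add: power_mult_distrib b2 sum_distrib_left N_def)
    finally have "(real n * a)\<^sup>2 \<le> (M * (real (D + n) * b))\<^sup>2" .
    then show ?thesis
      by (rule power2_le_imp_le) (simp add: M_def b_def matrix_norm_nonneg)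
  qed
  \<comment> \<open>\<open>key\<close> bounds \<open>real n * (a - M * b)\<close> by
    \<open>M * D * b\<close> for all \<open>n\<close>, which the Archimedean property excludes if
    the difference is positive.\<close>
  have "a \<le> M * b"
  proof (rule ccontr)
    assume "\<not> a \<le> M * b"
    then have "0 < a - M * b" by simp
    then obtain n where "M * D * b < real n * (a - M * b)" using reals_Archimedean3 by blast
    with key[of n] show False by (simp add: algebra_simps)
  qed
  then show "matrix_apply_norm k (\<lambda>i j. comb wop (p i j)) x \<le>
      matrix_norm k (\<lambda>i j. comb reg_op (p i j)) * L2_set (\<lambda>j. norm (x j)) {..<k}"
    by (simp add: a_def b_def M_def y_def matrix_apply_norm_def)
qed

end

section \<open>Compression to an invariant subspace\<close>

text \<open>A continuous image of a closed set need not be closed; isometry on the values of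
  \<open>\<pi>\<close> makes the preimages of a convergent sequence converge. This identifies the
  compressed algebra with the closed algebra of the compressed generators.\<close>

lemma image_closure_isometric:
  fixes \<kappa> :: "'a :: banach \<Rightarrow> 'b :: real_normed_vector" and \<pi> :: "'p \<Rightarrow> 'a"
  assumes cont: "continuous_on UNIV \<kappa>"
    and iso: "\<And>p q. norm (\<kappa> (\<pi> p) - \<kappa> (\<pi> q)) = norm (\<pi> p - \<pi> q)"
  shows "\<kappa> ` closure (range \<pi>) = closure (range (\<lambda>p. \<kappa> (\<pi> p)))"
proof
  show "\<kappa> ` closure (range \<pi>) \<subseteq> closure (range (\<lambda>p. \<kappa> (\<pi> p)))"
    by (rule image_closure_subset)
      (auto intro: continuous_on_subset[OF cont] subsetD[OF closure_subset])
  show "closure (range (\<lambda>p. \<kappa> (\<pi> p))) \<subseteq> \<kappa> ` closure (range \<pi>)"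
  proof
    fix b assume "b \<in> closure (range (\<lambda>p. \<kappa> (\<pi> p)))"
    then obtain Z where Z: "(\<forall>n. Z n \<in> range (\<lambda>p. \<kappa> (\<pi> p))) \<and> Z \<longlonglongrightarrow> b"
      unfolding closure_sequential by (rule exE)
    then have "\<forall>n. \<exists>p. Z n = \<kappa> (\<pi> p)" by blast
    then obtain X where "\<forall>n. Z n = \<kappa> (\<pi> (X n))" by (rule choice[THEN exE])
    then have "Z = (\<lambda>n. \<kappa> (\<pi> (X n)))" by (simp add: fun_eq_iff)
    with Z have X: "(\<lambda>n. \<kappa> (\<pi> (X n))) \<longlonglongrightarrow> b" by simp
    obtain a where a: "(\<lambda>n. \<pi> (X n)) \<longlonglongrightarrow> a"
      using cauchy_transfer[of "\<lambda>n. \<pi> (X n)", OF iso[symmetric] X] by blast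
    have "isCont \<kappa> a" using cont by (simp add: continuous_on_eq_continuous_at)
    from isCont_tendsto_compose[OF this a] X have "b = \<kappa> a" by (rule LIMSEQ_unique[rotated])
    moreover have "a \<in> closure (range \<pi>)" unfolding closure_sequential
      by (rule exI[where x = "\<lambda>n. \<pi> (X n)"]) (simp add: a)
    ultimately show "b \<in> \<kappa> ` closure (range \<pi>)" by blast
  qed
qed

locale cuntz_invariant_projection = cuntz_graph_rep \<theta> S T
  for \<theta> :: "'m :: finite \<times> 'n :: finite \<Rightarrow> 'm \<times> 'n"
    and S :: "'m \<Rightarrow> 'h :: complex_hilbert_space \<Rightarrow>\<^sub>L 'h" and T :: "'n \<Rightarrow> 'h \<Rightarrow>\<^sub>L 'h" +
  fixes P :: "'h \<Rightarrow>\<^sub>L 'h"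
  assumes projection: "projection_op P"
    and invariant: "\<forall>A \<in> rep_alg id_blinfun S T. \<forall>x \<in> range P. A x \<in> range P"
begin

abbreviation "PS \<equiv> \<lambda>i. P o\<^sub>L S i o\<^sub>L P"
abbreviation "PT \<equiv> \<lambda>j. P o\<^sub>L T j o\<^sub>L P"

lemma clinear_P: "clinear_op P" and P_comp_P: "P o\<^sub>L P = P" and adj_P: "adj P = P"
  using projection by (auto simp: projection_op_def)

lemma P_P: "P (P x) = P x"
  using P_comp_P by (metis blinfun_apply_blinfun_compose)

lemma norm_P_le: "norm (P x) \<le> norm x"
proof -
  have "complex_of_real ((norm (P x))\<^sup>2) = cinner x (P x)"
    using cinner_adj[OF clinear_P, of x "P x"] by (simp only: cinner_self adj_P P_P)
  then have "(norm (P x))\<^sup>2 = cmod (cinner x (P x))"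
    by (metis norm_of_real abs_of_nonneg zero_le_power2)
  also have "\<dots> \<le> norm x * norm (P x)" by (rule cinner_cauchy_schwarz)
  finally show ?thesis by (cases "norm (P x) = 0") (simp_all add: power2_eq_square)
qed

lemma P_S: "P x = x \<Longrightarrow> P (S i x) = S i x" and P_T: "P x = x \<Longrightarrow> P (T j x) = T j x"
proof -
  have "unital_alg id_blinfun (range S \<union> range T) \<subseteq> rep_alg id_blinfun S T"
    unfolding rep_alg_def closed_unital_alg_def by (rule closure_subset)
  then have *: "S i \<in> rep_alg id_blinfun S T" "T j \<in> rep_alg id_blinfun S T"
    using unital_alg.gen[of "S i" "range S \<union> range T" id_blinfun]
      unital_alg.gen[of "T j" "range S \<union> range T" id_blinfun] by auto
  assume x: "P x = x"
  then have "x \<in> range P" by (metis rangeI)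
  with * invariant have "S i x \<in> range P" "T j x \<in> range P" by auto
  then show "P (S i x) = S i x" "P (T j x) = T j x" using P_P by auto
qed

text \<open>By invariance \<open>P\<close> fixes \<open>S j (P x)\<close> and
  \<open>T j (P x)\<close>. The projections inside a product of compressed operators therefore
  disappear, and the relations of \<open>S\<close> and \<open>T\<close> remain, cut down to
  \<open>P\<close>.\<close>

lemma isometric_rep_compression: "isometric_rep \<theta> P PS PT"
  unfolding isometric_rep_def
proof (intro conjI allI impI)
  have clin: "clinear_op (P o\<^sub>L S i)" "clinear_op (P o\<^sub>L T j)" for i j
    by (simp_all add: clinear_op_comp clinear_P clinear_S clinear_T)
  show "PS i \<in> bounded_ops P" "PT j \<in> bounded_ops P" for i j
    unfolding bounded_ops_def using clinear_P clinear_S clinear_T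
    by (auto intro!: blinfun_eqI clinear_op_comp simp: P_P)
  show "adj (PS i) o\<^sub>L PS j = (if i = j then P else 0)" for i j
    by (rule blinfun_eqI)
      (simp add: adj_comp clin clinear_P clinear_S adj_P P_S P_P adj_S_S blinfun.zero_right)
  show "adj (PT i) o\<^sub>L PT j = (if i = j then P else 0)" for i j
    by (rule blinfun_eqI)
      (simp add: adj_comp clin clinear_P clinear_T adj_P P_T P_P adj_T_T blinfun.zero_right)
  fix i j i' j' assume "\<theta> (i, j) = (i', j')"
  from commutation[OF this] have "S i (T j x) = T j' (S i' x)" for x
    by (metis blinfun_apply_blinfun_compose)
  then show "PS i o\<^sub>L PT j = PT j' o\<^sub>L PS i'"
    by (intro blinfun_eqI) (simp add: P_S P_T P_P)
qed

lemma graph_rep_compression: "graph_rep \<theta> P PS PT"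
  using isometric_rep_compression unfolding isometric_rep_def
  by unfold_locales (auto simp: clinear_P P_comp_P)

lemma word_op_compression: "P x = x \<Longrightarrow> word_op P PS PT w x = wop w x \<and> P (wop w x) = wop w x"
proof (induction w)
  case (Cons a w)
  then show ?case by (cases a) (auto simp: P_S P_T)
qed simp

lemma word_op_compression_apply: "word_op P PS PT w x = wop w (P x)"
  using graph_rep.wop_U[OF graph_rep_compression, of w] word_op_compression[of "P x" w]
  by (metis P_P blinfun_apply_blinfun_compose)

text \<open>Compression is multiplicative here, since every factor keeps a vector of the range of
  \<open>P\<close> in that range: a word in the compressed generators is the compressed
  word.\<close>

lemma comb_compression: "comb (word_op P PS PT) p = P o\<^sub>L comb wop p o\<^sub>L P"
  by (rule blinfun_eqI)
    (simp add: blinfun_apply_comb clinear_op_comb[OF clinear_P] word_op_compression_apply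
      word_op_compression[OF P_P])

lemma matrix_norm_compression_le:
  "matrix_norm k (\<lambda>i j. comb (word_op P PS PT) (p i j)) \<le> matrix_norm k (\<lambda>i j. comb wop (p i j))"
proof (rule matrix_norm_leI[OF matrix_norm_nonneg])
  fix x :: "nat \<Rightarrow> 'h"
  have "matrix_apply_norm k (\<lambda>i j. comb (word_op P PS PT) (p i j)) x =
      matrix_apply_norm k (\<lambda>i j. comb wop (p i j)) (\<lambda>j. P (x j))"
    by (simp add: matrix_apply_norm_def blinfun_apply_comb word_op_compression_apply)
  also have "\<dots> \<le> matrix_norm k (\<lambda>i j. comb wop (p i j)) * L2_set (\<lambda>j. norm (P (x j))) {..<k}"
    by (rule matrix_apply_norm_le)
  also have "\<dots> \<le> matrix_norm k (\<lambda>i j. comb wop (p i j)) * L2_set (\<lambda>j. norm (x j)) {..<k}"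
    by (intro mult_left_mono L2_set_mono matrix_norm_nonneg norm_P_le) auto
  finally show "matrix_apply_norm k (\<lambda>i j. comb (word_op P PS PT) (p i j)) x \<le>
      matrix_norm k (\<lambda>i j. comb wop (p i j)) * L2_set (\<lambda>j. norm (x j)) {..<k}" .
qed

context
  assumes aperiodic: "aperiodic \<theta>" and P_nonzero: "P \<noteq> 0"
begin

text \<open>The cycle of estimates closes. The first equation yields the isomorphism with the left
  regular algebra; the second makes compression isometric on polynomials, which identifies its
  image.\<close>

lemma matrix_norm_compression:
  "matrix_norm k (\<lambda>i j. comb reg_op (p i j)) = matrix_norm k (\<lambda>i j. comb (word_op P PS PT) (p i j))"
  "matrix_norm k (\<lambda>i j. comb wop (p i j)) = matrix_norm k (\<lambda>i j. comb (word_op P PS PT) (p i j))"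
  using matrix_norm_compression_le[of k p] matrix_norm_wop_le[of k p]
    matrix_norm_reg_op_le[OF aperiodic graph_rep_compression P_nonzero, of k p] word_op_compression
  by fastforce+

lemma compression_image_rep_alg:
  "(\<lambda>A. P o\<^sub>L A o\<^sub>L P) ` rep_alg id_blinfun S T = rep_alg P PS PT"
  unfolding rep_alg_eq graph_rep.rep_alg_eq[OF graph_rep_compression] comb_compression
proof (rule image_closure_isometric)
  show "continuous_on UNIV (\<lambda>A. P o\<^sub>L A o\<^sub>L P)" by (intro continuous_intros)
  show "norm ((P o\<^sub>L comb wop p o\<^sub>L P) - (P o\<^sub>L comb wop q o\<^sub>L P)) = norm (comb wop p - comb wop q)" for p q
  proof -
    \<comment> \<open>A difference of values is the value of a polynomial again, so the equality of
      norms applies to it.\<close>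
    have eq: "comb Z (p @ comb_scale (-1) q) = comb Z p - comb Z q"
      for Z :: "('m + 'n) list \<Rightarrow> 'h \<Rightarrow>\<^sub>L 'h"
      by (rule blinfun_eqI)
        (simp add: comb_comb_scale_blinfun blinfun.add_left blinfun.diff_left blinfun.minus_left)
    show ?thesis
      using matrix_norm_compression(2)[of 1 "\<lambda>_ _. p @ comb_scale (-1) q"]
      unfolding eq norm_eq_matrix_norm[symmetric] comb_compression by simp
  qed
qed

lemma rep_alg_compression_isomorphic:
  "completely_isometrically_isomorphic (rep_alg P PS PT) (left_regular_alg \<theta>)"
  unfolding left_regular_alg_eq
  by (rule graph_rep_completely_isometrically_isomorphic[OF graph_rep_compression left_regular_graph_rep])
    (rule matrix_norm_compression(1))

end

end

theorem theorem3p4: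
  fixes \<theta> :: "'m :: finite \<times> 'n :: finite \<Rightarrow> 'm \<times> 'n"
    and S :: "'m \<Rightarrow> 'h :: complex_hilbert_space \<Rightarrow>\<^sub>L 'h"
    and T :: "'n \<Rightarrow> 'h \<Rightarrow>\<^sub>L 'h"
    and P :: "'h \<Rightarrow>\<^sub>L 'h"
  assumes "bij \<theta>"
    and "aperiodic \<theta>"
    and "cuntz_rep \<theta> id_blinfun S T"
    and "projection_op P" and "P \<noteq> 0"
    and "\<forall>A \<in> rep_alg id_blinfun S T. \<forall>x \<in> range P. A x \<in> range P"
  shows "completely_isometrically_isomorphic
          ((\<lambda>A. P o\<^sub>L A o\<^sub>L P) ` rep_alg id_blinfun S T) (left_regular_alg \<theta>)
      \<and> rigid \<theta> P (\<lambda>i. P o\<^sub>L S i o\<^sub>L P) (\<lambda>j. P o\<^sub>L T j o\<^sub>L P)"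
proof -
  interpret cuntz_invariant_projection \<theta> S T P
    using assms by unfold_locales
  show ?thesis
    unfolding rigid_def compression_image_rep_alg[OF assms(2,5)]
    using rep_alg_compression_isomorphic[OF assms(2,5)] isometric_rep_compression by blast
qed

end
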